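(* Let $\mathbb{K}$ be a field. For $i=1,2$ let $G_i$ be a Cohen–Macaulay bipartite graph with a leaf $u_i$, let $N_{G_i}(u_i)=\{v_i\}$, and let $G=(G_1,u_1)\circ(G_2,u_2)$. Then $$\operatorname{depth}(S_G/I_G)=\operatorname{depth}(S_{G_1}/I_{G_1})+\operatorname{depth}(S_{G_2}/I_{G_2})-s,$$ where $s=1$ if $\deg_{G_i}(v_i)=1$ for all $i\in\{1,2\}$, and $s=2$ otherwise.
   Context: Graphs are finite and simple; the graphs $G_1,G_2$ are assumed to have no isolated vertices (the graph $G$ constructed from them may have isolated vertices). For a graph $H$ with vertex set $V(H)$ and edge set $E(H)$, $S_H=\mathbb{K}[V(H)]$ is the standard graded polynomial ring over $\mathbb{K}$ whose variables are the vertices of $H$, and $I_H=(uv \mid \{u,v\}\in E(H))\subset S_H$ is the edge ideal (it is $0$ if $H$ has no edges). $H$ is called Cohen–Macaulay if $S_H/I_H$ is a Cohen–Macaulay ring. $N_H(v)=\{u \mid \{u,v\}\in E(H)\}$ is the neighborhood of $v$, $\deg_H(v)=|N_H(v)|$, and $v$ is a leaf if $\deg_H(v)=1$. The $\circ$ operation: let $G_1,G_2$ be graphs on disjoint vertex sets, $u_i$ a leaf of $G_i$, and $N_{G_i}(u_i)=\{v_i\}$. Then $(G_1,u_1)\circ(G_2,u_2)$ is the graph obtained by first removing the leaves $u_1,u_2$ from $G_1$ and $G_2$ and then identifying the vertices $v_1$ and $v_2$. *)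

theory Defs
  imports "HOL-Library.Poly_Mapping" "HOL-Library.Extended_Nat"
    "HOL-Algebra.QuotRing" "HOL-Algebra.Ring_Divisibility"
begin

section \<open>Graphs\<close>

record 'v graph =
  verts :: "'v set"
  edges :: "'v set set"

definition simple_graph :: "'v graph \<Rightarrow> bool" where
  "simple_graph H \<longleftrightarrow> finite (verts H) \<and> (\<forall>e\<in>edges H. e \<subseteq> verts H \<and> card e = 2)"

definition neighborhood :: "'v graph \<Rightarrow> 'v \<Rightarrow> 'v set" where
  "neighborhood H v = {u. {u, v} \<in> edges H}"

definition vdegree :: "'v graph \<Rightarrow> 'v \<Rightarrow> nat" where
  "vdegree H v = card (neighborhood H v)"

definition leaf :: "'v graph \<Rightarrow> 'v \<Rightarrow> bool" where
  "leaf H v \<longleftrightarrow> v \<in> verts H \<and> vdegree H v = 1"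

definition no_isolated_vertices :: "'v graph \<Rightarrow> bool" where
  "no_isolated_vertices H \<longleftrightarrow> (\<forall>v\<in>verts H. neighborhood H v \<noteq> {})"

definition bipartite :: "'v graph \<Rightarrow> bool" where
  "bipartite H \<longleftrightarrow> (\<exists>A B. A \<union> B = verts H \<and> A \<inter> B = {} \<and>
     (\<forall>e\<in>edges H. \<exists>a\<in>A. \<exists>b\<in>B. e = {a, b}))"

definition remove_vertex :: "'v graph \<Rightarrow> 'v \<Rightarrow> 'v graph" where
  "remove_vertex H u = \<lparr>verts = verts H - {u}, edges = {e \<in> edges H. u \<notin> e}\<rparr>"

definition map_graph :: "('v \<Rightarrow> 'w) \<Rightarrow> 'v graph \<Rightarrow> 'w graph" where
  "map_graph f H = \<lparr>verts = f ` verts H, edges = (\<lambda>e. f ` e) ` edges H\<rparr>"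

definition graph_union :: "'v graph \<Rightarrow> 'v graph \<Rightarrow> 'v graph" where
  "graph_union H H' = \<lparr>verts = verts H \<union> verts H', edges = edges H \<union> edges H'\<rparr>"

text \<open>For graphs on disjoint vertex sets. The vertex obtained by identifying the neighbours
  \<open>v1\<close>, \<open>v2\<close> of the leaves is represented by \<open>v1\<close>, i.e. \<open>v2\<close> is renamed to \<open>v1\<close>.\<close>

definition circ :: "'v graph \<Rightarrow> 'v \<Rightarrow> 'v graph \<Rightarrow> 'v \<Rightarrow> 'v graph" where
  "circ G1 u1 G2 u2 =
     (let v1 = the_elem (neighborhood G1 u1); v2 = the_elem (neighborhood G2 u2)
      in graph_union (remove_vertex G1 u1) (map_graph (id(v2 := v1)) (remove_vertex G2 u2)))"

section \<open>Depth and Cohen--Macaulay rings\<close>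

text \<open>\<open>x\<^sub>1, \<dots>, x\<^sub>n\<close> is regular if each \<open>x\<^sub>i\<close> is a nonzerodivisor modulo
  \<open>(x\<^sub>1, \<dots>, x\<^sub>i\<^sub>-\<^sub>1)\<close> and \<open>(x\<^sub>1, \<dots>, x\<^sub>n) \<noteq> R\<close>.\<close>

definition regular_sequence :: "('a, 'b) ring_scheme \<Rightarrow> 'a list \<Rightarrow> bool" where
  "regular_sequence R xs \<longleftrightarrow> set xs \<subseteq> carrier R \<and> genideal R (set xs) \<noteq> carrier R \<and>
     (\<forall>i<length xs. \<forall>a\<in>carrier R.
        xs ! i \<otimes>\<^bsub>R\<^esub> a \<in> genideal R (set (take i xs)) \<longrightarrow> a \<in> genideal R (set (take i xs)))"

definition ideal_depth :: "('a, 'b) ring_scheme \<Rightarrow> 'a set \<Rightarrow> enat" where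
  "ideal_depth R J = Sup {enat (length xs) |xs. regular_sequence R xs \<and> set xs \<subseteq> J}"

definition prime_height :: "('a, 'b) ring_scheme \<Rightarrow> 'a set \<Rightarrow> enat" where
  "prime_height R P = Sup {enat n |n. \<exists>Q :: nat \<Rightarrow> 'a set.
     (\<forall>i\<le>n. primeideal (Q i) R) \<and> (\<forall>i<n. Q i \<subset> Q (Suc i)) \<and> Q n = P}"

text \<open>The definition of Eisenbud, \<^emph>\<open>Commutative Algebra\<close>, Section 18.2. As \<open>M\<close> is maximal, its
  depth and height are those of the localization \<open>R\<^sub>M\<close>, so this says that all \<open>R\<^sub>M\<close> are
  Cohen--Macaulay local rings.\<close>

definition cohen_macaulay_ring :: "('a, 'b) ring_scheme \<Rightarrow> bool" where
  "cohen_macaulay_ring R \<longleftrightarrow> cring R \<and> noetherian_ring R \<and>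
     (\<forall>M. maximalideal M R \<longrightarrow> ideal_depth R M = prime_height R M)"

section \<open>Edge ideals\<close>

text \<open>The full type \<open>('v \<Rightarrow>\<^sub>0 nat) \<Rightarrow>\<^sub>0 'k\<close> is the polynomial ring in variables indexed by all of
  \<open>'v\<close>; exponent vectors are finitely supported functions \<open>'v \<Rightarrow>\<^sub>0 nat\<close>.\<close>

type_synonym ('v, 'k) mpolynomial = "('v \<Rightarrow>\<^sub>0 nat) \<Rightarrow>\<^sub>0 'k"

definition mvar :: "'v \<Rightarrow> ('v, 'k::field) mpolynomial" where
  "mvar v = Poly_Mapping.single (Poly_Mapping.single v 1) 1"

definition polynomial_ring :: "'v set \<Rightarrow> ('v, 'k::field) mpolynomial ring" where
  "polynomial_ring V =
     \<lparr>carrier = {p. \<forall>m\<in>Poly_Mapping.keys p. Poly_Mapping.keys m \<subseteq> V},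
      mult = (*), one = 1, zero = 0, add = (+)\<rparr>"

definition edge_ideal :: "'v graph \<Rightarrow> ('v, 'k::field) mpolynomial set" where
  "edge_ideal H = genideal (polynomial_ring (verts H)) {mvar u * mvar v |u v. {u, v} \<in> edges H}"

definition edge_ring :: "'v graph \<Rightarrow> ('v, 'k::field) mpolynomial set ring" where
  "edge_ring H = polynomial_ring (verts H) Quot edge_ideal H"

text \<open>The graded maximal ideal of \<open>S\<^sub>H / I\<^sub>H\<close>, generated by the residue classes of the
  variables.\<close>

definition irrelevant_ideal :: "'v graph \<Rightarrow> ('v, 'k::field) mpolynomial set set" where
  "irrelevant_ideal H = genideal (edge_ring H)
     {edge_ideal H +>\<^bsub>polynomial_ring (verts H)\<^esub> mvar v |v. v \<in> verts H}"

text \<open>The depth of \<open>S\<^sub>H / I\<^sub>H\<close> as a standard graded algebra over the field \<open>'k\<close>. Sequences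
  in the graded maximal ideal of \<open>S\<^sub>H / I\<^sub>H\<close> being regular there is the same as lifts to the
  graded maximal ideal of \<open>S\<^sub>H\<close> being regular on the \<open>S\<^sub>H\<close>-module \<open>S\<^sub>H / I\<^sub>H\<close>.\<close>

definition edge_ring_depth :: "'k::field itself \<Rightarrow> 'v graph \<Rightarrow> enat" where
  "edge_ring_depth _ H =
     ideal_depth (edge_ring H :: ('v, 'k) mpolynomial set ring) (irrelevant_ideal H)"

definition cohen_macaulay_graph :: "'k::field itself \<Rightarrow> 'v graph \<Rightarrow> bool" where
  "cohen_macaulay_graph _ H \<longleftrightarrow>
     cohen_macaulay_ring (edge_ring H :: ('v, 'k) mpolynomial set ring)"

end

theory Submission imports Defs begin

text \<open>A Cohen--Macaulay bipartite graph without isolated vertices has a perfect matching with the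
properties found by Herzog and Hibi: neighbours \<open>w\<close>, \<open>w'\<close> of the two ends of a matched edge
are adjacent to each other, and they form a matched edge only if it is the given one. The depth of
the edge ring is the number of matched edges (\<open>cohen_macaulay_bipartite_foldable\<close>). In \<open>G\<close> the edges
\<open>u1 v1\<close> and \<open>u2 v2\<close> have disappeared, and the other \<open>d1 + d2 - 2\<close> matched edges cover
everything but the vertex \<open>v\<close> obtained from \<open>v1\<close> and \<open>v2\<close>.

For the lower bound, the differences \<open>x - y\<close> over these matched edges form a regular sequence.
Dividing by some of them identifies the ends of matched edges, and the result is again a quotient
by a monomial ideal (\<open>folded_ideal_iff\<close>), where a difference of two variables is a
nonzerodivisor by a condition on single monomials (\<open>mvar_diff_nonzerodivisor\<close>). If \<open>v\<close>
is isolated, which happens exactly for \<open>s = 1\<close>, then \<open>v\<close> is a free variable and prolongs the sequence.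

For the upper bound, the depth is at most the size of any maximal independent set \<open>F\<close>
(\<open>depth_le_maximal_independent\<close>). An independent set contains at most one end of a matched edge, so one
without \<open>v\<close> has at most \<open>d1 + d2 - 2\<close> elements, and there is a maximal one of this kind if
\<open>v\<close> has a neighbour.

A regular sequence consists here of arbitrary, possibly inhomogeneous elements of the graded
maximal ideal, and its length is bounded by a direct argument. The powers of the ideal
generated by a regular sequence \<open>f\<close> behave like the powers of the ideal of the variables in a
polynomial ring (\<open>quasi_regular\<close>, a theorem of Rees), so elements have initial terms
in the monomials of \<open>f\<close>, and these are multiplicative for multiplication by polynomials
in \<open>f\<close> with coefficients in the field (\<open>initial_ev_mult\<close>). Hence no nonzero polynomial in \<open>f\<close> kills a
nonzero element. But the product of the vertices of \<open>F\<close> is killed by all other variables, so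
modulo its annihilator the entries of \<open>f\<close> become polynomials in the variables \<open>F\<close>, and more than
\<open>card F\<close> of them are algebraically dependent.

The Cohen--Macaulay property is used at the graded maximal ideal. Its height is at least the
size of every independent set, so depth and height can agree only if all maximal independent sets have
the same size (\<open>cohen_macaulay_depth\<close>). Hall's theorem then gives the perfect matching, and the
adjacency of \<open>w\<close> and \<open>w'\<close> follows by counting. That no two matched edges span a cycle of length four is
a stronger property than equal sizes. It comes from \<open>depth_le_pinched_pair\<close>, which applies the
argument about initial terms to fractions \<open>z / (x - y)\<close> (\<open>approximate_quotient\<close>); it plays
the role of the connectedness of Cohen--Macaulay complexes.\<close>

abbreviation "keys \<equiv> Poly_Mapping.keys"
abbreviation "lookup \<equiv> Poly_Mapping.lookup"
abbreviation "single \<equiv> Poly_Mapping.single"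

section \<open>Exponent vectors\<close>

definition tdeg :: "('v \<Rightarrow>\<^sub>0 nat) \<Rightarrow> nat" where
  "tdeg \<alpha> = (\<Sum>i\<in>keys \<alpha>. lookup \<alpha> i)"

definition mon_eval :: "('v \<Rightarrow> 'a::comm_monoid_mult) \<Rightarrow> ('v \<Rightarrow>\<^sub>0 nat) \<Rightarrow> 'a" where
  "mon_eval f \<alpha> = (\<Prod>i\<in>keys \<alpha>. f i ^ lookup \<alpha> i)"

lemma keys_add_nat:
  fixes \<alpha> \<beta> :: "'v \<Rightarrow>\<^sub>0 nat"
  shows "keys (\<alpha> + \<beta>) = keys \<alpha> \<union> keys \<beta>"
  by (auto simp: in_keys_iff lookup_add)

lemma tdeg_superset:
  assumes "finite A" "keys \<alpha> \<subseteq> A"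
  shows "tdeg \<alpha> = (\<Sum>i\<in>A. lookup \<alpha> i)"
  unfolding tdeg_def using assms by (intro sum.mono_neutral_left) (auto simp: in_keys_iff)

lemma tdeg_add: "tdeg (\<alpha> + \<beta>) = tdeg \<alpha> + tdeg \<beta>"
proof -
  let ?A = "keys \<alpha> \<union> keys \<beta>"
  have "tdeg (\<alpha> + \<beta>) = (\<Sum>i\<in>?A. lookup (\<alpha> + \<beta>) i)"
    by (rule tdeg_superset) (auto simp: keys_add_nat)
  also have "\<dots> = (\<Sum>i\<in>?A. lookup \<alpha> i) + (\<Sum>i\<in>?A. lookup \<beta> i)"
    by (simp add: lookup_add sum.distrib)
  also have "\<dots> = tdeg \<alpha> + tdeg \<beta>"
    by (subst (1 2) tdeg_superset[where A = ?A]) auto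
  finally show ?thesis .
qed

lemma tdeg_single [simp]: "tdeg (single i n) = n"
  by (cases "n = 0") (auto simp: tdeg_def)

lemma tdeg_zero [simp]: "tdeg 0 = 0"
  by (simp add: tdeg_def)

lemma tdeg_eq_0_iff: "tdeg \<alpha> = 0 \<longleftrightarrow> \<alpha> = 0"
  by (auto simp: tdeg_def in_keys_iff intro!: poly_mapping_eqI)

lemma mon_eval_superset:
  assumes "finite A" "keys \<alpha> \<subseteq> A"
  shows "mon_eval f \<alpha> = (\<Prod>i\<in>A. f i ^ lookup \<alpha> i)"
  unfolding mon_eval_def using assms by (intro prod.mono_neutral_left) (auto simp: in_keys_iff)

lemma mon_eval_add: "mon_eval f (\<alpha> + \<beta>) = mon_eval f \<alpha> * mon_eval f \<beta>"
proof -
  let ?A = "keys \<alpha> \<union> keys \<beta>"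
  have "mon_eval f (\<alpha> + \<beta>) = (\<Prod>i\<in>?A. f i ^ lookup (\<alpha> + \<beta>) i)"
    by (rule mon_eval_superset) (auto simp: keys_add_nat)
  also have "\<dots> = (\<Prod>i\<in>?A. f i ^ lookup \<alpha> i) * (\<Prod>i\<in>?A. f i ^ lookup \<beta> i)"
    by (simp add: lookup_add power_add prod.distrib)
  also have "\<dots> = mon_eval f \<alpha> * mon_eval f \<beta>"
    by (subst (1 2) mon_eval_superset[where A = ?A]) auto
  finally show ?thesis .
qed

lemma mon_eval_zero [simp]: "mon_eval f 0 = 1"
  by (simp add: mon_eval_def)

lemma mon_eval_single [simp]: "mon_eval f (single i n) = f i ^ n"
  by (cases "n = 0") (auto simp: mon_eval_def)

definition exps :: "nat \<Rightarrow> (nat \<Rightarrow>\<^sub>0 nat) set" where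
  "exps r = {\<alpha>. keys \<alpha> \<subseteq> {..<r}}"

definition hexps :: "nat \<Rightarrow> nat \<Rightarrow> (nat \<Rightarrow>\<^sub>0 nat) set" where
  "hexps r N = {\<alpha> \<in> exps r. tdeg \<alpha> = N}"

lemma exps_add: "\<alpha> \<in> exps r \<Longrightarrow> \<beta> \<in> exps r \<Longrightarrow> \<alpha> + \<beta> \<in> exps r"
  by (auto simp: exps_def keys_add_nat)

lemma exps_zero [simp]: "0 \<in> exps r"
  by (auto simp: exps_def)

lemma exps_Suc: "exps r \<subseteq> exps (Suc r)"
  by (auto simp: exps_def)

lemma hexps_zero_deg: "hexps r 0 = {0}"
  by (auto simp: hexps_def tdeg_eq_0_iff)

lemma exps_0: "exps 0 = {0}"
  by (auto simp: exps_def)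

lemma hexps_0_Suc: "hexps 0 (Suc N) = {}"
  by (auto simp: hexps_def exps_0)

text \<open>Sorting by the occurrence of the last variable is the step of every induction on the number of variables.\<close>

lemma hexps_Suc_Suc:
  "hexps (Suc r) (Suc N) = hexps r (Suc N) \<union> (\<lambda>\<alpha>. \<alpha> + single r 1) ` hexps (Suc r) N"
proof (intro equalityI subsetI)
  fix \<alpha> assume a: "\<alpha> \<in> hexps (Suc r) (Suc N)"
  show "\<alpha> \<in> hexps r (Suc N) \<union> (\<lambda>\<alpha>. \<alpha> + single r 1) ` hexps (Suc r) N"
  proof (cases "r \<in> keys \<alpha>")
    case False
    then show ?thesis using a by (auto simp: hexps_def exps_def less_Suc_eq)
  next
    case True
    define \<beta> where "\<beta> = \<alpha> - single r 1"
    have e: "\<alpha> = \<beta> + single r 1"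
      using True by (intro poly_mapping_eqI)
        (auto simp: \<beta>_def lookup_add lookup_minus lookup_single when_def in_keys_iff)
    then have "\<beta> \<in> hexps (Suc r) N"
      using a by (auto simp: hexps_def exps_def tdeg_add keys_add_nat)
    then show ?thesis using e by blast
  qed
next
  fix \<alpha> assume "\<alpha> \<in> hexps r (Suc N) \<union> (\<lambda>\<alpha>. \<alpha> + single r 1) ` hexps (Suc r) N"
  then show "\<alpha> \<in> hexps (Suc r) (Suc N)"
    using exps_Suc[of r] by (auto simp: hexps_def exps_def tdeg_add keys_add_nat)
qed

lemma hexps_Suc_Suc_disjoint:
  "hexps r (Suc N) \<inter> (\<lambda>\<alpha>. \<alpha> + single r 1) ` hexps (Suc r) N = {}"
  by (auto simp: hexps_def exps_def keys_add_nat)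

lemma finite_hexps: "finite (hexps r N)"
proof (induction r arbitrary: N)
  case 0
  then show ?case by (cases N) (simp_all add: hexps_zero_deg hexps_0_Suc)
next
  case (Suc r)
  show ?case
  proof (induction N)
    case 0
    then show ?case by (simp add: hexps_zero_deg)
  next
    case (Suc N)
    then show ?case using Suc.IH \<open>\<And>N. finite (hexps r N)\<close> by (simp add: hexps_Suc_Suc)
  qed
qed

section \<open>Powers of an ideal generated by a regular sequence\<close>

locale subring_ideal =
  fixes C I :: "'a::comm_ring_1 set"
  assumes C_one: "1 \<in> C"
    and C_add: "\<lbrakk>a \<in> C; b \<in> C\<rbrakk> \<Longrightarrow> a + b \<in> C"
    and C_mult: "\<lbrakk>a \<in> C; b \<in> C\<rbrakk> \<Longrightarrow> a * b \<in> C"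
    and C_uminus: "a \<in> C \<Longrightarrow> - a \<in> C"
    and I_sub: "I \<subseteq> C"
    and I_zero: "0 \<in> I"
    and I_add: "\<lbrakk>a \<in> I; b \<in> I\<rbrakk> \<Longrightarrow> a + b \<in> I"
    and I_mult: "\<lbrakk>c \<in> C; a \<in> I\<rbrakk> \<Longrightarrow> c * a \<in> I"
begin

lemma C_zero: "0 \<in> C"
  using I_sub I_zero by blast

lemma C_diff: "\<lbrakk>a \<in> C; b \<in> C\<rbrakk> \<Longrightarrow> a - b \<in> C"
  using C_add[of a "- b"] C_uminus[of b] by simp

lemma C_sum: "(\<And>i. i \<in> A \<Longrightarrow> c i \<in> C) \<Longrightarrow> sum c A \<in> C"
  by (induction A rule: infinite_finite_induct) (auto intro: C_zero C_add)

lemma C_prod: "(\<And>i. i \<in> A \<Longrightarrow> c i \<in> C) \<Longrightarrow> prod c A \<in> C"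
  by (induction A rule: infinite_finite_induct) (auto intro: C_one C_mult)

lemma C_power: "c \<in> C \<Longrightarrow> c ^ n \<in> C"
  by (induction n) (auto intro: C_one C_mult)

lemmas C_closed = C_one C_zero C_add C_mult C_uminus C_diff C_sum C_prod C_power

end

text \<open>\<open>ideal_power C I f r N\<close> is the ideal \<open>I + (f 0, \<dots>, f (r - 1))\<^sup>N\<close> of the ring \<open>C\<close>. The recursion
sorts the products of \<open>N\<close> generators by the occurrence of the last one, in step with \<open>hexps_Suc_Suc\<close>.\<close>

fun ideal_power :: "'a::comm_ring_1 set \<Rightarrow> 'a set \<Rightarrow> (nat \<Rightarrow> 'a) \<Rightarrow> nat \<Rightarrow> nat \<Rightarrow> 'a set" where
  "ideal_power C I f r 0 = C"
| "ideal_power C I f 0 (Suc N) = I"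
| "ideal_power C I f (Suc r) (Suc N) =
     {a + f r * b |a b. a \<in> ideal_power C I f r (Suc N) \<and> b \<in> ideal_power C I f (Suc r) N}"

locale ring_tuple = subring_ideal C I for C I :: "'a::comm_ring_1 set" +
  fixes f :: "nat \<Rightarrow> 'a" and r :: nat
  assumes f_C: "i < r \<Longrightarrow> f i \<in> C"
begin

abbreviation "P \<equiv> ideal_power C I f"

lemma ideal_power_ideal:
  assumes "k \<le> r"
  shows "P k N \<subseteq> C \<and> 0 \<in> P k N \<and> I \<subseteq> P k N \<and>
    (\<forall>a\<in>P k N. \<forall>b\<in>P k N. a + b \<in> P k N) \<and> (\<forall>c\<in>C. \<forall>a\<in>P k N. c * a \<in> P k N)"
  using assms
proof (induction k arbitrary: N)
  case 0
  show ?case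
    by (cases N) (use I_sub in \<open>auto intro: C_closed I_zero I_add I_mult\<close>)
next
  case IHk: (Suc k)
  then have fk: "f k \<in> C" using f_C by simp
  show ?case
  proof (induction N)
    case 0
    then show ?case using I_sub by (auto intro: C_closed)
  next
    case (Suc N)
    note 1 = IHk.IH[of "Suc N"] and 2 = Suc
    have A: "P k (Suc N) \<subseteq> C" "0 \<in> P k (Suc N)" "I \<subseteq> P k (Suc N)"
      "\<And>a b. a \<in> P k (Suc N) \<Longrightarrow> b \<in> P k (Suc N) \<Longrightarrow> a + b \<in> P k (Suc N)"
      "\<And>c a. c \<in> C \<Longrightarrow> a \<in> P k (Suc N) \<Longrightarrow> c * a \<in> P k (Suc N)"
      using 1 IHk.prems by auto
    have B: "P (Suc k) N \<subseteq> C" "0 \<in> P (Suc k) N"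
      "\<And>a b. a \<in> P (Suc k) N \<Longrightarrow> b \<in> P (Suc k) N \<Longrightarrow> a + b \<in> P (Suc k) N"
      "\<And>c a. c \<in> C \<Longrightarrow> a \<in> P (Suc k) N \<Longrightarrow> c * a \<in> P (Suc k) N"
      using 2 by auto
    show ?case
    proof (intro conjI ballI)
      show "P (Suc k) (Suc N) \<subseteq> C"
        using A(1) B(1) fk by (auto intro!: C_add C_mult)
      show "0 \<in> P (Suc k) (Suc N)"
        using A(2) B(2) by force
      show "I \<subseteq> P (Suc k) (Suc N)"
        using A(3) B(2) by force
    next
      fix a b assume "a \<in> P (Suc k) (Suc N)" "b \<in> P (Suc k) (Suc N)"
      then obtain a1 a2 b1 b2 where "a = a1 + f k * a2" "b = b1 + f k * b2"
        "a1 \<in> P k (Suc N)" "b1 \<in> P k (Suc N)" "a2 \<in> P (Suc k) N" "b2 \<in> P (Suc k) N"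
        by auto
      then have "a + b = (a1 + b1) + f k * (a2 + b2)" "a1 + b1 \<in> P k (Suc N)" "a2 + b2 \<in> P (Suc k) N"
        using A(4) B(3) by (auto simp: algebra_simps)
      then show "a + b \<in> P (Suc k) (Suc N)" by auto
    next
      fix c a assume c: "c \<in> C" and "a \<in> P (Suc k) (Suc N)"
      then obtain a1 a2 where "a = a1 + f k * a2" "a1 \<in> P k (Suc N)" "a2 \<in> P (Suc k) N"
        by auto
      then have "c * a = c * a1 + f k * (c * a2)" "c * a1 \<in> P k (Suc N)" "c * a2 \<in> P (Suc k) N"
        using A(5)[OF c] B(4)[OF c] by (simp_all add: distrib_left mult.left_commute)
      then show "c * a \<in> P (Suc k) (Suc N)" by auto
    qed
  qed
qed

lemma P_C: "k \<le> r \<Longrightarrow> a \<in> P k N \<Longrightarrow> a \<in> C" using ideal_power_ideal by blast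
lemma P_zero: "k \<le> r \<Longrightarrow> 0 \<in> P k N" using ideal_power_ideal by blast
lemma P_I: "k \<le> r \<Longrightarrow> a \<in> I \<Longrightarrow> a \<in> P k N" using ideal_power_ideal by blast
lemma P_add: "k \<le> r \<Longrightarrow> a \<in> P k N \<Longrightarrow> b \<in> P k N \<Longrightarrow> a + b \<in> P k N" using ideal_power_ideal by blast
lemma P_mult: "k \<le> r \<Longrightarrow> c \<in> C \<Longrightarrow> a \<in> P k N \<Longrightarrow> c * a \<in> P k N" using ideal_power_ideal by blast
lemma P_uminus: "k \<le> r \<Longrightarrow> a \<in> P k N \<Longrightarrow> - a \<in> P k N"
  using P_mult[of k "- 1" a N] C_uminus[OF C_one] by simp
lemma P_diff: "k \<le> r \<Longrightarrow> a \<in> P k N \<Longrightarrow> b \<in> P k N \<Longrightarrow> a - b \<in> P k N"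
  using P_add[of k a N "- b"] P_uminus[of k b N] by simp
lemma P_sum: "k \<le> r \<Longrightarrow> (\<And>i. i \<in> A \<Longrightarrow> c i \<in> P k N) \<Longrightarrow> sum c A \<in> P k N"
  by (induction A rule: infinite_finite_induct) (auto intro: P_zero P_add)

lemma P_Suc_subset: "k \<le> r \<Longrightarrow> P k (Suc N) \<subseteq> P k N"
proof (induction k arbitrary: N)
  case 0
  then show ?case using I_sub by (cases N) auto
next
  case IHk: (Suc k)
  then have k: "k \<le> r" by simp
  show ?case
  proof (induction N)
    case 0
    show ?case using P_C[OF IHk.prems, of _ "Suc 0"] by (metis ideal_power.simps(1) subsetI)
  next
    case (Suc N)
    show ?case
    proof
      fix a assume "a \<in> P (Suc k) (Suc (Suc N))"
      then obtain b c where "a = b + f k * c" "b \<in> P k (Suc (Suc N))" "c \<in> P (Suc k) (Suc N)"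
        unfolding ideal_power.simps(3)[of C I f k "Suc N"] by blast
      moreover from this have "b \<in> P k (Suc N)" "c \<in> P (Suc k) N" using IHk.IH[OF k] Suc by blast+
      ultimately show "a \<in> P (Suc k) (Suc N)"
        unfolding ideal_power.simps(3)[of C I f k N] by blast
    qed
  qed
qed

lemma P_antimono: "k \<le> r \<Longrightarrow> M \<le> N \<Longrightarrow> P k N \<subseteq> P k M"
  by (rule lift_Suc_antimono_le[where f = "P k"]) (use P_Suc_subset in auto)

lemma P_subset_Suc:
  assumes "Suc k \<le> r"
  shows "P k N \<subseteq> P (Suc k) N"
proof (cases N)
  case (Suc M)
  then show ?thesis using P_zero[OF assms, of M] by force
qed simp

lemma gen_mult_P:
  assumes "k \<le> r" "j < k" "a \<in> P k N"
  shows "f j * a \<in> P k (Suc N)"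
  using assms
proof (induction k arbitrary: a N)
  case 0
  then show ?case by simp
next
  case IHk: (Suc k)
  show ?case
  proof (cases "j = k")
    case True
    then show ?thesis using IHk.prems P_zero[of k "Suc N"] by force
  next
    case False
    with IHk.prems have jk: "j < k" and kr: "k \<le> r" by auto
    from IHk.prems(3) show ?thesis
    proof (induction N arbitrary: a)
      case 0
      have "f j * 1 \<in> P k (Suc 0)" by (rule IHk.IH[OF kr jk]) (simp add: C_one)
      then have "f j * a \<in> P k (Suc 0)" using P_mult[OF kr, of a "f j"] 0 by (simp add: mult.commute)
      then show ?case using P_subset_Suc[OF IHk.prems(1)] by blast
    next
      case (Suc N)
      then obtain b c where bc: "a = b + f k * c" "b \<in> P k (Suc N)" "c \<in> P (Suc k) N" by auto
      have "f j * b \<in> P k (Suc (Suc N))" by (rule IHk.IH[OF kr jk bc(2)])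
      moreover have "f j * c \<in> P (Suc k) (Suc N)" by (rule Suc.IH[OF bc(3)])
      moreover have "f j * a = f j * b + f k * (f j * c)" using bc(1) by (simp add: algebra_simps)
      ultimately show ?case by auto
    qed
  qed
qed

lemma gen_power_mult_P:
  assumes "k \<le> r" "j < k" "a \<in> P k N"
  shows "f j ^ n * a \<in> P k (N + n)"
  using gen_mult_P[OF assms(1,2)] assms(3) by (induction n) (auto simp: mult.assoc)

lemma mon_mult_P:
  assumes k: "k \<le> r" and "\<alpha> \<in> exps k" and a: "a \<in> P k N"
  shows "mon_eval f \<alpha> * a \<in> P k (N + tdeg \<alpha>)"
proof -
  have "finite K \<Longrightarrow> K \<subseteq> {..<k} \<Longrightarrow>
      (\<Prod>i\<in>K. f i ^ e i) * a \<in> P k (N + (\<Sum>i\<in>K. e i))" for K and e :: "nat \<Rightarrow> nat"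
  proof (induction K rule: finite_induct)
    case empty
    then show ?case using a by simp
  next
    case (insert j K)
    have "f j ^ e j * ((\<Prod>i\<in>K. f i ^ e i) * a) \<in> P k ((N + (\<Sum>i\<in>K. e i)) + e j)"
      using insert by (intro gen_power_mult_P[OF k]) auto
    then show ?case using insert by (simp add: mult.assoc add_ac)
  qed
  then show ?thesis unfolding mon_eval_def tdeg_def using assms(2) by (auto simp: exps_def)
qed

lemma mon_C: "k \<le> r \<Longrightarrow> \<alpha> \<in> exps k \<Longrightarrow> mon_eval f \<alpha> \<in> C"
  unfolding mon_eval_def exps_def by (auto intro!: C_prod C_power f_C)

lemma mon_mem_P: "k \<le> r \<Longrightarrow> \<alpha> \<in> exps k \<Longrightarrow> c \<in> C \<Longrightarrow> N \<le> tdeg \<alpha> \<Longrightarrow> mon_eval f \<alpha> * c \<in> P k N"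
  using mon_mult_P[of k \<alpha> c 0] P_antimono[of k N "tdeg \<alpha>"] by auto

lemma sum_hexps_Suc_Suc:
  "(\<Sum>\<alpha>\<in>hexps (Suc k) (Suc N). mon_eval f \<alpha> * c \<alpha>) =
   (\<Sum>\<alpha>\<in>hexps k (Suc N). mon_eval f \<alpha> * c \<alpha>) +
   f k * (\<Sum>\<alpha>\<in>hexps (Suc k) N. mon_eval f \<alpha> * c (\<alpha> + single k 1))"
proof -
  have "(\<Sum>\<alpha>\<in>(\<lambda>\<alpha>. \<alpha> + single k 1) ` hexps (Suc k) N. mon_eval f \<alpha> * c \<alpha>) =
      (\<Sum>\<alpha>\<in>hexps (Suc k) N. mon_eval f (\<alpha> + single k 1) * c (\<alpha> + single k 1))"
    by (subst sum.reindex) (auto simp: inj_on_def)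
  also have "\<dots> = f k * (\<Sum>\<alpha>\<in>hexps (Suc k) N. mon_eval f \<alpha> * c (\<alpha> + single k 1))"
    by (simp add: mon_eval_add sum_distrib_left mult_ac)
  finally show ?thesis unfolding hexps_Suc_Suc
    by (subst sum.union_disjoint) (use hexps_Suc_Suc_disjoint[of k N] in \<open>auto simp: finite_hexps\<close>)
qed

lemma P_expand:
  assumes "k \<le> r" "a \<in> P k N"
  obtains x c where "x \<in> I" "\<And>\<alpha>. c \<alpha> \<in> C" "a = x + (\<Sum>\<alpha>\<in>hexps k N. mon_eval f \<alpha> * c \<alpha>)"
proof -
  have "\<exists>x c. x \<in> I \<and> (\<forall>\<alpha>. c \<alpha> \<in> C) \<and> a = x + (\<Sum>\<alpha>\<in>hexps k N. mon_eval f \<alpha> * c \<alpha>)"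
    using assms
  proof (induction k arbitrary: a N)
    case 0
    show ?case
    proof (cases N)
      case 0
      then show ?thesis using \<open>a \<in> P 0 N\<close> I_zero
        by (intro exI[of _ 0] exI[of _ "\<lambda>_. a"]) (simp add: hexps_zero_deg)
    next
      case (Suc M)
      then show ?thesis using \<open>a \<in> P 0 N\<close> C_zero
        by (intro exI[of _ a] exI[of _ "\<lambda>_. 0"]) (simp add: hexps_0_Suc)
    qed
  next
    case IHk: (Suc k)
    have k: "k \<le> r" and fk: "f k \<in> C" using IHk.prems f_C by auto
    show ?case using IHk.prems(2)
    proof (induction N arbitrary: a)
      case 0
      then show ?case using I_zero
        by (intro exI[of _ 0] exI[of _ "\<lambda>_. a"]) (simp add: hexps_zero_deg)
    next
      case (Suc N)
      then obtain b b' where b: "a = b + f k * b'" "b \<in> P k (Suc N)" "b' \<in> P (Suc k) N" by auto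
      obtain x c where 1: "x \<in> I" "\<forall>\<alpha>. c \<alpha> \<in> C" "b = x + (\<Sum>\<alpha>\<in>hexps k (Suc N). mon_eval f \<alpha> * c \<alpha>)"
        using IHk.IH[OF k b(2)] by blast
      obtain x' c' where 2: "x' \<in> I" "\<forall>\<alpha>. c' \<alpha> \<in> C" "b' = x' + (\<Sum>\<alpha>\<in>hexps (Suc k) N. mon_eval f \<alpha> * c' \<alpha>)"
        using Suc.IH[OF b(3)] by blast
      define d where "d \<alpha> = (if k \<in> keys \<alpha> then c' (\<alpha> - single k 1) else c \<alpha>)" for \<alpha>
      have d1: "d \<alpha> = c \<alpha>" if "\<alpha> \<in> hexps k (Suc N)" for \<alpha>
        using that by (auto simp: d_def hexps_def exps_def)
      have d2: "d (\<alpha> + single k 1) = c' \<alpha>" for \<alpha>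
        by (simp add: d_def keys_add_nat)
      have "a = (x + f k * x') + (\<Sum>\<alpha>\<in>hexps (Suc k) (Suc N). mon_eval f \<alpha> * d \<alpha>)"
        unfolding sum_hexps_Suc_Suc d2 b(1) 1(3) 2(3) using d1 by (simp add: algebra_simps cong: sum.cong)
      moreover have "x + f k * x' \<in> I" using 1 2 fk by (intro I_add I_mult) auto
      moreover have "\<forall>\<alpha>. d \<alpha> \<in> C" using 1 2 by (auto simp: d_def)
      ultimately show ?case by blast
    qed
  qed
  then show ?thesis using that by blast
qed

end

text \<open>As \<open>ideal_power C I f i 1\<close> is \<open>I + (f 0, \<dots>, f (i - 1))\<close>, the assumption says that \<open>f i\<close> is a
nonzerodivisor modulo \<open>I\<close> and the preceding entries.\<close>

locale regular_tuple = ring_tuple +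
  assumes regular: "\<lbrakk>i < r; a \<in> C; f i * a \<in> ideal_power C I f i 1\<rbrakk> \<Longrightarrow> a \<in> ideal_power C I f i 1"
begin

text \<open>Rees: a form in a regular sequence can take a value in the next power of the ideal only if its
coefficients lie in the ideal. Write the form as \<open>A + f k * B\<close> with \<open>A\<close> in the first \<open>k\<close> entries.
As \<open>f k\<close> is a nonzerodivisor modulo the powers of the ideal of these entries, \<open>B\<close> is congruent to a form
in the first \<open>k\<close> entries modulo the next power for all \<open>k + 1\<close> entries, and this form lies in that power as well. So the
induction on the degree applies to \<open>B\<close>, and the one on \<open>k\<close> to the sum of \<open>A\<close> and \<open>f k\<close> times the form.\<close>

lemma quasi_regular_aux:
  assumes "k \<le> r"
  shows "(\<forall>e. (\<forall>\<alpha>. e \<alpha> \<in> C) \<longrightarrow> (\<Sum>\<alpha>\<in>hexps k N. mon_eval f \<alpha> * e \<alpha>) \<in> P k (Suc N) \<longrightarrow>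
      (\<forall>\<alpha>\<in>hexps k N. e \<alpha> \<in> P k 1))"
  using assms
proof (induction k arbitrary: N)
  case 0
  then show ?case by (cases N) (auto simp: hexps_zero_deg hexps_0_Suc)
next
  case IHk: (Suc k)
  have k: "k \<le> r" "k < r" and fk: "f k \<in> C" using IHk.prems f_C by auto
  have IH: "e \<alpha> \<in> P k 1" if "\<And>\<alpha>. e \<alpha> \<in> C" "(\<Sum>\<alpha>\<in>hexps k N. mon_eval f \<alpha> * e \<alpha>) \<in> P k (Suc N)"
    "\<alpha> \<in> hexps k N" for e \<alpha> N
    using IHk.IH[OF k(1)] that by blast
  \<comment> \<open>The power is gained degree by degree: the coefficients of \<open>a\<close>, multiplied by \<open>f k\<close>, are in the ideal
by the hypothesis for \<open>k\<close>, and then regularity of \<open>f k\<close> applies to them.\<close>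
  have nzd: "a \<in> P k N" if "a \<in> C" "f k * a \<in> P k N" for a N
    using that
  proof (induction N)
    case 0
    then show ?case by simp
  next
    case (Suc N)
    then have "f k * a \<in> P k N" using P_Suc_subset[OF k(1)] by blast
    with Suc have "a \<in> P k N" by blast
    then obtain x c where c: "x \<in> I" "\<And>\<alpha>. c \<alpha> \<in> C" "a = x + (\<Sum>\<alpha>\<in>hexps k N. mon_eval f \<alpha> * c \<alpha>)"
      using P_expand[OF k(1)] by blast
    have "(\<Sum>\<alpha>\<in>hexps k N. mon_eval f \<alpha> * (f k * c \<alpha>)) = f k * a - f k * x"
      by (simp add: c(3) sum_distrib_left algebra_simps)
    also have "\<dots> \<in> P k (Suc N)"
      by (rule P_diff[OF k(1) Suc.prems(2) P_I[OF k(1) I_mult[OF fk c(1)]]])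
    finally have "\<forall>\<alpha>\<in>hexps k N. f k * c \<alpha> \<in> P k 1"
      using IH[of "\<lambda>\<alpha>. f k * c \<alpha>" N] c(2) fk C_mult by blast
    then have "\<forall>\<alpha>\<in>hexps k N. c \<alpha> \<in> P k 1" using regular[OF k(2)] c(2) by blast
    then have "(\<Sum>\<alpha>\<in>hexps k N. mon_eval f \<alpha> * c \<alpha>) \<in> P k (Suc N)"
      by (intro P_sum[OF k(1)]) (use mon_mult_P[OF k(1), where N = 1] in \<open>auto simp: hexps_def\<close>)
    then show ?case unfolding c(3) by (rule P_add[OF k(1) P_I[OF k(1) c(1)]])
  qed
  show ?case
  proof (induction N)
    case 0
    then show ?case by (simp add: hexps_zero_deg)
  next
    case (Suc N)
    show ?case
    proof (intro allI impI)
      fix e assume e: "\<forall>\<alpha>. e \<alpha> \<in> C"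
        and "(\<Sum>\<alpha>\<in>hexps (Suc k) (Suc N). mon_eval f \<alpha> * e \<alpha>) \<in> P (Suc k) (Suc (Suc N))"
      define A where "A = (\<Sum>\<alpha>\<in>hexps k (Suc N). mon_eval f \<alpha> * e \<alpha>)"
      define B where "B = (\<Sum>\<alpha>\<in>hexps (Suc k) N. mon_eval f \<alpha> * e (\<alpha> + single k 1))"
      have "A + f k * B \<in> P (Suc k) (Suc (Suc N))"
        using \<open>(\<Sum>\<alpha>\<in>hexps (Suc k) (Suc N). mon_eval f \<alpha> * e \<alpha>) \<in> P (Suc k) (Suc (Suc N))\<close>
        by (simp only: sum_hexps_Suc_Suc A_def B_def)
      then obtain a b where ab: "A + f k * B = a + f k * b" "a \<in> P k (Suc (Suc N))" "b \<in> P (Suc k) (Suc N)"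
        by auto
      have AP: "A \<in> P k (Suc N)" unfolding A_def
        by (intro P_sum[OF k(1)] mon_mem_P[OF k(1)]) (use e in \<open>auto simp: hexps_def\<close>)
      have BP: "B \<in> P (Suc k) N" unfolding B_def
        by (intro P_sum[OF IHk.prems] mon_mem_P[OF IHk.prems]) (use e in \<open>auto simp: hexps_def\<close>)
      have "f k * (B - b) = a - A" using ab(1) by (simp add: algebra_simps)
      moreover have "a - A \<in> P k (Suc N)"
        using P_diff[OF k(1)] AP ab(2) P_Suc_subset[OF k(1)] by blast
      moreover have "B - b \<in> C"
        using BP ab(3) P_C[OF IHk.prems] C_diff by blast
      ultimately have h: "B - b \<in> P k (Suc N)" using nzd by metis
      then have "B - b \<in> P (Suc k) (Suc N)" using P_subset_Suc[OF IHk.prems] by blast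
      then have "B \<in> P (Suc k) (Suc N)" using P_add[OF IHk.prems _ ab(3), of "B - b"] by (simp only: diff_add_cancel)
      then have c1: "\<forall>\<alpha>\<in>hexps (Suc k) N. e (\<alpha> + single k 1) \<in> P (Suc k) 1"
        using Suc.IH[rule_format, of "\<lambda>\<alpha>. e (\<alpha> + single k 1)"] e unfolding B_def by blast
      obtain x c where c: "x \<in> I" "\<And>\<alpha>. c \<alpha> \<in> C" "B - b = x + (\<Sum>\<alpha>\<in>hexps k (Suc N). mon_eval f \<alpha> * c \<alpha>)"
        using P_expand[OF k(1) h] by blast
      have "(\<Sum>\<alpha>\<in>hexps k (Suc N). mon_eval f \<alpha> * (e \<alpha> + f k * c \<alpha>)) = A + f k * (B - b - x)"
        by (simp add: c(3) A_def sum.distrib sum_distrib_left algebra_simps)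
      also have "\<dots> = a - f k * x" using ab(1) by (simp add: algebra_simps)
      also have "\<dots> \<in> P k (Suc (Suc N))"
        by (rule P_diff[OF k(1) ab(2) P_I[OF k(1) I_mult[OF fk c(1)]]])
      finally have c2: "\<forall>\<alpha>\<in>hexps k (Suc N). e \<alpha> + f k * c \<alpha> \<in> P k 1"
        using IH[of "\<lambda>\<alpha>. e \<alpha> + f k * c \<alpha>"] e c(2) fk C_mult C_add by blast
      have "e \<alpha> \<in> P (Suc k) 1" if "\<alpha> \<in> hexps k (Suc N)" for \<alpha>
      proof -
        have "e \<alpha> + f k * c \<alpha> \<in> P (Suc k) 1" using that c2 P_subset_Suc[OF IHk.prems] by blast
        moreover have "f k * c \<alpha> \<in> P (Suc k) 1"
          using gen_mult_P[OF IHk.prems, of k "c \<alpha>" 0] c(2) by (simp only: One_nat_def ideal_power.simps(1))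
        ultimately show ?thesis
          using P_diff[OF IHk.prems, of "e \<alpha> + f k * c \<alpha>" 1 "f k * c \<alpha>"] by (simp only: add_diff_cancel_right')
      qed
      with c1 show "\<forall>\<alpha>\<in>hexps (Suc k) (Suc N). e \<alpha> \<in> P (Suc k) 1"
        unfolding hexps_Suc_Suc by blast
    qed
  qed
qed

theorem quasi_regular:
  assumes "\<And>\<alpha>. e \<alpha> \<in> C" "(\<Sum>\<alpha>\<in>hexps r N. mon_eval f \<alpha> * e \<alpha>) \<in> P r (Suc N)" "\<alpha> \<in> hexps r N"
  shows "e \<alpha> \<in> P r 1"
  using quasi_regular_aux[OF le_refl] assms by blast

end

section \<open>Initial terms with respect to a regular sequence\<close>

text \<open>A local monomial order in which degree comes first, so that in finitely many variables only finitely many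
exponent vectors precede a given one.\<close>

definition precedes :: "('v::linorder \<Rightarrow>\<^sub>0 nat) \<Rightarrow> ('v \<Rightarrow>\<^sub>0 nat) \<Rightarrow> bool" where
  "precedes \<alpha> \<beta> \<longleftrightarrow> tdeg \<alpha> < tdeg \<beta> \<or> (tdeg \<alpha> = tdeg \<beta> \<and> \<alpha> < \<beta>)"

lemma precedes_trans: "precedes \<alpha> \<beta> \<Longrightarrow> precedes \<beta> \<gamma> \<Longrightarrow> precedes \<alpha> \<gamma>"
  by (auto simp: precedes_def)

lemma precedes_irrefl: "\<not> precedes \<alpha> \<alpha>"
  by (auto simp: precedes_def)

lemma precedes_linear: "precedes \<alpha> \<beta> \<or> \<alpha> = \<beta> \<or> precedes \<beta> \<alpha>"
  by (auto simp: precedes_def)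

lemma precedes_add: "precedes (\<alpha> + \<gamma>) (\<beta> + \<gamma>) \<longleftrightarrow> precedes \<alpha> \<beta>"
  by (auto simp: precedes_def tdeg_add)

lemma precedes_least:
  assumes "finite A" "A \<noteq> {}"
  obtains \<alpha> where "\<alpha> \<in> A" "\<And>\<beta>. \<beta> \<in> A \<Longrightarrow> \<beta> \<noteq> \<alpha> \<Longrightarrow> precedes \<alpha> \<beta>"
proof -
  have "\<exists>\<alpha>\<in>A. \<forall>\<beta>\<in>A. \<beta> \<noteq> \<alpha> \<longrightarrow> precedes \<alpha> \<beta>"
    using assms
  proof (induction rule: finite_ne_induct)
    case (insert x F)
    then obtain \<alpha> where "\<alpha> \<in> F" "\<forall>\<beta>\<in>F. \<beta> \<noteq> \<alpha> \<longrightarrow> precedes \<alpha> \<beta>" by blast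
    then show ?case using precedes_linear[of x \<alpha>] precedes_trans by (metis insert_iff)
  qed auto
  then show ?thesis using that by blast
qed

lemma precedes_greatest:
  assumes "finite A" "A \<noteq> {}"
  obtains \<alpha> where "\<alpha> \<in> A" "\<And>\<beta>. \<beta> \<in> A \<Longrightarrow> \<not> precedes \<alpha> \<beta>"
proof -
  have "\<exists>\<alpha>\<in>A. \<forall>\<beta>\<in>A. \<not> precedes \<alpha> \<beta>"
    using assms
  proof (induction rule: finite_ne_induct)
    case (singleton x)
    then show ?case using precedes_irrefl by auto
  next
    case (insert x F)
    then obtain \<alpha> where "\<alpha> \<in> F" "\<forall>\<beta>\<in>F. \<not> precedes \<alpha> \<beta>" by blast
    then show ?case using precedes_irrefl precedes_trans by (metis insert_iff)
  qed
  then show ?thesis using that by blast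
qed

context regular_tuple
begin

lemmas rP_C = P_C[OF le_refl] and rP_zero = P_zero[OF le_refl] and rP_I = P_I[OF le_refl]
  and rP_add = P_add[OF le_refl] and rP_mult = P_mult[OF le_refl] and rP_diff = P_diff[OF le_refl]
  and rP_uminus = P_uminus[OF le_refl] and rP_sum = P_sum[OF le_refl]
  and rP_antimono = P_antimono[OF le_refl]
  and rmon_C = mon_C[OF le_refl] and rmon_mult_P = mon_mult_P[OF le_refl]
  and rmon_mem_P = mon_mem_P[OF le_refl]

text \<open>The ideal generated by \<open>I\<close> and the monomials in \<open>f\<close> that come after \<open>\<alpha>\<close>. Those of larger degree are all
contained in the first summand.\<close>

definition later :: "(nat \<Rightarrow>\<^sub>0 nat) \<Rightarrow> 'a set" where
  "later \<alpha> = {y + (\<Sum>\<beta>\<in>{\<beta> \<in> hexps r (tdeg \<alpha>). \<alpha> < \<beta>}. mon_eval f \<beta> * c \<beta>) |y c.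
     y \<in> P r (Suc (tdeg \<alpha>)) \<and> (\<forall>\<beta>. c \<beta> \<in> C)}"

lemma laterI:
  "y \<in> P r (Suc (tdeg \<alpha>)) \<Longrightarrow> (\<And>\<beta>. c \<beta> \<in> C) \<Longrightarrow>
   y + (\<Sum>\<beta>\<in>{\<beta> \<in> hexps r (tdeg \<alpha>). \<alpha> < \<beta>}. mon_eval f \<beta> * c \<beta>) \<in> later \<alpha>"
  unfolding later_def by blast

lemma laterE:
  assumes "x \<in> later \<alpha>"
  obtains y c where "y \<in> P r (Suc (tdeg \<alpha>))" "\<And>\<beta>. c \<beta> \<in> C"
    "x = y + (\<Sum>\<beta>\<in>{\<beta> \<in> hexps r (tdeg \<alpha>). \<alpha> < \<beta>}. mon_eval f \<beta> * c \<beta>)"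
  using assms unfolding later_def by blast

lemma later_add:
  assumes "x \<in> later \<alpha>" "x' \<in> later \<alpha>"
  shows "x + x' \<in> later \<alpha>"
proof -
  let ?B = "{\<beta> \<in> hexps r (tdeg \<alpha>). \<alpha> < \<beta>}"
  obtain y c where 1: "y \<in> P r (Suc (tdeg \<alpha>))" "\<And>\<beta>. c \<beta> \<in> C" "x = y + (\<Sum>\<beta>\<in>?B. mon_eval f \<beta> * c \<beta>)"
    using assms(1) by (rule laterE) blast
  obtain y' c' where 2: "y' \<in> P r (Suc (tdeg \<alpha>))" "\<And>\<beta>. c' \<beta> \<in> C" "x' = y' + (\<Sum>\<beta>\<in>?B. mon_eval f \<beta> * c' \<beta>)"
    using assms(2) by (rule laterE) blast
  have "x + x' = (y + y') + (\<Sum>\<beta>\<in>?B. mon_eval f \<beta> * (c \<beta> + c' \<beta>))"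
    by (simp add: 1 2 distrib_left sum.distrib)
  also have "\<dots> \<in> later \<alpha>" using 1 2 by (intro laterI rP_add C_add)
  finally show ?thesis .
qed

lemma later_mult:
  assumes "d \<in> C" "x \<in> later \<alpha>"
  shows "d * x \<in> later \<alpha>"
proof -
  let ?B = "{\<beta> \<in> hexps r (tdeg \<alpha>). \<alpha> < \<beta>}"
  obtain y c where 1: "y \<in> P r (Suc (tdeg \<alpha>))" "\<And>\<beta>. c \<beta> \<in> C" "x = y + (\<Sum>\<beta>\<in>?B. mon_eval f \<beta> * c \<beta>)"
    using assms(2) by (rule laterE) blast
  have "d * x = d * y + (\<Sum>\<beta>\<in>?B. mon_eval f \<beta> * (d * c \<beta>))"
    by (simp add: 1 distrib_left sum_distrib_left mult_ac)
  also have "\<dots> \<in> later \<alpha>" using 1 assms by (intro laterI rP_mult C_mult)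
  finally show ?thesis .
qed

lemma P_later: "y \<in> P r (Suc (tdeg \<alpha>)) \<Longrightarrow> y \<in> later \<alpha>"
  using laterI[of y \<alpha> "\<lambda>_. 0"] C_zero by simp

lemma later_zero: "0 \<in> later \<alpha>"
  by (intro P_later rP_zero)

lemma later_uminus: "x \<in> later \<alpha> \<Longrightarrow> - x \<in> later \<alpha>"
  using later_mult[of "- 1" x] C_uminus[OF C_one] by simp

lemma later_diff: "x \<in> later \<alpha> \<Longrightarrow> x' \<in> later \<alpha> \<Longrightarrow> x - x' \<in> later \<alpha>"
  using later_add[of x \<alpha> "- x'"] later_uminus[of x'] by simp

lemma later_sum: "(\<And>i. i \<in> A \<Longrightarrow> c i \<in> later \<alpha>) \<Longrightarrow> sum c A \<in> later \<alpha>"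
  by (induction A rule: infinite_finite_induct) (auto intro: later_zero later_add)

lemma later_P: "x \<in> later \<alpha> \<Longrightarrow> x \<in> P r (tdeg \<alpha>)"
  by (erule laterE)
    (use rP_antimono[of "tdeg \<alpha>" "Suc (tdeg \<alpha>)"] in
      \<open>auto intro!: rP_add rP_sum rmon_mem_P simp: hexps_def\<close>)

lemma mon_later:
  assumes "precedes \<alpha> \<beta>" "\<beta> \<in> exps r" "c \<in> C"
  shows "mon_eval f \<beta> * c \<in> later \<alpha>"
proof (cases "tdeg \<alpha> < tdeg \<beta>")
  case True
  then show ?thesis using assms by (intro P_later rmon_mem_P) auto
next
  case False
  let ?B = "{\<beta> \<in> hexps r (tdeg \<alpha>). \<alpha> < \<beta>}"
  have "\<beta> \<in> ?B" using False assms by (auto simp: precedes_def hexps_def)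
  moreover have "finite ?B" using finite_hexps by simp
  ultimately have "0 + (\<Sum>\<gamma>\<in>?B. mon_eval f \<gamma> * (if \<gamma> = \<beta> then c else 0)) = mon_eval f \<beta> * c"
    by (simp add: if_distrib[of "(*) _"] sum.delta cong: if_cong)
  then show ?thesis
    using laterI[of 0 \<alpha> "\<lambda>\<gamma>. if \<gamma> = \<beta> then c else 0"] rP_zero C_zero assms(3) by simp
qed

lemma later_subset: "precedes \<alpha> \<beta> \<Longrightarrow> later \<beta> \<subseteq> later \<alpha>"
proof
  fix x assume p: "precedes \<alpha> \<beta>" and x0: "x \<in> later \<beta>"
  from x0 obtain y c where x: "y \<in> P r (Suc (tdeg \<beta>))" "\<And>\<gamma>. c \<gamma> \<in> C"
    "x = y + (\<Sum>\<gamma>\<in>{\<gamma> \<in> hexps r (tdeg \<beta>). \<beta> < \<gamma>}. mon_eval f \<gamma> * c \<gamma>)"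
    using laterE by blast
  have "tdeg \<alpha> \<le> tdeg \<beta>" using p by (auto simp: precedes_def)
  then have "y \<in> later \<alpha>" using x(1) rP_antimono[of "Suc (tdeg \<alpha>)" "Suc (tdeg \<beta>)"] P_later by auto
  moreover have "mon_eval f \<gamma> * c \<gamma> \<in> later \<alpha>" if "\<gamma> \<in> {\<gamma> \<in> hexps r (tdeg \<beta>). \<beta> < \<gamma>}" for \<gamma>
  proof (rule mon_later)
    show "precedes \<alpha> \<gamma>" using that p precedes_trans[OF p] by (auto simp: precedes_def hexps_def)
  qed (use that x in \<open>auto simp: hexps_def\<close>)
  ultimately show "x \<in> later \<alpha>" unfolding x(3) by (intro later_add later_sum)
qed

lemma mon_mult_later:
  assumes "\<beta> \<in> exps r" "x \<in> later \<alpha>"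
  shows "mon_eval f \<beta> * x \<in> later (\<alpha> + \<beta>)"
proof -
  let ?B = "{\<beta> \<in> hexps r (tdeg \<alpha>). \<alpha> < \<beta>}"
  obtain y c where x: "y \<in> P r (Suc (tdeg \<alpha>))" "\<And>\<beta>. c \<beta> \<in> C" "x = y + (\<Sum>\<beta>\<in>?B. mon_eval f \<beta> * c \<beta>)"
    using assms(2) by (rule laterE) blast
  have e: "mon_eval f \<beta> * x = mon_eval f \<beta> * y + (\<Sum>\<gamma>\<in>?B. mon_eval f (\<gamma> + \<beta>) * c \<gamma>)"
    by (simp add: x(3) mon_eval_add distrib_left sum_distrib_left mult_ac)
  have "mon_eval f \<beta> * y \<in> later (\<alpha> + \<beta>)"
    using rmon_mult_P[OF assms(1) x(1)] by (intro P_later) (simp add: tdeg_add)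
  moreover have "mon_eval f (\<gamma> + \<beta>) * c \<gamma> \<in> later (\<alpha> + \<beta>)" if "\<gamma> \<in> ?B" for \<gamma>
    using that assms(1) x(2)
    by (intro mon_later exps_add) (auto simp: precedes_add, auto simp: precedes_def hexps_def)
  ultimately show ?thesis unfolding e by (intro later_add later_sum)
qed

text \<open>Quasi-regularity for a single monomial. It is the reason why the coefficient of an initial term
is determined modulo the ideal generated by \<open>f\<close>.\<close>

lemma mon_mem_later_iff:
  assumes \<alpha>: "\<alpha> \<in> exps r" and e: "e \<in> C"
  shows "mon_eval f \<alpha> * e \<in> later \<alpha> \<longleftrightarrow> e \<in> P r 1"
proof
  assume "e \<in> P r 1"
  then show "mon_eval f \<alpha> * e \<in> later \<alpha>" using rmon_mult_P[OF \<alpha>] by (intro P_later) force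
next
  assume l: "mon_eval f \<alpha> * e \<in> later \<alpha>"
  let ?H = "hexps r (tdeg \<alpha>)" and ?B = "{\<beta> \<in> hexps r (tdeg \<alpha>). \<alpha> < \<beta>}"
  obtain y c where x: "y \<in> P r (Suc (tdeg \<alpha>))" "\<And>\<beta>. c \<beta> \<in> C"
    "mon_eval f \<alpha> * e = y + (\<Sum>\<beta>\<in>?B. mon_eval f \<beta> * c \<beta>)"
    using l by (rule laterE) blast
  define d where "d \<beta> = (if \<beta> = \<alpha> then e else if \<alpha> < \<beta> then - c \<beta> else 0)" for \<beta>
  have a: "\<alpha> \<in> ?H" using \<alpha> by (simp add: hexps_def)
  have "(\<Sum>\<beta>\<in>?H. mon_eval f \<beta> * d \<beta>) = mon_eval f \<alpha> * e + (\<Sum>\<beta>\<in>?H - {\<alpha>}. mon_eval f \<beta> * d \<beta>)"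
    using a by (simp add: sum.remove[OF finite_hexps] d_def)
  also have "(\<Sum>\<beta>\<in>?H - {\<alpha>}. mon_eval f \<beta> * d \<beta>) = (\<Sum>\<beta>\<in>?B. mon_eval f \<beta> * d \<beta>)"
    using finite_hexps[of r "tdeg \<alpha>"] by (intro sum.mono_neutral_right) (auto simp: d_def)
  also have "\<dots> = (\<Sum>\<beta>\<in>?B. - (mon_eval f \<beta> * c \<beta>))"
    by (intro sum.cong) (auto simp: d_def)
  also have "mon_eval f \<alpha> * e + \<dots> = y" by (simp add: x(3) sum_negf)
  finally have "d \<alpha> \<in> P r 1"
    using quasi_regular[of d "tdeg \<alpha>" \<alpha>] x a e by (auto simp: d_def C_uminus C_zero)
  then show "e \<in> P r 1" by (simp add: d_def)
qed

text \<open>\<open>\<alpha>\<close> is the first exponent in an expansion of \<open>a\<close> by powers of \<open>f\<close>, and \<open>e\<close> its coefficient.\<close>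

definition initial :: "'a \<Rightarrow> (nat \<Rightarrow>\<^sub>0 nat) \<Rightarrow> 'a \<Rightarrow> bool" where
  "initial a \<alpha> e \<longleftrightarrow> a \<in> C \<and> \<alpha> \<in> exps r \<and> e \<in> C \<and> e \<notin> P r 1 \<and> a - mon_eval f \<alpha> * e \<in> later \<alpha>"

lemma initial_notin_later: "initial a \<alpha> e \<Longrightarrow> a \<notin> later \<alpha>"
  using later_diff[of a \<alpha> "a - mon_eval f \<alpha> * e"] mon_mem_later_iff[of \<alpha> e]
  by (auto simp: initial_def)

lemma initial_notin_P: "initial a \<alpha> e \<Longrightarrow> tdeg \<alpha> < N \<Longrightarrow> a \<notin> P r N"
  using initial_notin_later P_later rP_antimono[of "Suc (tdeg \<alpha>)" N] by (meson Suc_leI subsetD)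

lemma initial_later_precedes:
  assumes "initial a \<beta> e" "a \<in> later \<alpha>"
  shows "precedes \<alpha> \<beta>"
  using initial_notin_later[OF assms(1)] assms(2) precedes_linear[of \<alpha> \<beta>] later_subset[of \<beta> \<alpha>] by blast

lemma initial_mem_later:
  assumes "initial a \<beta> e" "precedes \<alpha> \<beta>"
  shows "a \<in> later \<alpha>"
  using assms later_add[of "a - mon_eval f \<beta> * e" \<alpha> "mon_eval f \<beta> * e"] later_subset[OF assms(2)] mon_later[OF assms(2)]
  by (auto simp: initial_def)

lemma initial_unique:
  assumes "initial a \<alpha> e" "initial b \<beta> e'" "a - b \<in> I"
  shows "\<alpha> = \<beta>" "e - e' \<in> P r 1"
proof -
  have I: "x \<in> later \<gamma>" if "x \<in> I" for x \<gamma> using that P_later rP_I by blast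
  have ab: "a \<in> later \<gamma> \<longleftrightarrow> b \<in> later \<gamma>" for \<gamma>
    using later_diff[of a \<gamma> "a - b"] later_add[of b \<gamma> "a - b"] I[OF assms(3)] by auto
  show eq: "\<alpha> = \<beta>"
    using ab initial_mem_later[OF assms(1)] initial_mem_later[OF assms(2)]
      initial_notin_later[OF assms(1)] initial_notin_later[OF assms(2)] precedes_linear[of \<alpha> \<beta>] by blast
  have "mon_eval f \<alpha> * (e - e') = (a - b) - (a - mon_eval f \<alpha> * e) + (b - mon_eval f \<alpha> * e')"
    by (simp add: algebra_simps)
  also have "\<dots> \<in> later \<alpha>"
    using assms(1,2) I[OF assms(3)] eq by (intro later_add[OF later_diff]) (simp_all add: initial_def)
  finally show "e - e' \<in> P r 1"
    using assms(1,2) by (subst (asm) mon_mem_later_iff) (auto simp: initial_def C_diff)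
qed

text \<open>The degree of the initial exponent is that of the last power of the ideal containing \<open>a\<close>. In
this degree not all coefficients are in the ideal, and the first one that is not gives the initial term.\<close>

lemma initial_exists:
  assumes "a \<in> C" "a \<notin> P r M"
  obtains \<alpha> e where "initial a \<alpha> e" "tdeg \<alpha> < M"
proof -
  obtain N where N: "N < M" "a \<in> P r N" "a \<notin> P r (Suc N)"
  proof -
    define M' where "M' = (LEAST M. a \<notin> P r M)"
    have 1: "a \<notin> P r M'" unfolding M'_def using assms(2) by (rule LeastI)
    have 2: "M' \<le> M" unfolding M'_def using assms(2) by (rule Least_le)
    have "M' \<noteq> 0" using 1 assms(1) by (metis ideal_power.simps(1))
    then obtain N where N: "M' = Suc N" using not0_implies_Suc by blast
    have "a \<in> P r N" using not_less_Least[of N "\<lambda>M. a \<notin> P r M"] N unfolding M'_def by auto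
    then show ?thesis using that[of N] 1 2 N by simp
  qed
  obtain x c where c: "x \<in> I" "\<And>\<alpha>. c \<alpha> \<in> C" "a = x + (\<Sum>\<alpha>\<in>hexps r N. mon_eval f \<alpha> * c \<alpha>)"
    using P_expand[OF le_refl N(2)] by blast
  let ?H = "hexps r N"
  define S where "S = {\<alpha> \<in> ?H. c \<alpha> \<notin> P r 1}"
  have small: "mon_eval f \<beta> * c \<beta> \<in> P r (Suc N)" if "\<beta> \<in> ?H" "c \<beta> \<in> P r 1" for \<beta>
    using rmon_mult_P[of \<beta> "c \<beta>" 1] that by (auto simp: hexps_def)
  have fin: "finite S" using finite_hexps by (simp add: S_def)
  have "S \<noteq> {}"
  proof
    assume "S = {}"
    then have "a \<in> P r (Suc N)" unfolding c(3)
      by (intro rP_add rP_sum small rP_I[OF c(1)]) (auto simp: S_def)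
    with N show False by blast
  qed
  define \<alpha> where "\<alpha> = Min S"
  have \<alpha>: "\<alpha> \<in> S" "\<And>\<beta>. \<beta> \<in> S \<Longrightarrow> \<alpha> \<le> \<beta>" using fin \<open>S \<noteq> {}\<close> by (auto simp: \<alpha>_def)
  then have \<alpha>': "\<alpha> \<in> exps r" "tdeg \<alpha> = N" "\<alpha> \<in> ?H" by (auto simp: S_def hexps_def)
  have "a - mon_eval f \<alpha> * c \<alpha> = x + (\<Sum>\<beta>\<in>?H - {\<alpha>}. mon_eval f \<beta> * c \<beta>)"
    using \<alpha>' by (simp add: c(3) sum.remove[OF finite_hexps])
  also have "\<dots> \<in> later \<alpha>"
  proof (intro later_add later_sum)
    show "x \<in> later \<alpha>" using c(1) by (intro P_later rP_I)
    fix \<beta> assume \<beta>: "\<beta> \<in> ?H - {\<alpha>}"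
    show "mon_eval f \<beta> * c \<beta> \<in> later \<alpha>"
    proof (cases "\<beta> \<in> S")
      case False
      then show ?thesis using small[of \<beta>] \<beta> \<alpha>' by (intro P_later) (auto simp: S_def)
    next
      case True
      then have "\<alpha> < \<beta>" using \<alpha>(2) \<beta> by fastforce
      then show ?thesis using \<beta> \<alpha>' c(2) by (intro mon_later) (auto simp: precedes_def hexps_def)
    qed
  qed
  finally have "initial a \<alpha> (c \<alpha>)" using assms \<alpha> \<alpha>' c(2) by (auto simp: initial_def S_def)
  then show ?thesis using that \<alpha>' N by blast
qed

end

text \<open>Separate maps for coefficients and exponent vectors cover polynomials in the entries of a
regular sequence as well as substitutions for the variables of a polynomial ring.\<close>

definition poly_eval :: "('k::zero \<Rightarrow> 'a::comm_semiring_1) \<Rightarrow> ('e \<Rightarrow> 'a) \<Rightarrow> ('e \<Rightarrow>\<^sub>0 'k) \<Rightarrow> 'a" where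
  "poly_eval s e p = (\<Sum>\<mu>\<in>keys p. s (lookup p \<mu>) * e \<mu>)"

definition order_term :: "((nat \<Rightarrow>\<^sub>0 nat) \<Rightarrow>\<^sub>0 'k::zero) \<Rightarrow> (nat \<Rightarrow>\<^sub>0 nat) \<Rightarrow> bool" where
  "order_term g \<beta> \<longleftrightarrow> \<beta> \<in> keys g \<and> (\<forall>\<gamma>\<in>keys g. \<gamma> \<noteq> \<beta> \<longrightarrow> precedes \<beta> \<gamma>)"

lemma order_term_exists: "g \<noteq> 0 \<Longrightarrow> \<exists>\<beta>. order_term g \<beta>"
  using precedes_least[of "keys g"] unfolding order_term_def
  by (metis finite_keys keys_eq_empty)

locale regular_tuple_over_field = regular_tuple C I f r
  for C I :: "'a::comm_ring_1 set" and f r +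
  fixes s :: "'k::field \<Rightarrow> 'a"
  assumes s_C: "s c \<in> C" and s_mult: "s (c * d) = s c * s d" and s_one: "s 1 = 1"
begin

abbreviation "ev \<equiv> poly_eval s (mon_eval f)"

lemma ev_C: "keys g \<subseteq> exps r \<Longrightarrow> ev g \<in> C"
  unfolding poly_eval_def by (intro C_sum C_mult s_C rmon_C) auto

lemma scalar_mult_notin:
  assumes "c \<noteq> 0" "e \<notin> P r 1" shows "s c * e \<notin> P r 1"
proof
  assume "s c * e \<in> P r 1"
  then have "s (inverse c) * (s c * e) \<in> P r 1" by (rule rP_mult[OF s_C])
  moreover have "s (inverse c) * (s c * e) = s (inverse c * c) * e" by (simp only: s_mult mult.assoc)
  ultimately have "s (inverse c * c) * e \<in> P r 1" by argo
  then show False using assms(2) by (simp only: left_inverse[OF assms(1)] s_one mult_1_left)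
qed

text \<open>Initial terms are multiplicative because the coefficients of \<open>g\<close> are units: they do not move \<open>e\<close> into the ideal.\<close>

lemma initial_ev_mult:
  assumes g: "keys g \<subseteq> exps r" "order_term g \<beta>" and a: "initial a \<alpha> e"
  shows "initial (ev g * a) (\<alpha> + \<beta>) (s (lookup g \<beta>) * e)"
proof -
  let ?c = "\<lambda>\<gamma>. s (lookup g \<gamma>)"
  have aC: "a \<in> C" "\<alpha> \<in> exps r" "e \<in> C" "e \<notin> P r 1" "a - mon_eval f \<alpha> * e \<in> later \<alpha>"
    using a by (auto simp: initial_def)
  have \<beta>: "\<beta> \<in> keys g" "\<beta> \<in> exps r" using g by (auto simp: order_term_def)
  have "ev g * a - mon_eval f (\<alpha> + \<beta>) * (?c \<beta> * e) =
      ?c \<beta> * (mon_eval f \<beta> * (a - mon_eval f \<alpha> * e)) +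
      (\<Sum>\<gamma>\<in>keys g - {\<beta>}. ?c \<gamma> * (mon_eval f (\<gamma> + \<alpha>) * e + mon_eval f \<gamma> * (a - mon_eval f \<alpha> * e)))"
  proof -
    have split: "mon_eval f \<gamma> * a = mon_eval f (\<gamma> + \<alpha>) * e + mon_eval f \<gamma> * (a - mon_eval f \<alpha> * e)" for \<gamma>
      by (simp add: mon_eval_add right_diff_distrib mult.assoc)
    have "ev g * a = (\<Sum>\<gamma>\<in>keys g. ?c \<gamma> * (mon_eval f \<gamma> * a))"
      by (simp add: poly_eval_def sum_distrib_right mult.assoc)
    also have "\<dots> = ?c \<beta> * (mon_eval f \<beta> * a) + (\<Sum>\<gamma>\<in>keys g - {\<beta>}. ?c \<gamma> * (mon_eval f \<gamma> * a))"
      using \<beta>(1) by (intro sum.remove) auto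
    finally have "ev g * a - mon_eval f (\<alpha> + \<beta>) * (?c \<beta> * e) =
        ?c \<beta> * (mon_eval f \<beta> * a) - mon_eval f (\<alpha> + \<beta>) * (?c \<beta> * e) +
        (\<Sum>\<gamma>\<in>keys g - {\<beta>}. ?c \<gamma> * (mon_eval f \<gamma> * a))" by simp
    moreover have "?c \<beta> * (mon_eval f \<beta> * a) - mon_eval f (\<alpha> + \<beta>) * (?c \<beta> * e) =
        ?c \<beta> * (mon_eval f \<beta> * (a - mon_eval f \<alpha> * e))"
      by (simp add: mon_eval_add right_diff_distrib mult_ac)
    ultimately show ?thesis by (simp only: split)
  qed
  also have "\<dots> \<in> later (\<alpha> + \<beta>)"
  proof (rule later_add[OF later_mult[OF s_C] later_sum[OF later_mult[OF s_C later_add]]])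
    show "mon_eval f \<beta> * (a - mon_eval f \<alpha> * e) \<in> later (\<alpha> + \<beta>)"
      using \<beta> aC by (intro mon_mult_later)
    fix \<gamma> assume \<gamma>: "\<gamma> \<in> keys g - {\<beta>}"
    then have p: "precedes (\<alpha> + \<beta>) (\<gamma> + \<alpha>)" and \<gamma>r: "\<gamma> \<in> exps r"
      using g by (auto simp: order_term_def add.commute[of \<alpha>] precedes_add)
    show "mon_eval f (\<gamma> + \<alpha>) * e \<in> later (\<alpha> + \<beta>)"
      using p \<gamma>r aC by (intro mon_later exps_add)
    show "mon_eval f \<gamma> * (a - mon_eval f \<alpha> * e) \<in> later (\<alpha> + \<beta>)"
      using mon_mult_later[OF \<gamma>r aC(5)] later_subset[OF p] by (auto simp: add.commute)
  qed
  finally show ?thesis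
    using aC \<beta> g scalar_mult_notin[of "lookup g \<beta>" e]
    by (auto simp: initial_def ev_C C_mult s_C exps_add in_keys_iff)
qed

text \<open>The conclusion says that \<open>a\<close> is zero modulo \<open>I\<close> as far as the filtration by the powers of the ideal can see.\<close>

theorem ev_torsion_free:
  assumes g: "keys g \<subseteq> exps r" "g \<noteq> 0" and a: "a \<in> C" "ev g * a \<in> I"
  shows "a \<in> P r N"
proof (rule ccontr)
  assume "a \<notin> P r N"
  then obtain \<alpha> e where "initial a \<alpha> e" using initial_exists a by blast
  moreover obtain \<beta> where "order_term g \<beta>" using order_term_exists g by blast
  ultimately have "initial (ev g * a) (\<alpha> + \<beta>) (s (lookup g \<beta>) * e)"
    using initial_ev_mult g by blast
  then show False using initial_notin_later P_later rP_I a(2) by blast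
qed

lemma ev_mult_mem_P:
  assumes g: "keys g \<subseteq> exps r" "order_term g \<beta>" and a: "a \<in> C" "ev g * a \<in> P r (N + tdeg \<beta>)"
  shows "a \<in> P r N"
proof (rule ccontr)
  assume "a \<notin> P r N"
  then obtain \<alpha> e where i: "initial a \<alpha> e" "tdeg \<alpha> < N" using initial_exists a by blast
  from initial_notin_P[OF initial_ev_mult[OF g i(1)]] i(2) a(2) show False
    by (simp add: tdeg_add)
qed

text \<open>Think of the fraction \<open>w = b i / g i\<close>, which by \<open>comp\<close> is the same for all \<open>i\<close>. Comparing initial terms in
\<open>g i * b j = g j * b i\<close> shows that the initial exponents of \<open>b i\<close> and \<open>g i\<close> differ by a vector
independent of \<open>i\<close>. Its \<open>i\<close>-th entry is not negative, because \<open>\<beta> i\<close> does not involve the variable \<open>i\<close>. So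
\<open>w\<close> starts with an honest monomial in \<open>f\<close>, and subtracting this monomial moves the initial terms of all remainders up.\<close>

theorem approximate_quotient:
  fixes g :: "nat \<Rightarrow> (nat \<Rightarrow>\<^sub>0 nat) \<Rightarrow>\<^sub>0 'k"
  assumes r: "0 < r"
    and g: "\<And>i. i < r \<Longrightarrow> keys (g i) \<subseteq> exps r"
    and \<beta>: "\<And>i. i < r \<Longrightarrow> order_term (g i) (\<beta> i)" "\<And>i. i < r \<Longrightarrow> lookup (\<beta> i) i = 0"
    and b: "\<And>i. i < r \<Longrightarrow> b i \<in> C"
    and comp: "\<And>i j. i < r \<Longrightarrow> j < r \<Longrightarrow> ev (g i) * b j - ev (g j) * b i \<in> I"
  shows "\<exists>w\<in>C. b 0 - ev (g 0) * w \<in> P r M"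
proof (rule ccontr)
  assume neg: "\<not> ?thesis"
  let ?b = "\<lambda>i w. b i - ev (g i) * w"
  let ?c = "\<lambda>i. lookup (g i) (\<beta> i)"
  have evC: "i < r \<Longrightarrow> ev (g i) \<in> C" for i using g ev_C by blast
  have bC: "i < r \<Longrightarrow> w \<in> C \<Longrightarrow> ?b i w \<in> C" for i w by (intro C_diff C_mult b evC)
  have ex: "\<exists>\<alpha> e. initial (?b 0 w) \<alpha> e \<and> tdeg \<alpha> < M" if "w \<in> C" for w
    using initial_exists[OF bC[OF r that]] neg that by metis
  \<comment> \<open>If no \<open>w\<close> is good enough, all remainders have an initial exponent of degree below \<open>M\<close>. Choose
\<open>w\<close> such that it comes last; the construction above then improves it.\<close>
  define A where "A = {\<alpha>. tdeg \<alpha> < M \<and> (\<exists>w\<in>C. \<exists>e. initial (?b 0 w) \<alpha> e)}"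
  have "A \<subseteq> (\<Union>N<M. hexps r N)" by (auto simp: A_def hexps_def initial_def)
  then have "finite A" using finite_hexps by (meson finite_UN_I finite_lessThan finite_subset)
  moreover have "A \<noteq> {}" using ex[OF C_zero] C_zero unfolding A_def by blast
  ultimately obtain \<alpha>0 where \<alpha>0: "\<alpha>0 \<in> A" "\<And>\<beta>. \<beta> \<in> A \<Longrightarrow> \<not> precedes \<alpha>0 \<beta>"
    using precedes_greatest by blast
  then obtain w e0 where w: "w \<in> C" "initial (?b 0 w) \<alpha>0 e0" unfolding A_def by blast
  have comp': "ev (g i) * ?b j w - ev (g j) * ?b i w \<in> I" if "i < r" "j < r" for i j
  proof -
    have "ev (g i) * ?b j w - ev (g j) * ?b i w = ev (g i) * b j - ev (g j) * b i"
      by (simp add: right_diff_distrib mult.left_commute)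
    then show ?thesis using comp[OF that] by simp
  qed
  have init: "\<exists>\<alpha> e. initial (?b i w) \<alpha> e" if i: "i < r" for i
  proof -
    have 1: "initial (ev (g i) * ?b 0 w) (\<alpha>0 + \<beta> i) (s (?c i) * e0)"
      by (rule initial_ev_mult[OF g[OF i] \<beta>(1)[OF i] w(2)])
    let ?N = "Suc (tdeg (\<alpha>0 + \<beta> i))"
    have "?b i w \<notin> P r ?N"
    proof
      assume "?b i w \<in> P r ?N"
      then have "ev (g 0) * ?b i w \<in> P r ?N" using evC[OF r] by (intro rP_mult)
      then have "ev (g 0) * ?b i w + (ev (g i) * ?b 0 w - ev (g 0) * ?b i w) \<in> P r ?N"
        by (rule rP_add[OF _ rP_I[OF comp'[OF i r]]])
      then show False using initial_notin_P[OF 1] by force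
    qed
    then show ?thesis using initial_exists[OF bC[OF i w(1)]] by blast
  qed
  then obtain \<alpha> e where \<alpha>: "\<And>i. i < r \<Longrightarrow> initial (?b i w) (\<alpha> i) (e i)" by metis
  have cross: "\<alpha> i + \<beta> j = \<alpha> j + \<beta> i" "s (?c j) * e i - s (?c i) * e j \<in> P r 1" if "i < r" "j < r" for i j
    using initial_unique[OF initial_ev_mult[OF g[OF that(2)] \<beta>(1)[OF that(2)] \<alpha>[OF that(1)]]
        initial_ev_mult[OF g[OF that(1)] \<beta>(1)[OF that(1)] \<alpha>[OF that(2)]] comp'[OF that(2,1)]] by auto
  define \<tau> where "\<tau> = \<alpha> 0 - \<beta> 0"
  have le: "lookup (\<beta> 0) i \<le> lookup (\<alpha> 0) i" for i
  proof (cases "i < r")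
    case True
    then have "lookup (\<alpha> i + \<beta> 0) i = lookup (\<alpha> 0 + \<beta> i) i"
      using cross(1)[OF True r] by simp
    then show ?thesis using \<beta>(2)[OF True] by (simp add: lookup_add)
  next
    case False
    have "\<beta> 0 \<in> exps r" using \<beta>(1)[OF r] g[OF r] by (auto simp: order_term_def)
    then have "lookup (\<beta> 0) i = 0" using False by (auto simp: exps_def in_keys_iff)
    then show ?thesis by simp
  qed
  have \<tau>: "\<alpha> 0 = \<tau> + \<beta> 0"
    using le by (intro poly_mapping_eqI) (simp add: \<tau>_def lookup_add lookup_minus)
  have \<tau>r: "\<tau> \<in> exps r"
    using \<alpha>[OF r] \<tau> by (auto simp: initial_def exps_def keys_add_nat)
  have c0: "?c 0 \<noteq> 0" using \<beta>(1)[OF r] by (auto simp: order_term_def in_keys_iff)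
  \<comment> \<open>The correction to \<open>w\<close> is the monomial with exponent \<open>\<tau>\<close>; its coefficient is fitted to the index \<open>0\<close>.\<close>
  define d where "d = s (inverse (?c 0)) * e 0"
  have e0C: "e 0 \<in> C" "e 0 \<notin> P r 1" using \<alpha>[OF r] by (auto simp: initial_def)
  have dC: "d \<in> C" unfolding d_def using e0C by (intro C_mult s_C)
  have dN: "d \<notin> P r 1" unfolding d_def using c0 e0C by (intro scalar_mult_notin) auto
  have i\<tau>: "initial (mon_eval f \<tau> * d) \<tau> d"
    using dC dN \<tau>r later_zero by (auto simp: initial_def C_mult rmon_C)
  have "s (?c 0) * d = s (?c 0 * inverse (?c 0)) * e 0" unfolding d_def by (simp only: s_mult mult.assoc)
  then have cd: "s (?c 0) * d = e 0" using c0 by (simp add: s_one)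
  define w' where "w' = w + mon_eval f \<tau> * d"
  have w'C: "w' \<in> C" unfolding w'_def using w dC \<tau>r by (intro C_add C_mult rmon_C)
  have i0: "initial (ev (g 0) * (mon_eval f \<tau> * d)) (\<alpha> 0) (e 0)"
    using initial_ev_mult[OF g[OF r] \<beta>(1)[OF r] i\<tau>] by (simp add: \<tau> cd)
  have "?b 0 w' = (?b 0 w - mon_eval f (\<alpha> 0) * e 0) - (ev (g 0) * (mon_eval f \<tau> * d) - mon_eval f (\<alpha> 0) * e 0)"
    by (simp add: w'_def algebra_simps)
  also have "\<dots> \<in> later (\<alpha> 0)"
    using \<alpha>[OF r] i0 by (intro later_diff[of "?b 0 w - _"]) (simp_all add: initial_def)
  finally have l: "?b 0 w' \<in> later (\<alpha> 0)" .
  obtain \<alpha>' e' where \<alpha>': "initial (?b 0 w') \<alpha>' e'" "tdeg \<alpha>' < M" using ex[OF w'C] by blast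
  have "precedes (\<alpha> 0) \<alpha>'" by (rule initial_later_precedes[OF \<alpha>'(1) l])
  moreover have "\<alpha> 0 = \<alpha>0" using initial_unique(1)[OF \<alpha>[OF r] w(2)] I_zero by simp
  moreover have "\<alpha>' \<in> A" using \<alpha>' w'C unfolding A_def by blast
  ultimately show False using \<alpha>0(2) by blast
qed

end


section \<open>Evaluating polynomials\<close>

lemma sum_single_lookup: "(\<Sum>k\<in>keys p. single k (lookup p k)) = p"
proof (rule poly_mapping_eqI)
  fix k
  have "lookup (\<Sum>k\<in>keys p. single k (lookup p k)) k = (\<Sum>j\<in>keys p. if j = k then lookup p k else 0)"
    unfolding lookup_sum by (intro sum.cong) (auto simp: lookup_single when_def)
  then show "lookup (\<Sum>k\<in>keys p. single k (lookup p k)) k = lookup p k"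
    by (auto simp: in_keys_iff)
qed

lemma poly_induct [case_names zero add single]:
  assumes "P 0" "\<And>p q. P p \<Longrightarrow> P q \<Longrightarrow> P (p + q)" "\<And>k c. P (single k c)"
  shows "P (p :: 'e \<Rightarrow>\<^sub>0 'k::comm_monoid_add)"
proof -
  have "P (\<Sum>k\<in>A. single k (lookup p k))" for A
    by (induction A rule: infinite_finite_induct) (auto intro: assms)
  then show ?thesis using sum_single_lookup[of p] by metis
qed

locale evaluation =
  fixes s :: "'k::comm_ring_1 \<Rightarrow> 'a::comm_ring_1" and e :: "'e::comm_monoid_add \<Rightarrow> 'a"
  assumes s_add: "s (c + d) = s c + s d" and s_mult: "s (c * d) = s c * s d" and s_one: "s 1 = 1"
    and e_zero: "e 0 = 1" and e_add: "e (\<mu> + \<nu>) = e \<mu> * e \<nu>"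
begin

lemma s_zero: "s 0 = 0"
  using s_add[of 0 0] by simp

lemma ev_superset: "finite A \<Longrightarrow> keys p \<subseteq> A \<Longrightarrow> poly_eval s e p = (\<Sum>\<mu>\<in>A. s (lookup p \<mu>) * e \<mu>)"
  unfolding poly_eval_def by (intro sum.mono_neutral_left) (auto simp: in_keys_iff s_zero)

lemma ev_zero [simp]: "poly_eval s e 0 = 0"
  by (simp add: poly_eval_def)

lemma ev_single [simp]: "poly_eval s e (single \<mu> c) = s c * e \<mu>"
  by (cases "c = 0") (simp_all add: poly_eval_def s_zero)

lemma ev_add: "poly_eval s e (p + q) = poly_eval s e p + poly_eval s e q"
proof -
  let ?A = "keys p \<union> keys q"
  have "poly_eval s e (p + q) = (\<Sum>\<mu>\<in>?A. s (lookup (p + q) \<mu>) * e \<mu>)"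
    by (intro ev_superset) (auto simp: Poly_Mapping.keys_add)
  also have "\<dots> = (\<Sum>\<mu>\<in>?A. s (lookup p \<mu>) * e \<mu>) + (\<Sum>\<mu>\<in>?A. s (lookup q \<mu>) * e \<mu>)"
    by (simp add: lookup_add s_add distrib_right sum.distrib)
  also have "\<dots> = poly_eval s e p + poly_eval s e q"
    by (subst (1 2) ev_superset[where A = ?A]) auto
  finally show ?thesis .
qed

lemma ev_one [simp]: "poly_eval s e 1 = 1"
  using ev_single[of 0 1] by (simp add: s_one e_zero del: ev_single)

lemma ev_uminus: "poly_eval s e (- p) = - poly_eval s e p"
  using ev_add[of p "- p"] by (simp add: eq_neg_iff_add_eq_0 add.commute)

lemma ev_diff: "poly_eval s e (p - q) = poly_eval s e p - poly_eval s e q"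
  using ev_add[of p "- q"] by (simp add: ev_uminus)

lemma ev_mult: "poly_eval s e (p * q) = poly_eval s e p * poly_eval s e q"
proof (induction p rule: poly_induct)
  case (single k c)
  show ?case
    by (induction q rule: poly_induct) (simp_all add: distrib_left distrib_right ev_add mult_single s_mult e_add mult.assoc mult.left_commute)
qed (simp_all add: distrib_right ev_add)

lemma ev_sum: "poly_eval s e (sum p A) = (\<Sum>i\<in>A. poly_eval s e (p i))"
  by (induction A rule: infinite_finite_induct) (simp_all add: ev_add)

lemma ev_power: "poly_eval s e (p ^ n) = poly_eval s e p ^ n"
  by (induction n) (simp_all add: ev_mult)

lemma ev_prod: "poly_eval s e (prod p A) = (\<Prod>i\<in>A. poly_eval s e (p i))"
  by (induction A rule: infinite_finite_induct) (simp_all add: ev_mult)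

lemma ev_mon: "poly_eval s e (mon_eval f \<alpha>) = mon_eval (\<lambda>i. poly_eval s e (f i)) \<alpha>"
  by (simp add: mon_eval_def ev_prod ev_power)

end

abbreviation constp :: "'k::comm_ring_1 \<Rightarrow> ('e::comm_monoid_add \<Rightarrow>\<^sub>0 'k)" where
  "constp \<equiv> single 0"

definition subst :: "('v \<Rightarrow> ('w, 'k::field) mpolynomial) \<Rightarrow> ('v, 'k) mpolynomial \<Rightarrow> ('w, 'k) mpolynomial" where
  "subst f = poly_eval constp (mon_eval f)"

lemma evaluation_subst: "evaluation constp (mon_eval (f :: 'v \<Rightarrow> ('w, 'k::field) mpolynomial))"
  by unfold_locales (simp_all add: single_add mult_single mon_eval_add)

lemmas subst_add = evaluation.ev_add[OF evaluation_subst, folded subst_def]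
  and subst_mult = evaluation.ev_mult[OF evaluation_subst, folded subst_def]
  and subst_zero [simp] = evaluation.ev_zero[OF evaluation_subst, folded subst_def]
  and subst_one [simp] = evaluation.ev_one[OF evaluation_subst, folded subst_def]
  and subst_diff = evaluation.ev_diff[OF evaluation_subst, folded subst_def]
  and subst_uminus = evaluation.ev_uminus[OF evaluation_subst, folded subst_def]
  and subst_single = evaluation.ev_single[OF evaluation_subst, folded subst_def]
  and subst_sum = evaluation.ev_sum[OF evaluation_subst, folded subst_def]
  and subst_mon = evaluation.ev_mon[OF evaluation_subst, folded subst_def]

lemma subst_mvar [simp]: "subst f (mvar v) = f v"
  by (simp add: mvar_def subst_single)

lemma subst_subst: "subst h (subst f p) = subst (\<lambda>i. subst h (f i)) p"
  by (induction p rule: poly_induct) (simp_all add: subst_add subst_single subst_mult subst_mon)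

lemma mon_eval_mvar: "mon_eval (mvar :: 'v \<Rightarrow> ('v, 'k::field) mpolynomial) \<mu> = single \<mu> 1"
proof -
  have e: "mvar v ^ n = (single (single v n) 1 :: ('v, 'k) mpolynomial)" for v n
    by (induction n) (simp_all add: mvar_def mult_single single_add flip: single_add)
  have p: "(\<Prod>v\<in>A. single (single v (lookup \<mu> v)) 1) = (single (\<Sum>v\<in>A. single v (lookup \<mu> v)) 1 :: ('v, 'k) mpolynomial)"
    for A by (induction A rule: infinite_finite_induct) (simp_all add: mult_single)
  show ?thesis unfolding mon_eval_def e p sum_single_lookup ..
qed

text \<open>The kernel is the prime ideal generated by the variables outside \<open>F\<close>.\<close>

definition restrict_vars :: "'v set \<Rightarrow> ('v, 'k::field) mpolynomial \<Rightarrow> ('v, 'k) mpolynomial" where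
  "restrict_vars F = subst (\<lambda>v. if v \<in> F then mvar v else 0)"

lemma mon_eval_restrict:
  "mon_eval (\<lambda>v. if v \<in> F then mvar v else 0) \<mu> =
    (if keys \<mu> \<subseteq> F then single \<mu> 1 else 0 :: ('v, 'k::field) mpolynomial)"
proof (cases "keys \<mu> \<subseteq> F")
  case True
  then have "mon_eval (\<lambda>v. if v \<in> F then mvar v else 0) \<mu> = (mon_eval mvar \<mu> :: ('v, 'k) mpolynomial)"
    unfolding mon_eval_def by (intro prod.cong) auto
  then show ?thesis using True by (simp add: mon_eval_mvar)
next
  case False
  then obtain v where "v \<in> keys \<mu>" "v \<notin> F" by blast
  then have "mon_eval (\<lambda>v. if v \<in> F then mvar v else 0) \<mu> = (0 :: ('v, 'k) mpolynomial)"
    unfolding mon_eval_def by (intro prod_zero) (auto intro!: bexI[of _ v] simp: in_keys_iff zero_power)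
  then show ?thesis using False by simp
qed

lemma lookup_restrict_vars: "lookup (restrict_vars F p) \<mu> = (if keys \<mu> \<subseteq> F then lookup p \<mu> else 0)"
  by (induction p rule: poly_induct)
    (auto simp: restrict_vars_def subst_add lookup_add subst_single mon_eval_restrict mult_single lookup_single when_def)

lemma keys_restrict_vars: "keys (restrict_vars F p) = {\<mu> \<in> keys p. keys \<mu> \<subseteq> F}"
  by (auto simp: in_keys_iff[of _ "restrict_vars F p"] in_keys_iff[of _ p] lookup_restrict_vars
      simp del: not_in_keys_iff_lookup_eq_zero split: if_splits)

lemma restrict_vars_eq_0_iff: "restrict_vars F p = 0 \<longleftrightarrow> (\<forall>\<mu>\<in>keys p. \<not> keys \<mu> \<subseteq> F)"
proof -
  have "restrict_vars F p = 0 \<longleftrightarrow> keys (restrict_vars F p) = {}" by simp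
  then show ?thesis unfolding keys_restrict_vars by blast
qed

section \<open>Monomial ideals\<close>

definition polys :: "'v set \<Rightarrow> ('v, 'k::field) mpolynomial set" where
  "polys V = {p. \<forall>\<mu>\<in>keys p. keys \<mu> \<subseteq> V}"

definition up_closed :: "(('v \<Rightarrow>\<^sub>0 nat) \<Rightarrow> bool) \<Rightarrow> bool" where
  "up_closed B \<longleftrightarrow> (\<forall>\<mu> \<nu>. B \<mu> \<longrightarrow> B (\<mu> + \<nu>))"

definition monomial_ideal :: "'v set \<Rightarrow> (('v \<Rightarrow>\<^sub>0 nat) \<Rightarrow> bool) \<Rightarrow> ('v, 'k::field) mpolynomial set" where
  "monomial_ideal V B = {p \<in> polys V. \<forall>\<mu>\<in>keys p. B \<mu>}"

lemma up_closedD: "up_closed B \<Longrightarrow> B \<mu> \<Longrightarrow> B (\<mu> + \<nu>)"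
  by (simp add: up_closed_def)

lemma up_closed_tdeg: "up_closed (\<lambda>\<mu>. N \<le> tdeg \<mu>)"
  by (auto simp: up_closed_def tdeg_add)

lemma up_closed_disj: "up_closed B \<Longrightarrow> up_closed B' \<Longrightarrow> up_closed (\<lambda>\<mu>. B \<mu> \<or> B' \<mu>)"
  by (auto simp: up_closed_def)

lemma polys_mult: 
  assumes "p \<in> polys V" "q \<in> polys V"
  shows "p * q \<in> polys V"
  unfolding polys_def
proof (intro CollectI ballI)
  fix \<mu> assume "\<mu> \<in> keys (p * q)"
  then obtain \<nu> \<kappa> where "\<mu> = \<nu> + \<kappa>" "\<nu> \<in> keys p" "\<kappa> \<in> keys q" using keys_mult[of p q] by blast
  then show "keys \<mu> \<subseteq> V" using assms by (auto simp: polys_def keys_add_nat)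
qed

lemma polys_add: "p \<in> polys V \<Longrightarrow> q \<in> polys V \<Longrightarrow> p + q \<in> polys V"
  using Poly_Mapping.keys_add[of p q] by (auto simp: polys_def)

lemma polys_basic: "1 \<in> polys V" "0 \<in> polys V" "constp c \<in> polys V" "v \<in> V \<Longrightarrow> mvar v \<in> polys V"
  by (auto simp: polys_def mvar_def)

lemma polys_uminus: "p \<in> polys V \<Longrightarrow> - p \<in> polys V"
  by (simp add: polys_def)

lemma polys_diff: "p \<in> polys V \<Longrightarrow> q \<in> polys V \<Longrightarrow> p - q \<in> polys V"
  using polys_add[of p V "- q"] polys_uminus[of q V] by simp

lemmas polys_closed = polys_basic polys_add polys_diff polys_mult polys_uminus

lemma monomial_ideal_subring_ideal:
  assumes B: "up_closed B"
  shows "subring_ideal (polys V) (monomial_ideal V B :: ('v, 'k::field) mpolynomial set)"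
proof
  show "c * a \<in> monomial_ideal V B" if c: "c \<in> polys V" and a: "a \<in> monomial_ideal V B"
    for c a :: "('v, 'k) mpolynomial"
  proof -
    have "B \<mu>" if "\<mu> \<in> keys (c * a)" for \<mu>
    proof -
      obtain \<nu> \<kappa> where "\<mu> = \<nu> + \<kappa>" "\<kappa> \<in> keys a" using \<open>\<mu> \<in> keys (c * a)\<close> keys_mult[of c a] by blast
      then show ?thesis using up_closedD[OF B, of \<kappa> \<nu>] a by (auto simp: monomial_ideal_def add.commute)
    qed
    then show ?thesis using c a by (auto simp: monomial_ideal_def polys_mult)
  qed
  show "a + b \<in> monomial_ideal V B" if "a \<in> monomial_ideal V B" "b \<in> monomial_ideal V B"
    for a b :: "('v, 'k) mpolynomial"
    using that Poly_Mapping.keys_add[of a b] by (auto simp: monomial_ideal_def polys_add)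
qed (auto simp: monomial_ideal_def intro: polys_closed)

lemma single_mem_monomial_ideal: "keys \<mu> \<subseteq> V \<Longrightarrow> B \<mu> \<Longrightarrow> single \<mu> c \<in> monomial_ideal V B"
  by (auto simp: monomial_ideal_def polys_def)

lemma lookup_mult_single_add: "lookup (single \<nu> c * p) (\<nu> + \<mu>) = c * lookup (p :: ('v, 'k::field) mpolynomial) \<mu>"
  by (induction p rule: poly_induct) (auto simp: mult_single lookup_single when_def distrib_left lookup_add)

lemma keys_mult_single:
  fixes c :: "'k::field"
  assumes "c \<noteq> 0"
  shows "keys (single \<nu> c * p) = (\<lambda>\<mu>. \<nu> + \<mu>) ` keys (p :: ('v, 'k) mpolynomial)"
proof -
  note l = lookup_mult_single_add[of \<nu> c p]
  show ?thesis
  proof (intro equalityI subsetI)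
    fix \<kappa> assume \<kappa>: "\<kappa> \<in> keys (single \<nu> c * p)"
    then obtain a b where "\<kappa> = a + b" "a \<in> keys (single \<nu> c)" "b \<in> keys p"
      using keys_mult[of "single \<nu> c" p] by blast
    then show "\<kappa> \<in> (\<lambda>\<mu>. \<nu> + \<mu>) ` keys p" using assms by auto
  next
    fix \<kappa> assume "\<kappa> \<in> (\<lambda>\<mu>. \<nu> + \<mu>) ` keys p"
    then show "\<kappa> \<in> keys (single \<nu> c * p)" using l assms by (auto simp: in_keys_iff)
  qed
qed

text \<open>If the entries of \<open>f\<close> have no constant term, then the monomials of small degree of an element of a high power
are in the monomial ideal. Hence an element of all powers is in the monomial ideal.\<close>

lemma ideal_power_monomial:
  fixes f :: "nat \<Rightarrow> ('v, 'k::field) mpolynomial"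
  assumes B: "up_closed B" and f: "\<And>i. i < r \<Longrightarrow> f i \<in> monomial_ideal V (\<lambda>\<mu>. 1 \<le> tdeg \<mu>)"
    and "k \<le> r"
  shows "ideal_power (polys V) (monomial_ideal V B) f k N \<subseteq> monomial_ideal V (\<lambda>\<mu>. B \<mu> \<or> N \<le> tdeg \<mu>)"
  using \<open>k \<le> r\<close>
proof (induction k arbitrary: N)
  case 0
  then show ?case by (cases N) (auto simp: monomial_ideal_def)
next
  case IHk: (Suc k)
  let ?M = "\<lambda>N. monomial_ideal V (\<lambda>\<mu>. B \<mu> \<or> N \<le> tdeg \<mu>) :: ('v, 'k) mpolynomial set"
  have sub: "subring_ideal (polys V) (?M N)" for N
    by (intro monomial_ideal_subring_ideal up_closed_disj B up_closed_tdeg)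
  show ?case
  proof (induction N)
    case 0
    then show ?case by (auto simp: monomial_ideal_def)
  next
    case (Suc N)
    show ?case
    proof
      fix x assume "x \<in> ideal_power (polys V) (monomial_ideal V B) f (Suc k) (Suc N)"
      then obtain a b where x: "x = a + f k * b" "a \<in> ?M (Suc N)" "b \<in> ?M N"
        using Suc IHk by fastforce
      have fk: "f k \<in> monomial_ideal V (\<lambda>\<mu>. 1 \<le> tdeg \<mu>)" using f IHk.prems by simp
      have "B \<mu> \<or> Suc N \<le> tdeg \<mu>" if \<mu>: "\<mu> \<in> keys (f k * b)" for \<mu>
      proof -
        obtain \<nu> \<kappa> where e: "\<mu> = \<nu> + \<kappa>" "\<nu> \<in> keys (f k)" "\<kappa> \<in> keys b"
          using \<mu> keys_mult[of "f k" b] by blast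
        have "B \<kappa> \<or> N \<le> tdeg \<kappa>" "1 \<le> tdeg \<nu>" using e fk x(3) by (auto simp: monomial_ideal_def)
        then show ?thesis using up_closedD[OF B, of \<kappa> \<nu>] by (auto simp: e(1) tdeg_add add.commute)
      qed
      then have "f k * b \<in> ?M (Suc N)"
        using fk x(3) by (auto simp: monomial_ideal_def polys_mult)
      then show "x \<in> ?M (Suc N)" unfolding x(1) by (intro subring_ideal.I_add[OF sub] x(2))
    qed
  qed
qed


lemma lookup_mvar_mult:
  "lookup (mvar x * p) \<kappa> = (if x \<in> keys \<kappa> then lookup p (\<kappa> - single x 1) else 0)"
  for p :: "('v, 'k::field) mpolynomial"
proof (cases "x \<in> keys \<kappa>")
  case True
  then have "\<kappa> = single x 1 + (\<kappa> - single x 1)"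
    by (intro poly_mapping_eqI) (auto simp: lookup_add lookup_minus lookup_single when_def in_keys_iff)
  then show ?thesis using True lookup_mult_single_add[of "single x 1" 1 p "\<kappa> - single x 1"]
    by (simp add: mvar_def)
next
  case False
  then have "\<kappa> \<notin> keys (mvar x * p)"
    by (auto simp: mvar_def keys_mult_single keys_add_nat)
  then show ?thesis using False by (simp add: in_keys_iff)
qed

text \<open>If \<open>p\<close> has monomials outside the ideal, take one with the largest exponent of \<open>x\<close>. Its product with \<open>x\<close> cannot
cancel, so it is in the ideal, and by \<open>star\<close> no product with a power of \<open>y\<close> is. Therefore
the product with \<open>y\<close> has to cancel, which yields another monomial of \<open>p\<close> with one \<open>x\<close> replaced by \<open>y\<close>. The same holds
for the new monomial, and so on until no \<open>x\<close> is left to be replaced.\<close>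

lemma mvar_diff_nonzerodivisor:
  fixes p :: "('v, 'k::field) mpolynomial"
  assumes B: "up_closed B" and xy: "x \<noteq> y"
    and star: "\<And>\<mu>. B (\<mu> + single x 1) \<Longrightarrow> B (\<mu> + single y 1) \<Longrightarrow> B \<mu>"
    and p: "p \<in> polys V" and q: "(mvar x - mvar y) * p \<in> monomial_ideal V B"
  shows "p \<in> monomial_ideal V B"
proof (rule ccontr)
  assume "p \<notin> monomial_ideal V B"
  define K where "K = {\<mu> \<in> keys p. \<not> B \<mu>}"
  have K: "finite K" "K \<noteq> {}" using p \<open>p \<notin> _\<close> by (auto simp: K_def monomial_ideal_def)
  let ?q = "(mvar x - mvar y) * p"
  let ?X = "single x (1::nat)" and ?Y = "single y (1::nat)"
  have lq: "lookup ?q \<kappa> = lookup (mvar x * p) \<kappa> - lookup (mvar y * p) \<kappa>" for \<kappa>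
    by (simp add: left_diff_distrib lookup_minus)
  have qB: "B \<kappa>" if "lookup ?q \<kappa> \<noteq> 0" for \<kappa>
    using q that by (auto simp: monomial_ideal_def in_keys_iff)
  obtain \<mu> where \<mu>: "\<mu> \<in> K" "\<And>\<nu>. \<nu> \<in> K \<Longrightarrow> lookup \<nu> x \<le> lookup \<mu> x"
    using finite_imageI[OF K(1), of "\<lambda>\<nu>. lookup \<nu> x"] K(2)
      Max_in[of "(\<lambda>\<nu>. lookup \<nu> x) ` K"] Max_ge[of "(\<lambda>\<nu>. lookup \<nu> x) ` K"]
    by (metis (no_types, lifting) image_iff image_is_empty)
  have BX: "B (\<mu> + ?X)"
  proof (cases "y \<in> keys (\<mu> + ?X) \<and> \<mu> + ?X - ?Y \<in> keys p")
    case True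
    let ?\<nu> = "\<mu> + ?X - ?Y"
    have e: "?\<nu> + ?Y = \<mu> + ?X"
      using True by (intro poly_mapping_eqI) (auto simp: lookup_add lookup_minus lookup_single when_def in_keys_iff)
    have "lookup ?\<nu> x = Suc (lookup \<mu> x)" using xy by (simp add: lookup_add lookup_minus lookup_single when_def)
    then have "?\<nu> \<notin> K" using \<mu>(2)[of ?\<nu>] by auto
    then have "B ?\<nu>" using True by (auto simp: K_def)
    then show ?thesis using up_closedD[OF B, of ?\<nu> ?Y] e by simp
  next
    case False
    then have "lookup (mvar y * p) (\<mu> + ?X) = 0" by (auto simp: lookup_mvar_mult in_keys_iff)
    moreover have "lookup (mvar x * p) (\<mu> + ?X) = lookup p \<mu>"
      by (simp add: lookup_mvar_mult keys_add_nat)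
    ultimately show ?thesis using \<mu>(1) by (intro qB) (auto simp: lq K_def in_keys_iff)
  qed
  have NY: "\<not> B (\<mu> + single y j)" for j
  proof (induction j)
    case 0
    then show ?case using \<mu> by (simp add: K_def)
  next
    case (Suc j)
    have "B (\<mu> + single y j + ?X)" using up_closedD[OF B BX, of "single y j"] by (simp add: add_ac)
    then have "\<not> B (\<mu> + single y j + ?Y)" using star Suc by blast
    then show ?case by (simp add: add.assoc flip: single_add)
  qed
  \<comment> \<open>The monomials of \<open>p\<close> reached from \<open>\<mu>\<close> by replacing \<open>k\<close> factors \<open>x\<close> by \<open>y\<close>.\<close>
  define K' where "K' = {\<nu> \<in> K. \<exists>k. \<nu> + single x k = \<mu> + single y k}"
  have "\<mu> \<in> K'" using \<mu> by (auto simp: K'_def intro!: exI[of _ 0])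
  then obtain \<nu> where \<nu>: "\<nu> \<in> K'" "\<And>\<kappa>. \<kappa> \<in> K' \<Longrightarrow> lookup \<nu> x \<le> lookup \<kappa> x"
    using ex_has_least_nat[of "\<lambda>\<nu>. \<nu> \<in> K'" \<mu> "\<lambda>\<nu>. lookup \<nu> x"] by blast
  then obtain k where k: "\<nu> + single x k = \<mu> + single y k" and \<nu>K: "\<nu> \<in> K" by (auto simp: K'_def)
  have e1: "\<nu> + ?Y + single x k = \<mu> + single y (Suc k)"
    using k by (metis (no_types, lifting) add.assoc add.commute plus_1_eq_Suc single_add)
  have NB: "\<not> B (\<nu> + ?Y)" using up_closedD[OF B, of "\<nu> + ?Y" "single x k"] NY[of "Suc k"] e1 by auto
  then have "lookup ?q (\<nu> + ?Y) = 0" using qB by blast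
  moreover have "lookup (mvar y * p) (\<nu> + ?Y) = lookup p \<nu>"
    by (simp add: lookup_mvar_mult keys_add_nat)
  moreover have "lookup p \<nu> \<noteq> 0" using \<nu>K by (auto simp: K_def in_keys_iff)
  ultimately have "lookup (mvar x * p) (\<nu> + ?Y) \<noteq> 0" by (simp add: lq)
  then have x: "x \<in> keys (\<nu> + ?Y)" "\<nu> + ?Y - ?X \<in> keys p"
    by (auto simp: lookup_mvar_mult in_keys_iff split: if_splits)
  let ?\<nu> = "\<nu> + ?Y - ?X"
  have xn: "lookup \<nu> x > 0" using x xy by (auto simp: in_keys_iff lookup_add lookup_single when_def)
  have e: "?\<nu> + ?X = \<nu> + ?Y"
    using xn by (intro poly_mapping_eqI) (auto simp: lookup_add lookup_minus lookup_single when_def in_keys_iff)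
  have "\<not> B ?\<nu>" using up_closedD[OF B, of ?\<nu> ?X] NB e by auto
  moreover have "?\<nu> + single x (Suc k) = \<mu> + single y (Suc k)"
    using e e1 by (metis (no_types, lifting) add.assoc plus_1_eq_Suc single_add)
  ultimately have "?\<nu> \<in> K'" using x(2) unfolding K'_def K_def by blast
  moreover have "lookup ?\<nu> x < lookup \<nu> x" using xn xy by (simp add: lookup_add lookup_minus lookup_single when_def)
  ultimately show False using \<nu>(2)[of ?\<nu>] by simp
qed

section \<open>Algebraic dependence\<close>

text \<open>Elimination of one unknown for each equation.\<close>

lemma homogeneous_system_nontrivial:
  fixes m :: "'i \<Rightarrow> 'j \<Rightarrow> 'k::field"
  assumes "finite B" "finite A" "card B < card A"
  shows "\<exists>c. (\<exists>a\<in>A. c a \<noteq> 0) \<and> (\<forall>b\<in>B. (\<Sum>a\<in>A. c a * m a b) = 0)"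
  using assms
proof (induction B arbitrary: A m rule: finite_induct)
  case empty
  then have "A \<noteq> {}" by auto
  then show ?case by (intro exI[of _ "\<lambda>_. 1"]) auto
next
  case (insert b0 B)
  show ?case
  proof (cases "\<forall>a\<in>A. m a b0 = 0")
    case True
    have "card B < card A" using insert by simp
    then obtain c where "\<exists>a\<in>A. c a \<noteq> 0" "\<forall>b\<in>B. (\<Sum>a\<in>A. c a * m a b) = 0"
      using insert.IH[OF insert.prems(1), of m] by blast
    then show ?thesis using True by (intro exI[of _ c]) auto
  next
    case False
    then obtain a0 where a0: "a0 \<in> A" "m a0 b0 \<noteq> 0" by blast
    define A' where "A' = A - {a0}"
    have A': "finite A'" "card B < card A'" using insert a0 by (auto simp: A'_def)
    define t where "t = (\<lambda>a. m a b0 / m a0 b0)"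
    obtain c where c: "\<exists>a\<in>A'. c a \<noteq> 0" "\<forall>b\<in>B. (\<Sum>a\<in>A'. c a * (m a b - t a * m a0 b)) = 0"
      using insert.IH[OF A', of "\<lambda>a b. m a b - t a * m a0 b"] by blast
    define d where "d = c(a0 := - (\<Sum>a\<in>A'. c a * t a))"
    have s: "(\<Sum>a\<in>A. d a * m a b) = (\<Sum>a\<in>A'. c a * m a b) - (\<Sum>a\<in>A'. c a * t a) * m a0 b" for b
    proof -
      have "(\<Sum>a\<in>A. d a * m a b) = d a0 * m a0 b + (\<Sum>a\<in>A'. d a * m a b)"
        using a0 insert.prems(1) by (simp add: A'_def sum.remove)
      also have "(\<Sum>a\<in>A'. d a * m a b) = (\<Sum>a\<in>A'. c a * m a b)"
        by (intro sum.cong) (auto simp: A'_def d_def)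
      finally show ?thesis by (simp add: d_def)
    qed
    have "(\<Sum>a\<in>A. d a * m a b) = 0" if "b \<in> insert b0 B" for b
    proof (cases "b = b0")
      case True
      have "(\<Sum>a\<in>A'. c a * t a) * m a0 b0 = (\<Sum>a\<in>A'. c a * m a b0)"
        using a0 by (simp add: sum_distrib_right t_def)
      then show ?thesis using s True by simp
    next
      case False
      then have "(\<Sum>a\<in>A'. c a * (m a b - t a * m a0 b)) = 0" using c that by blast
      then show ?thesis unfolding s by (simp add: right_diff_distrib sum_subtractf sum_distrib_right mult.assoc)
    qed
    moreover have "\<exists>a\<in>A. d a \<noteq> 0" using c(1) by (auto simp: A'_def d_def)
    ultimately show ?thesis by blast
  qed
qed

lemma card_exponent_box:
  assumes S: "finite S" and N: "0 < N"
  shows "finite {\<alpha> :: 'i \<Rightarrow>\<^sub>0 nat. keys \<alpha> \<subseteq> S \<and> (\<forall>i. lookup \<alpha> i < N)}"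
    and "card {\<alpha> :: 'i \<Rightarrow>\<^sub>0 nat. keys \<alpha> \<subseteq> S \<and> (\<forall>i. lookup \<alpha> i < N)} = N ^ card S"
proof -
  let ?A = "{\<alpha> :: 'i \<Rightarrow>\<^sub>0 nat. keys \<alpha> \<subseteq> S \<and> (\<forall>i. lookup \<alpha> i < N)}"
  have bij: "bij_betw (\<lambda>\<alpha>. restrict (lookup \<alpha>) S) ?A (S \<rightarrow>\<^sub>E {..<N})"
  proof (rule bij_betwI[where g = "\<lambda>h. Abs_poly_mapping (\<lambda>i. if i \<in> S then h i else 0)"])
    have l: "lookup (Abs_poly_mapping (\<lambda>i. if i \<in> S then h i else 0)) = (\<lambda>i. if i \<in> S then h i else (0::nat))" for h
      using S by (intro lookup_Abs_poly_mapping) (auto elim: rev_finite_subset)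
    show "(\<lambda>\<alpha>. restrict (lookup \<alpha>) S) \<in> ?A \<rightarrow> (S \<rightarrow>\<^sub>E {..<N})" by auto
    show "(\<lambda>h. Abs_poly_mapping (\<lambda>i. if i \<in> S then h i else 0)) \<in> (S \<rightarrow>\<^sub>E {..<N}) \<rightarrow> ?A"
      using N by (auto simp: in_keys_iff l split: if_splits)
    show "Abs_poly_mapping (\<lambda>i. if i \<in> S then restrict (lookup \<alpha>) S i else 0) = \<alpha>" if "\<alpha> \<in> ?A" for \<alpha>
      using that by (intro poly_mapping_eqI) (auto simp: l in_keys_iff)
    show "restrict (lookup (Abs_poly_mapping (\<lambda>i. if i \<in> S then h i else 0))) S = h"
      if "h \<in> S \<rightarrow>\<^sub>E {..<N}" for h
      using that by (intro ext) (auto simp: l PiE_def extensional_def)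
  qed
  show "finite ?A" "card ?A = N ^ card S"
    unfolding bij_betw_finite[OF bij] bij_betw_same_card[OF bij]
    using finite_PiE[OF S, of "\<lambda>_. {..<N}"] card_PiE[OF S, of "\<lambda>_. {..<N}"] by (auto simp: prod_constant)
qed

lemma lookup_le_tdeg: "lookup \<mu> v \<le> tdeg \<mu>"
proof (cases "v \<in> keys \<mu>")
  case True
  then show ?thesis unfolding tdeg_def by (intro member_le_sum) auto
qed (simp add: in_keys_iff)

definition polys_deg :: "'v set \<Rightarrow> nat \<Rightarrow> ('v, 'k::field) mpolynomial set" where
  "polys_deg F n = {p \<in> polys F. \<forall>\<mu>\<in>keys p. tdeg \<mu> \<le> n}"

lemma polys_deg_mult: 
  assumes "p \<in> polys_deg F m" "q \<in> polys_deg F n"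
  shows "p * q \<in> polys_deg F (m + n)"
proof -
  have "tdeg \<mu> \<le> m + n" if "\<mu> \<in> keys (p * q)" for \<mu>
  proof -
    obtain \<nu> \<kappa> where "\<mu> = \<nu> + \<kappa>" "\<nu> \<in> keys p" "\<kappa> \<in> keys q" using \<open>\<mu> \<in> keys (p * q)\<close> keys_mult[of p q] by blast
    then show ?thesis using assms by (auto simp: polys_deg_def tdeg_add intro!: add_mono)
  qed
  then show ?thesis using assms by (auto simp: polys_deg_def polys_mult)
qed

lemma polys_deg_one: "1 \<in> polys_deg F 0"
  by (auto simp: polys_deg_def polys_closed)

lemma polys_deg_power: "p \<in> polys_deg F D \<Longrightarrow> p ^ n \<in> polys_deg F (n * D)"
  by (induction n) (auto simp: polys_deg_one polys_deg_mult)

lemma polys_deg_mon_eval: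
  assumes "\<And>i. i \<in> keys \<alpha> \<Longrightarrow> f i \<in> polys_deg F D"
  shows "mon_eval f \<alpha> \<in> polys_deg F (tdeg \<alpha> * D)"
proof -
  have "(\<Prod>i\<in>A. f i ^ lookup \<alpha> i) \<in> polys_deg F ((\<Sum>i\<in>A. lookup \<alpha> i) * D)" if "A \<subseteq> keys \<alpha>" for A
    using finite_subset[OF that finite_keys] that
    by (induction A rule: finite_induct)
      (auto simp: polys_deg_one distrib_right intro!: polys_deg_mult polys_deg_power assms)
  then show ?thesis unfolding mon_eval_def tdeg_def by blast
qed

text \<open>A dimension count: the number of monomials in the \<open>f i\<close> with exponents below \<open>N\<close> grows like \<open>N\<close> to the power
\<open>card S\<close>, while their values lie in a space of dimension proportional to \<open>N\<close> to the power \<open>card F\<close>.\<close>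

lemma algebraic_dependence:
  fixes f :: "'i \<Rightarrow> ('v, 'k::field) mpolynomial"
  assumes S: "finite S" and F: "finite F" and card: "card F < card S"
    and f: "\<And>i. i \<in> S \<Longrightarrow> f i \<in> polys F"
  shows "\<exists>g. g \<noteq> 0 \<and> (\<forall>\<alpha>\<in>keys g. keys \<alpha> \<subseteq> S) \<and> subst f g = 0"
proof -
  let ?k = "card S" and ?d = "card F"
  define D where "D = Max (insert 0 (\<Union>i\<in>S. tdeg ` keys (f i)))"
  have D: "f i \<in> polys_deg F D" if "i \<in> S" for i
  proof -
    have "tdeg \<mu> \<le> D" if "\<mu> \<in> keys (f i)" for \<mu>
      unfolding D_def using S \<open>i \<in> S\<close> that by (intro Max_ge) auto
    then show ?thesis using f that by (auto simp: polys_deg_def)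
  qed
  \<comment> \<open>\<open>D\<close> bounds the degrees of the \<open>f i\<close>, so the monomials have degree at most \<open>L\<close>, and \<open>N\<close> is
large enough for \<open>(L + 1) ^ d < N ^ k\<close>.\<close>
  define N where "N = Suc ((?k * D + 1) ^ ?d)"
  define L where "L = ?k * N * D"
  define A where "A = {\<alpha> :: 'i \<Rightarrow>\<^sub>0 nat. keys \<alpha> \<subseteq> S \<and> (\<forall>i. lookup \<alpha> i < N)}"
  define M where "M = {\<mu> :: 'v \<Rightarrow>\<^sub>0 nat. keys \<mu> \<subseteq> F \<and> (\<forall>v. lookup \<mu> v < Suc L)}"
  have N: "0 < N" by (simp add: N_def)
  have A: "finite A" "card A = N ^ ?k" and M: "finite M" "card M = Suc L ^ ?d"
    unfolding A_def M_def using card_exponent_box[OF S N] card_exponent_box[OF F, of "Suc L"] by auto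
  have "Suc L ^ ?d \<le> ((?k * D + 1) * N) ^ ?d"
    using N by (intro power_mono) (auto simp: L_def algebra_simps)
  also have "\<dots> = (?k * D + 1) ^ ?d * N ^ ?d" by (rule power_mult_distrib)
  also have "\<dots> < N * N ^ ?d" using N by (intro mult_strict_right_mono) (auto simp: N_def)
  also have "\<dots> = N ^ Suc ?d" by simp
  also have "\<dots> \<le> N ^ ?k" using N card by (intro power_increasing) auto
  finally have "card M < card A" using A M by simp
  then obtain c where c: "\<exists>\<alpha>\<in>A. c \<alpha> \<noteq> 0" "\<forall>\<mu>\<in>M. (\<Sum>\<alpha>\<in>A. c \<alpha> * lookup (mon_eval f \<alpha>) \<mu>) = 0"
    using homogeneous_system_nontrivial[OF M(1) A(1), of "\<lambda>\<alpha> \<mu>. lookup (mon_eval f \<alpha>) \<mu>"] by blast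
  define g where "g = (\<Sum>\<alpha>\<in>A. single \<alpha> (c \<alpha>))"
  have lg: "lookup g \<alpha> = (if \<alpha> \<in> A then c \<alpha> else 0)" for \<alpha>
    unfolding g_def lookup_sum using A by (simp add: lookup_single when_def)
  have inM: "\<mu> \<in> M" if "\<alpha> \<in> A" "\<mu> \<in> keys (mon_eval f \<alpha>)" for \<alpha> \<mu>
  proof -
    have "mon_eval f \<alpha> \<in> polys_deg F (tdeg \<alpha> * D)"
      using that D by (intro polys_deg_mon_eval) (auto simp: A_def)
    then have \<mu>: "keys \<mu> \<subseteq> F" "tdeg \<mu> \<le> tdeg \<alpha> * D" using that by (auto simp: polys_deg_def polys_def)
    have "tdeg \<alpha> = (\<Sum>i\<in>S. lookup \<alpha> i)" using that S by (intro tdeg_superset) (auto simp: A_def)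
    also have "\<dots> \<le> (\<Sum>i\<in>S. N)" using that by (intro sum_mono) (auto simp: A_def less_imp_le)
    finally have "tdeg \<alpha> * D \<le> L" by (simp add: L_def)
    then have "lookup \<mu> v < Suc L" for v using \<mu>(2) lookup_le_tdeg[of \<mu> v] by linarith
    then show ?thesis using \<mu> by (auto simp: M_def)
  qed
  have "subst f g = (\<Sum>\<alpha>\<in>A. constp (c \<alpha>) * mon_eval f \<alpha>)"
    by (simp add: g_def subst_sum subst_single)
  also have "\<dots> = 0"
  proof (rule poly_mapping_eqI)
    fix \<mu>
    have "lookup (\<Sum>\<alpha>\<in>A. constp (c \<alpha>) * mon_eval f \<alpha>) \<mu> = (\<Sum>\<alpha>\<in>A. c \<alpha> * lookup (mon_eval f \<alpha>) \<mu>)"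
      by (simp add: lookup_sum lookup_mult_single_add[of 0, simplified])
    also have "\<dots> = 0"
    proof (cases "\<mu> \<in> M")
      case False
      then show ?thesis using inM by (intro sum.neutral) (auto simp: in_keys_iff)
    qed (use c in auto)
    finally show "lookup (\<Sum>\<alpha>\<in>A. constp (c \<alpha>) * mon_eval f \<alpha>) \<mu> = lookup 0 \<mu>" by simp
  qed
  finally have "subst f g = 0" .
  moreover have "g \<noteq> 0" using c(1) lg by (metis lookup_zero)
  moreover have "keys g \<subseteq> A" using lg by (metis in_keys_iff subsetI)
  then have "\<forall>\<alpha>\<in>keys g. keys \<alpha> \<subseteq> S" unfolding A_def by blast
  ultimately show ?thesis by blast
qed


section \<open>Upper bounds for the length of a regular sequence\<close>

lemma restrict_vars_polys: "restrict_vars F p \<in> polys F"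
  by (auto simp: polys_def keys_restrict_vars)

lemma restricted_relation:
  fixes f :: "nat \<Rightarrow> ('v, 'k::field) mpolynomial"
  assumes "finite S" "finite F" "card F < card S"
  shows "\<exists>g. g \<noteq> 0 \<and> (\<forall>\<alpha>\<in>keys g. keys \<alpha> \<subseteq> S) \<and> restrict_vars F (subst f g) = 0"
  using algebraic_dependence[OF assms restrict_vars_polys, of f]
  unfolding restrict_vars_def subst_subst .

locale monomial_regular_tuple =
  regular_tuple "polys V" "monomial_ideal V B" f r
  for V :: "'v set" and B and f :: "nat \<Rightarrow> ('v, 'k::field) mpolynomial" and r +
  assumes B: "up_closed B" and f_pos: "i < r \<Longrightarrow> f i \<in> monomial_ideal V (\<lambda>\<mu>. 1 \<le> tdeg \<mu>)"
begin

sublocale regular_tuple_over_field "polys V" "monomial_ideal V B" f r "constp :: 'k \<Rightarrow> _"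
  by unfold_locales (simp_all add: polys_closed mult_single)

lemma P_monomial: "P r N \<subseteq> monomial_ideal V (\<lambda>\<mu>. B \<mu> \<or> N \<le> tdeg \<mu>)"
  by (rule ideal_power_monomial[OF B f_pos le_refl])

text \<open>Modulo the variables outside \<open>F\<close>, which kill \<open>z\<close>, more than \<open>card F\<close> entries of \<open>f\<close> satisfy a polynomial relation \<open>g\<close>. Then \<open>g(f)\<close>
kills \<open>z\<close>, in contradiction to \<open>ev_torsion_free\<close>.\<close>

theorem length_le_annihilated:
  fixes z :: "('v, 'k) mpolynomial"
  assumes F: "finite F" and z: "z \<in> polys V" "z \<notin> monomial_ideal V B"
    and ann: "\<And>p. p \<in> polys V \<Longrightarrow> restrict_vars F p = 0 \<Longrightarrow> p * z \<in> monomial_ideal V B"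
  shows "r \<le> card F"
proof (rule ccontr)
  assume "\<not> r \<le> card F"
  then obtain g where g: "g \<noteq> 0" "\<forall>\<alpha>\<in>keys g. keys \<alpha> \<subseteq> {..<r}" "restrict_vars F (subst f g) = 0"
    using restricted_relation[of "{..<r}" F f] F by auto
  have gr: "keys g \<subseteq> exps r" using g(2) by (auto simp: exps_def)
  have "subst f g * z \<in> monomial_ideal V B"
    using ann[OF ev_C[OF gr, folded subst_def] g(3)] .
  then have zP: "z \<in> P r N" for N
    using ev_torsion_free[OF gr g(1) z(1)] by (simp add: subst_def)
  define N where "N = Suc (Max (insert 0 (tdeg ` keys z)))"
  have "tdeg \<mu> < N" if "\<mu> \<in> keys z" for \<mu>
    using that by (simp add: N_def less_Suc_eq_le)
  then have "z \<in> monomial_ideal V B"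
    using zP[of N] P_monomial[of N] z(1) by (fastforce simp: monomial_ideal_def)
  with z(2) show False by blast
qed

text \<open>The analogue of \<open>length_le_annihilated\<close> for the quotient by \<open>\<theta>\<close>, stated for a sequence that is
regular before dividing by \<open>\<theta>\<close>. If \<open>r\<close> exceeds \<open>card F + 1\<close>, there are relations among the entries of \<open>f\<close> on \<open>F\<close>
even after omitting an arbitrary one, and multiplying the fraction \<open>z / \<theta>\<close> by such a relation gives an element of the ring. By
\<open>approximate_quotient\<close> the fraction itself is an element of the ring up to high order, so \<open>z\<close> is a multiple of \<open>\<theta>\<close> up to high order.\<close>

theorem length_le_annihilated_mod_nonzerodivisor:
  fixes z \<theta> :: "('v, 'k) mpolynomial"
  assumes F: "finite F" and \<theta>: "\<theta> \<in> polys V"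
    and nzd: "\<And>a. a \<in> polys V \<Longrightarrow> \<theta> * a \<in> monomial_ideal V B \<Longrightarrow> a \<in> monomial_ideal V B"
    and z: "z \<in> polys V" "\<And>w. w \<in> polys V \<Longrightarrow> z - \<theta> * w \<notin> monomial_ideal V (\<lambda>\<mu>. B \<mu> \<or> N \<le> tdeg \<mu>)"
    and ann: "\<And>p. p \<in> polys V \<Longrightarrow> restrict_vars F p = 0 \<Longrightarrow> \<exists>b\<in>polys V. p * z - \<theta> * b \<in> monomial_ideal V B"
  shows "r \<le> card F + 1"
proof (rule ccontr)
  assume r: "\<not> r \<le> card F + 1"
  have "\<exists>g. g \<noteq> 0 \<and> (\<forall>\<alpha>\<in>keys g. keys \<alpha> \<subseteq> {..<r} - {i}) \<and> restrict_vars F (subst f g) = 0" if "i < r" for i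
    using restricted_relation[of "{..<r} - {i}" F f] F r that by auto
  then obtain g where g: "\<And>i. i < r \<Longrightarrow> g i \<noteq> 0" "\<And>i \<alpha>. i < r \<Longrightarrow> \<alpha> \<in> keys (g i) \<Longrightarrow> keys \<alpha> \<subseteq> {..<r} - {i}"
    "\<And>i. i < r \<Longrightarrow> restrict_vars F (subst f (g i)) = 0" by metis
  have gr: "keys (g i) \<subseteq> exps r" if "i < r" for i using g(2)[OF that] by (force simp: exps_def)
  have "\<exists>\<beta>. order_term (g i) \<beta>" if "i < r" for i using order_term_exists g(1) that by blast
  then obtain \<beta> where \<beta>: "\<And>i. i < r \<Longrightarrow> order_term (g i) (\<beta> i)" by metis
  have \<beta>0: "lookup (\<beta> i) i = 0" if "i < r" for i
    using g(2)[OF that, of "\<beta> i"] \<beta>[OF that] by (auto simp: order_term_def in_keys_iff)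
  have evC: "ev (g i) \<in> polys V" if "i < r" for i using ev_C gr that by blast
  have "\<exists>b\<in>polys V. ev (g i) * z - \<theta> * b \<in> monomial_ideal V B" if "i < r" for i
    using ann[OF evC[OF that]] g(3)[OF that] by (simp add: subst_def)
  then obtain b where b: "\<And>i. i < r \<Longrightarrow> b i \<in> polys V"
    "\<And>i. i < r \<Longrightarrow> ev (g i) * z - \<theta> * b i \<in> monomial_ideal V B" by metis
  have comp: "ev (g i) * b j - ev (g j) * b i \<in> monomial_ideal V B" if ij: "i < r" "j < r" for i j
  proof (rule nzd)
    show "ev (g i) * b j - ev (g j) * b i \<in> polys V"
      using ij b(1) evC by (intro polys_diff polys_mult)
    have "\<theta> * (ev (g i) * b j - ev (g j) * b i) =
        ev (g j) * (ev (g i) * z - \<theta> * b i) + (- ev (g i)) * (ev (g j) * z - \<theta> * b j)"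
      by (simp add: algebra_simps)
    also have "\<dots> \<in> monomial_ideal V B"
      using ij by (intro I_add I_mult b(2) evC polys_uminus)
    finally show "\<theta> * (ev (g i) * b j - ev (g j) * b i) \<in> monomial_ideal V B" .
  qed
  have r0: "0 < r" using r by simp
  obtain w where w: "w \<in> polys V" "b 0 - ev (g 0) * w \<in> P r (N + tdeg (\<beta> 0))"
    using approximate_quotient[OF r0 gr \<beta> \<beta>0 b(1) comp] by blast
  have "ev (g 0) * (z - \<theta> * w) = (ev (g 0) * z - \<theta> * b 0) + \<theta> * (b 0 - ev (g 0) * w)"
    by (simp add: algebra_simps)
  also have "\<dots> \<in> P r (N + tdeg (\<beta> 0))"
    by (rule rP_add[OF rP_I[OF b(2)[OF r0]] rP_mult[OF \<theta> w(2)]])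
  finally have "z - \<theta> * w \<in> P r N"
    using ev_mult_mem_P[OF gr[OF r0] \<beta>[OF r0]] z(1) \<theta> w(1) by (simp add: polys_diff polys_mult)
  then show False using z(2)[OF w(1)] P_monomial by blast
qed

end

section \<open>Ideals and regular sequences in a quotient ring\<close>

locale cring_ideal = cring R + ideal I R for R (structure) and I
begin

abbreviation Q where "Q \<equiv> R Quot I"

lemma cring_Q: "cring Q" by (rule quotient_is_cring[OF is_cring])
lemma hom_Q: "ring_hom_ring R Q ((+>) I)" by (rule rcos_ring_hom_ring)
lemma ideal_I: "ideal I R" by (rule is_ideal)

lemma carrier_Q: "carrier Q = (+>) I ` carrier R"
  by (auto simp: FactRing_def A_RCOSETS_def')

lemma coset_carrier: "a \<in> carrier R \<Longrightarrow> I +> a \<in> carrier Q"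
  by (simp add: carrier_Q)

lemma coset_mult: "a \<in> carrier R \<Longrightarrow> b \<in> carrier R \<Longrightarrow> (I +> a) \<otimes>\<^bsub>Q\<^esub> (I +> b) = I +> (a \<otimes> b)"
  using rcoset_mult_add by (simp add: FactRing_def)

lemma coset_one: "\<one>\<^bsub>Q\<^esub> = I +> \<one>"
  by (simp add: FactRing_def)

lemma coset_image_mem_iff:
  assumes J: "ideal J R" "I \<subseteq> J" and a: "a \<in> carrier R"
  shows "I +> a \<in> (+>) I ` J \<longleftrightarrow> a \<in> J"
proof
  assume "I +> a \<in> (+>) I ` J"
  then obtain b where b: "b \<in> J" "I +> a = I +> b" by auto
  interpret J: ideal J R by fact
  have bc: "b \<in> carrier R" using b J.Icarr by blast
  then have "a \<ominus> b \<in> J" using quotient_eq_iff_same_a_r_cos[OF ideal_I a bc] b J(2) by blast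
  then have "(a \<ominus> b) \<oplus> b \<in> J" using b J.a_closed by blast
  moreover have "(a \<ominus> b) \<oplus> b = a" using a bc by (simp add: a_minus_def a_assoc l_neg)
  ultimately show "a \<in> J" by simp
qed blast

text \<open>With this all computations in the quotient ring can be done with representatives.\<close>

lemma coset_mem_genideal_iff:
  assumes X: "X \<subseteq> carrier R" and a: "a \<in> carrier R"
  shows "I +> a \<in> genideal Q ((+>) I ` X) \<longleftrightarrow> a \<in> genideal R (I \<union> X)"
proof
  interpret Q: cring Q by (rule cring_Q)
  have IX: "I \<union> X \<subseteq> carrier R" using X a_subset by (rule Un_least[rotated])
  have J: "ideal (genideal R (I \<union> X)) R" by (rule genideal_ideal[OF IX])
  have IJ: "I \<subseteq> genideal R (I \<union> X)" "X \<subseteq> genideal R (I \<union> X)"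
    using genideal_self[OF IX] by (simp_all only: Un_subset_iff)
  have XQ: "(+>) I ` X \<subseteq> carrier Q" unfolding carrier_Q by (rule image_mono[OF X])
  {
    assume "I +> a \<in> genideal Q ((+>) I ` X)"
    moreover have "genideal Q ((+>) I ` X) \<subseteq> (+>) I ` genideal R (I \<union> X)"
      by (rule Q.genideal_minimal[OF ring_ideal_imp_quot_ideal[OF ideal_I J]]) (rule image_mono[OF IJ(2)])
    ultimately have "I +> a \<in> (+>) I ` genideal R (I \<union> X)" by (rule rev_subsetD)
    then show "a \<in> genideal R (I \<union> X)"
      by (simp only: coset_image_mem_iff[OF J IJ(1) a])
  }
  {
    let ?K = "{b \<in> carrier R. I +> b \<in> genideal Q ((+>) I ` X)}"
    have KQ: "ideal (genideal Q ((+>) I ` X)) Q" by (rule Q.genideal_ideal[OF XQ])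
    have "I \<subseteq> ?K"
    proof
      fix i assume i: "i \<in> I"
      have "I +> i = \<zero>\<^bsub>Q\<^esub>" unfolding a_rcos_const[OF i] by (simp add: FactRing_def)
      then have "I +> i \<in> genideal Q ((+>) I ` X)"
        using additive_subgroup.zero_closed[OF ideal.axioms(1)[OF KQ]] by (simp only:)
      then show "i \<in> ?K" using Icarr[OF i] by (intro CollectI conjI)
    qed
    moreover have "X \<subseteq> ?K"
    proof
      fix x assume x: "x \<in> X"
      then have "I +> x \<in> genideal Q ((+>) I ` X)"
        by (rule subsetD[OF Q.genideal_self[OF XQ] imageI])
      then show "x \<in> ?K" using subsetD[OF X x] by simp
    qed
    ultimately have "I \<union> X \<subseteq> ?K" by (rule Un_least)
    then have "genideal R (I \<union> X) \<subseteq> ?K"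
      by (rule genideal_minimal[OF ring_hom_ring.ideal_vimage[OF hom_Q KQ]])
    moreover assume "a \<in> genideal R (I \<union> X)"
    ultimately have "a \<in> ?K" by (rule rev_subsetD[rotated])
    then show "I +> a \<in> genideal Q ((+>) I ` X)" by simp
  }
qed

lemma regular_sequence_quotient_iff:
  assumes fs: "set fs \<subseteq> carrier R"
  shows "regular_sequence Q (map ((+>) I) fs) \<longleftrightarrow>
    genideal R (I \<union> set fs) \<noteq> carrier R \<and>
    (\<forall>i<length fs. \<forall>a\<in>carrier R. fs ! i \<otimes> a \<in> genideal R (I \<union> set (take i fs)) \<longrightarrow>
       a \<in> genideal R (I \<union> set (take i fs)))"
proof -
  interpret Q: cring Q by (rule cring_Q)
  have IX: "I \<union> set fs \<subseteq> carrier R" using fs Icarr by blast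
  have XQ: "(+>) I ` set fs \<subseteq> carrier Q" using fs coset_carrier by blast
  have J: "ideal (genideal R (I \<union> set fs)) R" by (rule genideal_ideal[OF IX])
  have K: "ideal (genideal Q ((+>) I ` set fs)) Q" by (rule Q.genideal_ideal[OF XQ])
  have "genideal R (I \<union> set fs) = carrier R \<longleftrightarrow> \<one> \<in> genideal R (I \<union> set fs)"
    using ideal.one_imp_carrier[OF J] by auto
  also have "\<dots> \<longleftrightarrow> \<one>\<^bsub>Q\<^esub> \<in> genideal Q ((+>) I ` set fs)"
    unfolding coset_one by (rule coset_mem_genideal_iff[OF fs one_closed, symmetric])
  also have "\<dots> \<longleftrightarrow> genideal Q ((+>) I ` set fs) = carrier Q"
    using ideal.one_imp_carrier[OF K] by auto
  finally have 1: "genideal R (I \<union> set fs) = carrier R \<longleftrightarrow> genideal Q (set (map ((+>) I) fs)) = carrier Q"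
    by simp
  have 2: "(\<forall>a\<in>carrier Q. map ((+>) I) fs ! i \<otimes>\<^bsub>Q\<^esub> a \<in> genideal Q (set (take i (map ((+>) I) fs))) \<longrightarrow>
       a \<in> genideal Q (set (take i (map ((+>) I) fs)))) \<longleftrightarrow>
     (\<forall>a\<in>carrier R. fs ! i \<otimes> a \<in> genideal R (I \<union> set (take i fs)) \<longrightarrow>
       a \<in> genideal R (I \<union> set (take i fs)))" if i: "i < length fs" for i
  proof -
    have X: "set (take i fs) \<subseteq> carrier R" using fs set_take_subset by force
    have f: "fs ! i \<in> carrier R" using fs i by auto
    show ?thesis using i f
      by (simp add: carrier_Q take_map coset_mult coset_mem_genideal_iff[OF X])
  qed
  show ?thesis
    unfolding regular_sequence_def using 1 2 XQ by auto
qed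

lemma primeideal_image:
  assumes P: "primeideal P R" and IP: "I \<subseteq> P"
  shows "primeideal ((+>) I ` P) Q"
proof (rule primeidealI)
  interpret P: primeideal P R by fact
  have PI: "ideal P R" by (rule P.is_ideal)
  show "ideal ((+>) I ` P) Q" by (rule ring_ideal_imp_quot_ideal[OF ideal_I PI])
  show "cring Q" by (rule cring_Q)
  show "carrier Q \<noteq> (+>) I ` P"
  proof
    assume "carrier Q = (+>) I ` P"
    then have "\<one> \<in> P" using coset_image_mem_iff[OF PI IP one_closed] coset_carrier[OF one_closed] by blast
    then show False using P.one_imp_carrier P.I_notcarr by blast
  qed
  fix a b assume "a \<in> carrier Q" "b \<in> carrier Q" and ab: "a \<otimes>\<^bsub>Q\<^esub> b \<in> (+>) I ` P"
  then obtain x y where x: "x \<in> carrier R" "a = I +> x" and y: "y \<in> carrier R" "b = I +> y"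
    by (auto simp: carrier_Q)
  have "x \<otimes> y \<in> P" using ab coset_image_mem_iff[OF PI IP, of "x \<otimes> y"] x y by (simp add: coset_mult)
  then have "x \<in> P \<or> y \<in> P" using P.I_prime x y by blast
  then show "a \<in> (+>) I ` P \<or> b \<in> (+>) I ` P" using x y by blast
qed

lemma maximalideal_image:
  assumes M: "maximalideal M R" and IM: "I \<subseteq> M"
  shows "maximalideal ((+>) I ` M) Q"
proof (rule maximalidealI)
  interpret M: maximalideal M R by fact
  have MI: "ideal M R" by (rule M.is_ideal)
  show "ideal ((+>) I ` M) Q" by (rule ring_ideal_imp_quot_ideal[OF ideal_I MI])
  show "carrier Q \<noteq> (+>) I ` M"
  proof
    assume "carrier Q = (+>) I ` M"
    then have "\<one> \<in> M" using coset_image_mem_iff[OF MI IM one_closed] coset_carrier[OF one_closed] by blast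
    then show False using M.one_imp_carrier M.I_notcarr by blast
  qed
  fix J assume J: "ideal J Q" "(+>) I ` M \<subseteq> J" "J \<subseteq> carrier Q"
  let ?K = "{b \<in> carrier R. I +> b \<in> J}"
  have "ideal ?K R" by (rule ring_hom_ring.ideal_vimage[OF hom_Q J(1)])
  moreover have "M \<subseteq> ?K"
  proof
    fix x assume x: "x \<in> M"
    then have "I +> x \<in> J" by (rule subsetD[OF J(2) imageI])
    then show "x \<in> ?K" using M.Icarr[OF x] by simp
  qed
  moreover have "?K \<subseteq> carrier R" by (rule Collect_restrict)
  ultimately have K: "?K = M \<or> ?K = carrier R" by (rule M.I_maximal)
  have JK: "J = (+>) I ` ?K"
  proof (intro equalityI subsetI)
    fix y assume y: "y \<in> J"
    then obtain x where "x \<in> carrier R" "y = I +> x" using subsetD[OF J(3) y] unfolding carrier_Q by blast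
    then show "y \<in> (+>) I ` ?K" using y by simp
  next
    fix y assume "y \<in> (+>) I ` ?K"
    then show "y \<in> J" by (elim imageE CollectE conjE) simp
  qed
  from K show "J = (+>) I ` M \<or> J = carrier Q"
  proof
    assume "?K = M"
    then show ?thesis using JK by simp
  next
    assume "?K = carrier R"
    then have "J = carrier Q" using JK unfolding carrier_Q by simp
    then show ?thesis by simp
  qed
qed

lemma image_strict_mono:
  assumes "ideal J R" "I \<subseteq> J" "ideal K R" "J \<subset> K"
  shows "(+>) I ` J \<subset> (+>) I ` K"
proof -
  obtain a where a: "a \<in> K" "a \<notin> J" using assms by blast
  then have "a \<in> carrier R" using ideal.Icarr[OF assms(3)] by blast
  then have "I +> a \<notin> (+>) I ` J" using coset_image_mem_iff[OF assms(1,2)] a by blast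
  then show ?thesis using a assms(4) by blast
qed

end

section \<open>The polynomial ring and its ideals\<close>

lemma carrier_polynomial_ring [simp]: "carrier (polynomial_ring V) = polys V"
  and mult_polynomial_ring [simp]: "mult (polynomial_ring V) = (*)"
  and one_polynomial_ring [simp]: "one (polynomial_ring V) = 1"
  and zero_polynomial_ring [simp]: "zero (polynomial_ring V) = 0"
  and add_polynomial_ring [simp]: "add (polynomial_ring V) = (+)"
  by (simp_all add: polynomial_ring_def polys_def)

lemma cring_polynomial_ring: "cring (polynomial_ring V)"
  by (rule cringI; (rule abelian_groupI | rule comm_monoidI)?)
    (auto simp: algebra_simps intro: polys_closed bexI[where x = "- _"])

lemma ideal_polynomial_ring_iff:
  "ideal J (polynomial_ring V) \<longleftrightarrow> subring_ideal (polys V) (J :: ('v, 'k::field) mpolynomial set)"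
proof
  let ?R = "polynomial_ring V :: ('v, 'k) mpolynomial ring"
  interpret R: cring ?R by (rule cring_polynomial_ring)
  {
    assume "ideal J ?R"
    then interpret J: ideal J ?R .
    show "subring_ideal (polys V) J"
    proof
      show "J \<subseteq> polys V" using J.a_subset by simp
      show "0 \<in> J" using J.zero_closed by simp
      show "a + b \<in> J" if "a \<in> J" "b \<in> J" for a b using J.a_closed[OF that] by simp
      show "c * a \<in> J" if "c \<in> polys V" "a \<in> J" for a c using J.I_l_closed[of a c] that by simp
    qed (auto intro: polys_closed)
  }
  {
    assume "subring_ideal (polys V) J"
    then interpret J: subring_ideal "polys V" J .
    have um: "- a \<in> J" if "a \<in> J" for a
      using J.I_mult[of "- 1" a] that by (auto intro: polys_closed)
    have inv: "a_inv ?R a = - a" if "a \<in> J" for a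
      using R.add.inv_equality[of "- a" a] that J.I_sub by (auto intro: polys_closed)
    show "ideal J ?R"
    proof (rule idealI)
      show "subgroup J (add_monoid ?R)"
      proof (rule subgroup.intro)
        show "inv\<^bsub>add_monoid ?R\<^esub> a \<in> J" if "a \<in> J" for a
          using um[OF that] inv[OF that] unfolding a_inv_def by (simp only:)
      qed (use J.I_sub J.I_zero J.I_add in auto)
      show "ring ?R" by (rule R.ring_axioms)
      fix a x assume "a \<in> J" "x \<in> carrier ?R"
      then show "x \<otimes>\<^bsub>?R\<^esub> a \<in> J" "a \<otimes>\<^bsub>?R\<^esub> x \<in> J"
        using J.I_mult[of x a] by (simp_all add: mult.commute)
    qed
  }
qed

lemma mon_eval_congruent:
  assumes J: "subring_ideal C J" and f: "\<And>v. v \<in> keys \<mu> \<Longrightarrow> f v \<in> C \<and> h v \<in> C \<and> f v - h v \<in> J"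
  shows "mon_eval f \<mu> - mon_eval h \<mu> \<in> J"
proof -
  interpret J: subring_ideal C J by fact
  have step: "a * b - c * d \<in> J" if "a - c \<in> J" "b - d \<in> J" "a \<in> C" "d \<in> C" for a b c d
  proof -
    have "a * b - c * d = a * (b - d) + d * (a - c)" by (simp add: algebra_simps)
    also have "\<dots> \<in> J" using that by (intro J.I_add J.I_mult)
    finally show ?thesis .
  qed
  have pow: "f v ^ n - h v ^ n \<in> J" if "v \<in> keys \<mu>" for v n
    using f[OF that] by (induction n) (auto intro: step J.I_zero J.C_power)
  have "(\<Prod>v\<in>A. f v ^ lookup \<mu> v) - (\<Prod>v\<in>A. h v ^ lookup \<mu> v) \<in> J" if "A \<subseteq> keys \<mu>" for A
    using finite_subset[OF that finite_keys] that
  proof (induction A rule: finite_induct)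
    case empty
    then show ?case by (simp add: J.I_zero)
  next
    case (insert v A)
    then show ?case using f by (auto intro!: step pow J.C_power J.C_prod)
  qed
  then show ?thesis unfolding mon_eval_def by blast
qed

lemma subst_congruent:
  fixes f h :: "'v \<Rightarrow> ('w, 'k::field) mpolynomial"
  assumes J: "subring_ideal (polys W) J" and p: "p \<in> polys V"
    and f: "\<And>v. v \<in> V \<Longrightarrow> f v \<in> polys W \<and> h v \<in> polys W \<and> f v - h v \<in> J"
  shows "subst f p - subst h p \<in> J"
proof -
  interpret J: subring_ideal "polys W" J by fact
  have "subst f p - subst h p = (\<Sum>\<mu>\<in>keys p. constp (lookup p \<mu>) * (mon_eval f \<mu> - mon_eval h \<mu>))"
    by (simp add: subst_def poly_eval_def right_diff_distrib sum_subtractf)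
  also have "\<dots> \<in> J"
  proof -
    have s: "(\<And>i. i \<in> A \<Longrightarrow> c i \<in> J) \<Longrightarrow> sum c A \<in> J" for c :: "_ \<Rightarrow> ('w, 'k) mpolynomial" and A
      by (induction A rule: infinite_finite_induct) (auto intro: J.I_zero J.I_add)
    show ?thesis
    proof (intro s J.I_mult polys_closed mon_eval_congruent[OF J])
      fix \<mu> v assume "\<mu> \<in> keys p" "v \<in> keys \<mu>"
      then have "v \<in> V" using p by (auto simp: polys_def)
      then show "f v \<in> polys W \<and> h v \<in> polys W \<and> f v - h v \<in> J" by (rule f)
    qed
  qed
  finally show ?thesis .
qed

lemma subst_mvar_id [simp]: "subst mvar p = p"
  by (induction p rule: poly_induct) (simp_all add: subst_add subst_single mon_eval_mvar mult_single)

lemma subst_cong_polys: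
  assumes "p \<in> polys V" "\<And>v. v \<in> V \<Longrightarrow> f v = h v"
  shows "subst f p = subst h p"
proof -
  have "mon_eval f \<mu> = mon_eval h \<mu>" if "\<mu> \<in> keys p" for \<mu>
  proof -
    have "keys \<mu> \<subseteq> V" using that assms(1) by (simp add: polys_def)
    then show ?thesis unfolding mon_eval_def using assms(2) by (intro prod.cong) auto
  qed
  then show ?thesis unfolding subst_def poly_eval_def by simp
qed

lemma mon_eval_polys: "(\<And>v. v \<in> keys \<mu> \<Longrightarrow> f v \<in> polys W) \<Longrightarrow> mon_eval f \<mu> \<in> polys W"
  unfolding mon_eval_def
  by (rule subring_ideal.C_prod[OF monomial_ideal_subring_ideal[of "\<lambda>_. True"]])
    (auto simp: up_closed_def intro: subring_ideal.C_power[OF monomial_ideal_subring_ideal[of "\<lambda>_. True"]])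

lemma subst_polys:
  assumes "p \<in> polys V" "\<And>v. v \<in> V \<Longrightarrow> f v \<in> polys W"
  shows "subst f p \<in> polys W"
  unfolding subst_def poly_eval_def
  by (rule subring_ideal.C_sum[OF monomial_ideal_subring_ideal[of "\<lambda>_. True"]])
    (use assms in \<open>auto simp: up_closed_def polys_def[of V] intro!: polys_closed mon_eval_polys\<close>)

section \<open>Edge ideals as monomial ideals\<close>

text \<open>The map \<open>\<sigma>\<close> identifies vertices. The two variables are added up, and not only required to
occur in \<open>\<mu>\<close>, because the edge between identified vertices becomes the square of a variable.\<close>

definition edge_divides :: "'v set set \<Rightarrow> ('v \<Rightarrow> 'v) \<Rightarrow> ('v \<Rightarrow>\<^sub>0 nat) \<Rightarrow> bool" where
  "edge_divides E \<sigma> \<mu> \<longleftrightarrow> (\<exists>u v \<nu>. {u, v} \<in> E \<and> \<mu> = single (\<sigma> u) 1 + single (\<sigma> v) 1 + \<nu>)"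

lemma up_closed_edge_divides: "up_closed (edge_divides E \<sigma>)"
  unfolding up_closed_def edge_divides_def by (metis add.assoc)

lemma edge_dividesI:
  assumes "{u, v} \<in> E" "\<sigma> u \<noteq> \<sigma> v" "\<sigma> u \<in> keys \<mu>" "\<sigma> v \<in> keys \<mu>"
  shows "edge_divides E \<sigma> \<mu>"
proof -
  have "\<mu> = single (\<sigma> u) 1 + single (\<sigma> v) 1 + (\<mu> - single (\<sigma> u) 1 - single (\<sigma> v) 1)"
    using assms by (intro poly_mapping_eqI) (auto simp: lookup_add lookup_minus lookup_single when_def in_keys_iff)
  then show ?thesis using assms(1) unfolding edge_divides_def by blast
qed

lemma edge_divides_id_iff:
  assumes "\<And>u v. {u, v} \<in> E \<Longrightarrow> u \<noteq> v"
  shows "edge_divides E id \<mu> \<longleftrightarrow> (\<exists>u v. {u, v} \<in> E \<and> u \<in> keys \<mu> \<and> v \<in> keys \<mu>)"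
proof
  assume "edge_divides E id \<mu>"
  then show "\<exists>u v. {u, v} \<in> E \<and> u \<in> keys \<mu> \<and> v \<in> keys \<mu>"
    unfolding edge_divides_def by (fastforce simp: keys_add_nat)
next
  assume "\<exists>u v. {u, v} \<in> E \<and> u \<in> keys \<mu> \<and> v \<in> keys \<mu>"
  then show "edge_divides E id \<mu>" using edge_dividesI[of _ _ E id \<mu>] assms by auto
qed

lemma monomial_ideal_subset:
  assumes J: "subring_ideal (polys V) J" and "\<And>\<mu>. keys \<mu> \<subseteq> V \<Longrightarrow> B \<mu> \<Longrightarrow> single \<mu> 1 \<in> J"
  shows "monomial_ideal V B \<subseteq> (J :: ('v, 'k::field) mpolynomial set)"
proof
  interpret J: subring_ideal "polys V" J by fact
  fix p :: "('v, 'k) mpolynomial" assume p: "p \<in> monomial_ideal V B"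
  have s: "(\<And>i. i \<in> A \<Longrightarrow> c i \<in> J) \<Longrightarrow> sum c A \<in> J" for c :: "_ \<Rightarrow> ('v, 'k) mpolynomial" and A
    by (induction A rule: infinite_finite_induct) (auto intro: J.I_zero J.I_add)
  have "single \<mu> (lookup p \<mu>) \<in> J" if "\<mu> \<in> keys p" for \<mu>
  proof -
    have "constp (lookup p \<mu>) * single \<mu> 1 \<in> J"
      using p that assms(2)[of \<mu>] by (intro J.I_mult polys_closed) (auto simp: monomial_ideal_def polys_def)
    then show ?thesis by (simp add: mult_single)
  qed
  then have "(\<Sum>\<mu>\<in>keys p. single \<mu> (lookup p \<mu>)) \<in> J" by (rule s)
  then show "p \<in> J" by (simp add: sum_single_lookup)
qed

lemma genideal_subring_ideal:
  "X \<subseteq> polys V \<Longrightarrow> subring_ideal (polys V) (genideal (polynomial_ring V) X :: ('v, 'k::field) mpolynomial set)"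
  using ring.genideal_ideal[OF cring.axioms(1)[OF cring_polynomial_ring], of X V]
  by (simp add: ideal_polynomial_ring_iff)

lemma genideal_poly_self: "X \<subseteq> polys V \<Longrightarrow> X \<subseteq> genideal (polynomial_ring V) X"
  using ring.genideal_self[OF cring.axioms(1)[OF cring_polynomial_ring], of X V] by simp

lemma genideal_poly_minimal:
  "subring_ideal (polys V) J \<Longrightarrow> X \<subseteq> J \<Longrightarrow> genideal (polynomial_ring V) X \<subseteq> J"
  using ring.genideal_minimal[OF cring.axioms(1)[OF cring_polynomial_ring], of J V X]
  by (simp add: ideal_polynomial_ring_iff)

lemma genideal_poly_mono:
  "Y \<subseteq> polys V \<Longrightarrow> X \<subseteq> Y \<Longrightarrow> genideal (polynomial_ring V) X \<subseteq> genideal (polynomial_ring V) Y"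
  using genideal_poly_self[of Y V] by (intro genideal_poly_minimal genideal_subring_ideal) auto

lemma mvar_prod_eq_single: "mvar u * mvar v = single (single u 1 + single v 1) 1"
  by (simp add: mvar_def mult_single)

text \<open>Modulo \<open>X\<close> every polynomial is congruent to its image under the substitution, and the generators of the edge ideal become
monomials again.\<close>

lemma mem_edge_ideal_identified_iff:
  fixes X :: "('v, 'k::field) mpolynomial set"
  assumes E: "\<And>u v. {u, v} \<in> E \<Longrightarrow> u \<in> V \<and> v \<in> V" and \<sigma>: "\<And>v. v \<in> V \<Longrightarrow> \<sigma> v \<in> V"
    and X: "X \<subseteq> polys V" "\<And>d. d \<in> X \<Longrightarrow> subst (\<lambda>v. mvar (\<sigma> v)) d = 0"
    and cong: "\<And>v. v \<in> V \<Longrightarrow> mvar v - mvar (\<sigma> v) \<in> genideal (polynomial_ring V) X"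
    and a: "a \<in> polys V"
  defines "I \<equiv> genideal (polynomial_ring V) {mvar u * mvar v |u v. {u, v} \<in> E}"
  shows "a \<in> genideal (polynomial_ring V) (I \<union> X) \<longleftrightarrow>
    subst (\<lambda>v. mvar (\<sigma> v)) a \<in> monomial_ideal V (edge_divides E \<sigma>)"
proof -
  let ?R = "polynomial_ring V :: ('v, 'k) mpolynomial ring"
  let ?M = "monomial_ideal V (edge_divides E \<sigma>) :: ('v, 'k) mpolynomial set"
  let ?s = "subst (\<lambda>v. mvar (\<sigma> v)) :: _ \<Rightarrow> ('v, 'k) mpolynomial"
  let ?G = "{mvar u * mvar v |u v. {u, v} \<in> E} :: ('v, 'k) mpolynomial set"
  interpret M: subring_ideal "polys V" ?M by (rule monomial_ideal_subring_ideal[OF up_closed_edge_divides])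
  have G: "?G \<subseteq> polys V" using E by (auto intro!: polys_closed)
  have I: "subring_ideal (polys V) I" unfolding I_def by (rule genideal_subring_ideal[OF G])
  have IX: "I \<union> X \<subseteq> polys V" using subring_ideal.I_sub[OF I] X by blast
  have sV: "?s p \<in> polys V" if "p \<in> polys V" for p
    using \<sigma> by (intro subst_polys[OF that]) (auto intro: polys_closed)
  let ?J = "genideal ?R (I \<union> X)"
  interpret J: subring_ideal "polys V" ?J by (rule genideal_subring_ideal[OF IX])
  have IJ: "I \<subseteq> ?J" "X \<subseteq> ?J" using genideal_poly_self[OF IX] by auto
  have XJ: "genideal ?R X \<subseteq> ?J" by (rule genideal_poly_mono[OF IX]) simp
  have congJ: "mvar v - mvar (\<sigma> v) \<in> ?J" if "v \<in> V" for v using cong[OF that] XJ by blast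
  show ?thesis
  proof
    let ?K = "{p \<in> polys V. ?s p \<in> ?M}"
    have K: "subring_ideal (polys V) ?K"
    proof
      show "c * b \<in> ?K" if "c \<in> polys V" "b \<in> ?K" for c b
        using that M.I_mult sV by (auto simp: subst_mult polys_mult)
    qed (auto simp: subst_add M.I_zero intro: polys_closed M.I_add)
    have "?G \<subseteq> ?K"
    proof
      fix p assume pG: "p \<in> ?G"
      then obtain u v where p: "p = mvar u * mvar v" "{u, v} \<in> E" by blast
      have "?s p = single (single (\<sigma> u) 1 + single (\<sigma> v) 1) 1"
        unfolding p(1) subst_mult subst_mvar by (rule mvar_prod_eq_single)
      also have "\<dots> \<in> ?M"
      proof (rule single_mem_monomial_ideal)
        show "keys (single (\<sigma> u) (1::nat) + single (\<sigma> v) 1) \<subseteq> V"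
          using E[OF p(2)] \<sigma> by (simp add: keys_add_nat)
        show "edge_divides E \<sigma> (single (\<sigma> u) 1 + single (\<sigma> v) 1)"
          unfolding edge_divides_def using p(2)
          by (intro exI[of _ u] exI[of _ v] exI[of _ 0]) simp
      qed
      finally show "p \<in> ?K" using subsetD[OF G pG] by (intro CollectI conjI)
    qed
    then have "I \<subseteq> ?K" unfolding I_def by (rule genideal_poly_minimal[OF K])
    moreover have "X \<subseteq> ?K" using X M.I_zero by auto
    ultimately have "?J \<subseteq> ?K" by (intro genideal_poly_minimal[OF K]) blast
    then show "a \<in> ?J \<Longrightarrow> ?s a \<in> ?M" by blast
  next
    have MJ: "?M \<subseteq> ?J"
    proof (rule monomial_ideal_subset[OF J.subring_ideal_axioms])
      fix \<mu> assume \<mu>: "keys \<mu> \<subseteq> V" "edge_divides E \<sigma> \<mu>"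
      then obtain u v \<nu> where e: "{u, v} \<in> E" "\<mu> = single (\<sigma> u) 1 + single (\<sigma> v) 1 + \<nu>"
        unfolding edge_divides_def by blast
      have V: "u \<in> V" "v \<in> V" "keys \<nu> \<subseteq> V" using E[OF e(1)] \<mu>(1) e(2) by (auto simp: keys_add_nat)
      have "mvar u * mvar v \<in> I" using genideal_poly_self[OF G] e(1) unfolding I_def by blast
      then have 1: "mvar u * mvar v \<in> ?J" using IJ(1) by blast
      have "mvar (\<sigma> u) * mvar (\<sigma> v) = mvar u * mvar v + (- mvar v) * (mvar u - mvar (\<sigma> u)) +
          (- mvar (\<sigma> u)) * (mvar v - mvar (\<sigma> v))"
        by (simp add: algebra_simps)
      also have "\<dots> \<in> ?J"
        by (rule J.I_add[OF J.I_add[OF 1 J.I_mult[OF _ congJ[OF V(1)]]] J.I_mult[OF _ congJ[OF V(2)]]])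
          (use V \<sigma> in \<open>auto intro: polys_closed\<close>)
      finally have "single \<nu> 1 * (mvar (\<sigma> u) * mvar (\<sigma> v)) \<in> ?J"
        by (rule J.I_mult[rotated]) (use V in \<open>auto simp: polys_def\<close>)
      then show "single \<mu> 1 \<in> ?J" by (simp add: mvar_prod_eq_single mult_single e(2) add_ac)
    qed
    have "subst mvar a - ?s a \<in> ?J"
      using \<sigma> congJ by (intro subst_congruent[OF J.subring_ideal_axioms a]) (auto intro: polys_closed)
    then have "a - ?s a \<in> ?J" by simp
    then show "?s a \<in> ?M \<Longrightarrow> a \<in> ?J" using J.I_add[of "a - ?s a" "?s a"] MJ by auto
  qed
qed

lemma simple_graph_edge:
  assumes "simple_graph H" "{u, v} \<in> edges H"
  shows "u \<in> verts H" "v \<in> verts H" "u \<noteq> v"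
  using assms by (fastforce simp: simple_graph_def)+

lemma edge_ideal_eq:
  assumes "simple_graph H"
  shows "edge_ideal H = (monomial_ideal (verts H) (edge_divides (edges H) id) :: ('v, 'k::field) mpolynomial set)"
proof -
  let ?G = "{mvar u * mvar v |u v. {u, v} \<in> edges H} :: ('v, 'k) mpolynomial set"
  let ?R = "polynomial_ring (verts H) :: ('v, 'k) mpolynomial ring"
  have G: "?G \<subseteq> polys (verts H)" using simple_graph_edge[OF assms] by (auto intro!: polys_closed)
  have I: "subring_ideal (polys (verts H)) (edge_ideal H :: ('v, 'k) mpolynomial set)"
    unfolding edge_ideal_def by (rule genideal_subring_ideal[OF G])
  have "genideal ?R (edge_ideal H \<union> {}) = edge_ideal H"
    using genideal_poly_minimal[OF I] genideal_poly_self[OF subring_ideal.I_sub[OF I]] by auto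
  moreover have "a \<in> genideal ?R (edge_ideal H \<union> {}) \<longleftrightarrow> a \<in> monomial_ideal (verts H) (edge_divides (edges H) id)"
    if "a \<in> polys (verts H)" for a
    using mem_edge_ideal_identified_iff[of "edges H" "verts H" id "{}" a] simple_graph_edge[OF assms] that
      subring_ideal.I_zero[OF genideal_subring_ideal[of "{}" "verts H"]]
    by (auto simp: edge_ideal_def)
  ultimately show ?thesis
    using subring_ideal.I_sub[OF I] by (auto simp: monomial_ideal_def)
qed

section \<open>Folding a graph along a matching\<close>

definition identify :: "('v \<times> 'v) list \<Rightarrow> 'v \<Rightarrow> 'v" where
  "identify ps v = (case map_of (map prod.swap ps) v of None \<Rightarrow> v | Some x \<Rightarrow> x)"

lemma identify_cases: "identify ps v = v \<and> v \<notin> snd ` set ps \<or> (identify ps v, v) \<in> set ps"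
proof (cases "map_of (map prod.swap ps) v")
  case None
  then have "v \<notin> snd ` set ps" by (auto simp: map_of_eq_None_iff image_image)
  then show ?thesis using None by (simp add: identify_def)
next
  case (Some x)
  then show ?thesis using map_of_SomeD[OF Some] by (auto simp: identify_def)
qed

lemma identify_not_snd: "v \<notin> snd ` set ps \<Longrightarrow> identify ps v = v"
  using identify_cases[of ps v] by force

lemma identify_snd:
  assumes "distinct (map snd ps)" "(x, y) \<in> set ps"
  shows "identify ps y = x"
  using identify_cases[of ps y] assms by (force simp: distinct_map inj_on_def)

text \<open>To fold means to identify the ends of the matched edges, that is, to divide by the differences \<open>x - y\<close>. By the
first condition a monomial multiplied into the edge ideal by both \<open>x\<close> and \<open>y\<close> contains an edge
\<open>w w'\<close>. The second condition keeps \<open>w\<close> and \<open>w'\<close> different while other pairs are folded.\<close>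

definition foldable :: "'v graph \<Rightarrow> ('v \<times> 'v) list \<Rightarrow> bool" where
  "foldable H ps \<longleftrightarrow> distinct (map fst ps @ map snd ps) \<and> set ps \<subseteq> verts H \<times> verts H \<and>
    (\<forall>(x, y)\<in>set ps. \<forall>w w'. {x, w} \<in> edges H \<longrightarrow> {y, w'} \<in> edges H \<longrightarrow>
      {w, w'} \<in> edges H \<and> (\<forall>(x', y')\<in>set ps. (x', y') \<noteq> (x, y) \<longrightarrow> {w, w'} \<noteq> {x', y'}))"

lemma foldableI:
  assumes d: "distinct (map fst ps @ map snd ps)" and V: "set ps \<subseteq> verts H \<times> verts H"
    and tr: "\<And>x y w w'. (x, y) \<in> set ps \<Longrightarrow> {x, w} \<in> edges H \<Longrightarrow> {y, w'} \<in> edges H \<Longrightarrow> {w, w'} \<in> edges H"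
    and ac: "\<And>x y w w' x' y'. (x, y) \<in> set ps \<Longrightarrow> {x, w} \<in> edges H \<Longrightarrow> {y, w'} \<in> edges H \<Longrightarrow>
      (x', y') \<in> set ps \<Longrightarrow> (x', y') \<noteq> (x, y) \<Longrightarrow> {w, w'} \<noteq> {x', y'}"
  shows "foldable H ps"
  unfolding foldable_def using assms by blast

lemma foldableD:
  assumes "foldable H ps" "(x, y) \<in> set ps" "{x, w} \<in> edges H" "{y, w'} \<in> edges H"
  shows "{w, w'} \<in> edges H"
    and "(x', y') \<in> set ps \<Longrightarrow> (x', y') \<noteq> (x, y) \<Longrightarrow> {w, w'} \<noteq> {x', y'}"
proof -
  have "\<forall>p\<in>set ps. case p of (x, y) \<Rightarrow> \<forall>w w'. {x, w} \<in> edges H \<longrightarrow> {y, w'} \<in> edges H \<longrightarrow>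
      {w, w'} \<in> edges H \<and> (\<forall>(x', y')\<in>set ps. (x', y') \<noteq> (x, y) \<longrightarrow> {w, w'} \<noteq> {x', y'})"
    using assms(1) unfolding foldable_def by (elim conjE)
  from bspec[OF this assms(2)] have A: "\<forall>w w'. {x, w} \<in> edges H \<longrightarrow> {y, w'} \<in> edges H \<longrightarrow>
      {w, w'} \<in> edges H \<and> (\<forall>(x', y')\<in>set ps. (x', y') \<noteq> (x, y) \<longrightarrow> {w, w'} \<noteq> {x', y'})"
    by (simp only: prod.case)
  have *: "{w, w'} \<in> edges H \<and> (\<forall>(x', y')\<in>set ps. (x', y') \<noteq> (x, y) \<longrightarrow> {w, w'} \<noteq> {x', y'})"
    by (rule mp[OF mp[OF spec[OF spec[OF A]] assms(3)] assms(4)])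
  then show "{w, w'} \<in> edges H" by (rule conjunct1)
  assume "(x', y') \<in> set ps" "(x', y') \<noteq> (x, y)"
  with bspec[OF conjunct2[OF *] this(1)] show "{w, w'} \<noteq> {x', y'}" by (simp only: prod.case simp_thms)
qed

lemma identify_take_facts:
  assumes d: "distinct (map fst ps @ map snd ps)" and k: "k < length ps" and xy: "ps ! k = (x, y)"
  shows "identify (take k ps) v = x \<longleftrightarrow> v = x" "identify (take k ps) v = y \<longleftrightarrow> v = y"
proof -
  have kin: "(x, y) \<in> set ps" using k xy nth_mem by metis
  have d1: "distinct (map fst ps)" "distinct (map snd ps)" "fst ` set ps \<inter> snd ` set ps = {}"
    using d by auto
  have nx: "x \<notin> fst ` set (take k ps)"
  proof
    assume "x \<in> fst ` set (take k ps)"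
    then obtain j where "j < k" "fst (ps ! j) = x" by (auto simp: in_set_conv_nth)
    then show False using nth_eq_iff_index_eq[OF d1(1), of j k] k xy by simp
  qed
  have ny: "y \<notin> snd ` set (take k ps)"
  proof
    assume "y \<in> snd ` set (take k ps)"
    then obtain j where "j < k" "snd (ps ! j) = y" by (auto simp: in_set_conv_nth)
    then show False using nth_eq_iff_index_eq[OF d1(2), of j k] k xy by simp
  qed
  have sub: "set (take k ps) \<subseteq> set ps" by (rule set_take_subset)
  have nxs: "x \<notin> snd ` set (take k ps)" and nyf: "y \<notin> fst ` set (take k ps)"
    using d1(3) kin sub by force+
  show "identify (take k ps) v = x \<longleftrightarrow> v = x"
    using identify_cases[of "take k ps" v] nx nxs identify_not_snd[of x "take k ps"] by force
  show "identify (take k ps) v = y \<longleftrightarrow> v = y"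
    using identify_cases[of "take k ps" v] ny nyf identify_not_snd[of y "take k ps"] by force
qed


lemma edge_divides_add_single:
  assumes \<sigma>: "\<And>v. \<sigma> v = x \<longleftrightarrow> v = x" and "edge_divides E \<sigma> (\<mu> + single x 1)"
  shows "edge_divides E \<sigma> \<mu> \<or> (\<exists>w. {x, w} \<in> E \<and> \<sigma> w \<in> keys \<mu>)"
proof -
  obtain u v \<nu> where e: "{u, v} \<in> E" "\<mu> + single x 1 = single (\<sigma> u) 1 + single (\<sigma> v) 1 + \<nu>"
    using assms(2) unfolding edge_divides_def by blast
  consider "\<sigma> u = x" | "\<sigma> v = x" | "\<sigma> u \<noteq> x" "\<sigma> v \<noteq> x" by blast
  then show ?thesis
  proof cases
    case 1
    then have "\<mu> + single x 1 = (single (\<sigma> v) 1 + \<nu>) + single x 1" using e(2) by (simp add: add_ac)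
    then have "\<mu> = single (\<sigma> v) 1 + \<nu>" by (rule add_right_imp_eq)
    then have "\<sigma> v \<in> keys \<mu>" by (simp add: keys_add_nat)
    moreover have "{x, v} \<in> E" using 1 \<sigma> e(1) by simp
    ultimately show ?thesis by blast
  next
    case 2
    then have "\<mu> + single x 1 = (single (\<sigma> u) 1 + \<nu>) + single x 1" using e(2) by (simp add: add_ac)
    then have "\<mu> = single (\<sigma> u) 1 + \<nu>" by (rule add_right_imp_eq)
    then have "\<sigma> u \<in> keys \<mu>" by (simp add: keys_add_nat)
    moreover have "{x, u} \<in> E" using 2 \<sigma> e(1) by (simp add: insert_commute)
    ultimately show ?thesis by blast
  next
    case 3
    have "lookup (\<mu> + single x 1) x = lookup (single (\<sigma> u) 1 + single (\<sigma> v) 1 + \<nu>) x"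
      using e(2) by simp
    then have "0 < lookup \<nu> x" using 3 by (simp add: lookup_add lookup_single when_def)
    then have "\<nu> = single x 1 + (\<nu> - single x 1)"
      by (intro poly_mapping_eqI) (auto simp: lookup_add lookup_minus lookup_single when_def)
    then obtain \<nu>' where "\<nu> = single x 1 + \<nu>'" by blast
    then have "\<mu> + single x 1 = (single (\<sigma> u) 1 + single (\<sigma> v) 1 + \<nu>') + single x 1"
      using e(2) by (simp add: add_ac)
    then have "\<mu> = single (\<sigma> u) 1 + single (\<sigma> v) 1 + \<nu>'" by (rule add_right_imp_eq)
    then show ?thesis using e(1) unfolding edge_divides_def by blast
  qed
qed

text \<open>This is the hypothesis of \<open>mvar_diff_nonzerodivisor\<close> for the pair \<open>x, y\<close> after the earlier pairs have been folded.\<close>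

lemma foldable_star:
  assumes H: "simple_graph H" and f: "foldable H ps" and k: "k < length ps" "ps ! k = (x, y)"
  defines "\<sigma> \<equiv> identify (take k ps)"
  assumes X: "edge_divides (edges H) \<sigma> (\<mu> + single x 1)" and Y: "edge_divides (edges H) \<sigma> (\<mu> + single y 1)"
  shows "edge_divides (edges H) \<sigma> \<mu>"
proof (rule ccontr)
  assume neg: "\<not> ?thesis"
  have d: "distinct (map fst ps @ map snd ps)" using f by (simp add: foldable_def)
  note facts = identify_take_facts[OF d k, folded \<sigma>_def]
  obtain w w' where w: "{x, w} \<in> edges H" "\<sigma> w \<in> keys \<mu>" and w': "{y, w'} \<in> edges H" "\<sigma> w' \<in> keys \<mu>"
    using edge_divides_add_single[OF facts(1) X] edge_divides_add_single[OF facts(2) Y] neg by metis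
  have xy: "(x, y) \<in> set ps" using k nth_mem by metis
  note ww = foldableD(1)[OF f xy w(1) w'(1)] and np = foldableD(2)[OF f xy w(1) w'(1)]
  have "\<sigma> w = \<sigma> w'" using edge_dividesI[OF ww, of \<sigma> \<mu>] w(2) w'(2) neg by blast
  have "x \<noteq> identify (take k ps) y"
  proof
    assume "x = identify (take k ps) y"
    then have "y = x" using facts(1)[of y] by (simp add: \<sigma>_def)
    then show False using d xy by force
  qed
  then have notin: "(x, y) \<notin> set (take k ps)"
    using identify_snd[of "take k ps" x y] d by (auto simp: distinct_take simp flip: take_map)
  have sub: "set (take k ps) \<subseteq> set ps" by (rule set_take_subset)
  have no: "\<not> ((a, b) \<in> set (take k ps) \<and> {w, w'} = {a, b})" for a b
    using np[of a b] sub notin by blast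
  have "w \<noteq> w'" using simple_graph_edge[OF H ww] by simp
  have inj: "inj_on fst (set ps)" using d by (simp add: distinct_map)
  show False
    using identify_cases[of "take k ps" w, folded \<sigma>_def] identify_cases[of "take k ps" w', folded \<sigma>_def]
  proof (elim disjE conjE)
    assume "\<sigma> w = w" "\<sigma> w' = w'"
    then show False using \<open>\<sigma> w = \<sigma> w'\<close> \<open>w \<noteq> w'\<close> by simp
  next
    assume "\<sigma> w = w" "(\<sigma> w', w') \<in> set (take k ps)"
    then show False using \<open>\<sigma> w = \<sigma> w'\<close> no[of w w'] by simp
  next
    assume "(\<sigma> w, w) \<in> set (take k ps)" "\<sigma> w' = w'"
    then show False using \<open>\<sigma> w = \<sigma> w'\<close> no[of w' w] by (simp add: insert_commute)
  next
    assume "(\<sigma> w, w) \<in> set (take k ps)" "(\<sigma> w', w') \<in> set (take k ps)"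
    then show False
      using \<open>\<sigma> w = \<sigma> w'\<close> \<open>w \<noteq> w'\<close> sub inj_onD[OF inj, of "(\<sigma> w, w)" "(\<sigma> w', w')"] by auto
  qed
qed

definition isolated :: "'v graph \<Rightarrow> 'v \<Rightarrow> bool" where
  "isolated H z \<longleftrightarrow> z \<in> verts H \<and> neighborhood H z = {}"

lemma cring_ideal_edge_ideal:
  "simple_graph H \<Longrightarrow> cring_ideal (polynomial_ring (verts H)) (edge_ideal H :: ('v, 'k::field) mpolynomial set)"
  unfolding cring_ideal_def edge_ideal_eq ideal_polynomial_ring_iff
  by (intro conjI cring_polynomial_ring monomial_ideal_subring_ideal up_closed_edge_divides)

abbreviation pos_ideal :: "'v graph \<Rightarrow> ('v, 'k::field) mpolynomial set" where
  "pos_ideal H \<equiv> monomial_ideal (verts H) (\<lambda>\<mu>. 1 \<le> tdeg \<mu>)"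

lemma pos_ideal_subring_ideal: "subring_ideal (polys (verts H)) (pos_ideal H)"
  by (rule monomial_ideal_subring_ideal[OF up_closed_tdeg])

lemma edge_ideal_pos: "simple_graph H \<Longrightarrow> edge_ideal H \<subseteq> pos_ideal H"
  by (auto simp: edge_ideal_eq monomial_ideal_def edge_divides_def tdeg_add)

lemma mvar_pos: "v \<in> verts H \<Longrightarrow> mvar v \<in> pos_ideal H"
  by (auto simp: monomial_ideal_def polys_closed) (simp add: mvar_def)

lemma folded_ideal_iff:
  fixes a :: "('v, 'k::field) mpolynomial"
  assumes H: "simple_graph H" and f: "foldable H ps" and a: "a \<in> polys (verts H)"
  shows "a \<in> genideal (polynomial_ring (verts H))
      (edge_ideal H \<union> set (take k (map (\<lambda>(x, y). mvar x - mvar y) ps))) \<longleftrightarrow>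
    subst (\<lambda>v. mvar (identify (take k ps) v)) a \<in>
      monomial_ideal (verts H) (edge_divides (edges H) (identify (take k ps)))"
proof -
  let ?V = "verts H" and ?qs = "take k ps"
  let ?X = "set (take k (map (\<lambda>(x, y). mvar x - mvar y) ps)) :: ('v, 'k) mpolynomial set"
  have X: "?X = (\<lambda>(x, y). mvar x - mvar y) ` set ?qs" by (simp add: take_map)
  have sub: "set ?qs \<subseteq> set ps" by (rule set_take_subset)
  have d: "distinct (map snd ?qs)" and disj: "fst ` set ps \<inter> snd ` set ps = {}" and V: "set ps \<subseteq> ?V \<times> ?V"
    using f by (auto simp: foldable_def distinct_take simp flip: take_map)
  have \<sigma>V: "identify ?qs v \<in> ?V" if "v \<in> ?V" for v
    using identify_cases[of ?qs v] V sub that by auto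
  have XV: "?X \<subseteq> polys ?V" unfolding X using sub V by (auto intro!: polys_closed)
  have X0: "subst (\<lambda>v. mvar (identify ?qs v)) p = 0" if pX: "p \<in> ?X" for p
  proof -
    obtain x y where xy: "(x, y) \<in> set ?qs" "p = mvar x - mvar y"
      using pX unfolding X by (elim imageE) (metis case_prod_conv surj_pair)
    have "identify ?qs y = x" by (rule identify_snd[OF d xy(1)])
    moreover have "identify ?qs x = x" using xy(1) sub disj by (intro identify_not_snd) force
    ultimately show ?thesis by (simp add: xy(2) subst_diff)
  qed
  have cong: "mvar v - mvar (identify ?qs v) \<in> genideal (polynomial_ring ?V) ?X" if "v \<in> ?V" for v
  proof -
    interpret G: subring_ideal "polys ?V" "genideal (polynomial_ring ?V) ?X"
      by (rule genideal_subring_ideal[OF XV])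
    show ?thesis
    proof (cases "identify ?qs v = v")
      case True
      then show ?thesis by (simp add: G.I_zero)
    next
      case False
      then have "(identify ?qs v, v) \<in> set ?qs" using identify_cases[of ?qs v] by blast
      then have "mvar (identify ?qs v) - mvar v \<in> ?X" unfolding X by force
      then have "- 1 * (mvar (identify ?qs v) - mvar v) \<in> genideal (polynomial_ring ?V) ?X"
        using genideal_poly_self[OF XV] by (intro G.I_mult polys_closed) auto
      then show ?thesis by simp
    qed
  qed
  show ?thesis
    unfolding edge_ideal_def
    by (rule mem_edge_ideal_identified_iff[OF _ \<sigma>V XV X0 cong a]) (use simple_graph_edge[OF H] in auto)
qed

lemma foldable_sequence_pos:
  assumes f: "foldable H ps" and zs: "\<And>z. z \<in> set zs \<Longrightarrow> z \<in> verts H"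
  shows "set (map (\<lambda>(x, y). mvar x - mvar y) ps @ map mvar zs) \<subseteq> (pos_ideal H :: ('v, 'k::field) mpolynomial set)"
proof
  interpret M: subring_ideal "polys (verts H)" "pos_ideal H :: ('v, 'k) mpolynomial set"
    by (rule pos_ideal_subring_ideal)
  fix p :: "('v, 'k) mpolynomial" assume "p \<in> set (map (\<lambda>(x, y). mvar x - mvar y) ps @ map mvar zs)"
  then consider x y where "(x, y) \<in> set ps" "p = mvar x - mvar y" | z where "z \<in> set zs" "p = mvar z"
    by auto
  then show "p \<in> pos_ideal H"
  proof cases
    case 1
    then have "x \<in> verts H" "y \<in> verts H" using f by (auto simp: foldable_def)
    then have xy: "mvar x \<in> pos_ideal H" "mvar y \<in> (pos_ideal H :: ('v, 'k) mpolynomial set)"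
      by (simp_all only: mvar_pos)
    have "mvar x + - 1 * mvar y \<in> (pos_ideal H :: ('v, 'k) mpolynomial set)"
      by (rule M.I_add[OF xy(1) M.I_mult[OF _ xy(2)]]) (simp add: polys_closed)
    then show ?thesis using 1 by simp
  next
    case 2
    then show ?thesis using mvar_pos[OF zs] by simp
  qed
qed

theorem foldable_regular_sequence:
  fixes H :: "'v graph"
  assumes H: "simple_graph H" and f: "foldable H ps"
    and zs: "length zs \<le> 1" "\<And>z. z \<in> set zs \<Longrightarrow> isolated H z \<and> z \<notin> fst ` set ps \<and> z \<notin> snd ` set ps"
  shows "regular_sequence (edge_ring H)
    (map ((+>\<^bsub>polynomial_ring (verts H)\<^esub>) (edge_ideal H))
      (map (\<lambda>(x, y). mvar x - mvar y) ps @ map mvar zs) :: ('v, 'k::field) mpolynomial set list)"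
proof -
  let ?V = "verts H"
  let ?R = "polynomial_ring ?V :: ('v, 'k) mpolynomial ring"
  let ?\<theta> = "map (\<lambda>(x, y). mvar x - mvar y) ps :: ('v, 'k) mpolynomial list"
  let ?fs = "?\<theta> @ map mvar zs"
  interpret cring_ideal ?R "edge_ideal H" by (rule cring_ideal_edge_ideal[OF H])
  interpret M: subring_ideal "polys ?V" "pos_ideal H :: ('v, 'k) mpolynomial set"
    by (rule pos_ideal_subring_ideal)
  have psV: "set ps \<subseteq> ?V \<times> ?V" and d: "distinct (map fst ps @ map snd ps)" using f by (auto simp: foldable_def)
  have fpos: "set ?fs \<subseteq> pos_ideal H"
    by (rule foldable_sequence_pos[OF f]) (use zs(2) in \<open>auto simp: isolated_def\<close>)
  then have fV: "set ?fs \<subseteq> polys ?V" using M.I_sub by blast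
  have "edge_ideal H \<union> set ?fs \<subseteq> pos_ideal H" using fpos edge_ideal_pos[OF H] by blast
  then have "genideal ?R (edge_ideal H \<union> set ?fs) \<subseteq> pos_ideal H"
    by (rule genideal_poly_minimal[OF pos_ideal_subring_ideal])
  moreover have "1 \<notin> pos_ideal H" by (simp add: monomial_ideal_def)
  ultimately have proper: "genideal ?R (edge_ideal H \<union> set ?fs) \<noteq> polys ?V"
    using polys_closed(1)[of ?V] by blast
  have reg: "a \<in> genideal ?R (edge_ideal H \<union> set (take i ?fs))"
    if i: "i < length ?fs" and a: "a \<in> polys ?V"
      and m: "?fs ! i * a \<in> genideal ?R (edge_ideal H \<union> set (take i ?fs))" for i a
  proof -
    let ?\<sigma> = "identify (take i ps)" and ?M = "\<lambda>i. monomial_ideal ?V (edge_divides (edges H) (identify (take i ps)))"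
    let ?s = "subst (\<lambda>v. mvar (?\<sigma> v)) :: _ \<Rightarrow> ('v, 'k) mpolynomial"
    have il: "i \<le> length ps" using i zs(1) by simp
    then have tk: "take i ?fs = take i ?\<theta>" by simp
    have mV: "?fs ! i * a \<in> polys ?V" using fV i a nth_mem[OF i] by (intro polys_closed) auto
    have sm: "?s (?fs ! i * a) \<in> ?M i" using m folded_ideal_iff[OF H f mV] unfolding tk by blast
    have sa: "?s a \<in> polys ?V"
      using psV set_take_subset[of i ps] identify_cases[of "take i ps"]
      by (intro subst_polys[OF a] polys_closed) (metis SigmaD1 subsetD)
    have "?s a \<in> ?M i"
    proof (cases "i < length ps")
      case True
      obtain x y where xy: "ps ! i = (x, y)" by force
      note facts = identify_take_facts[OF d True xy]
      have sxy: "?\<sigma> x = x" "?\<sigma> y = y" using facts by blast+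
      have "x \<noteq> y" using d True xy nth_mem[OF True] by force
      have "?s (?fs ! i * a) = (mvar x - mvar y) * ?s a"
        using True xy sxy by (simp add: nth_append subst_mult subst_diff)
      then show ?thesis
        using mvar_diff_nonzerodivisor[OF up_closed_edge_divides \<open>x \<noteq> y\<close> foldable_star[OF H f True xy] sa] sm
        by simp
    next
      case False
      then have il: "i = length ps" using \<open>i \<le> length ps\<close> by simp
      then have "zs \<noteq> []" using i by auto
      then obtain z where zz: "zs = [z]" using zs(1) by (cases zs) auto
      have iso: "isolated H z" and zn: "z \<notin> fst ` set ps" "z \<notin> snd ` set ps" using zs(2) zz by auto
      have \<sigma>z: "?\<sigma> v = z \<longleftrightarrow> v = z" for v
        using identify_cases[of "take i ps" v] identify_not_snd[of z "take i ps"] zn il by force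
      have "?s (?fs ! i * a) = single (single z 1) 1 * ?s a"
      proof -
        have "?\<sigma> z = z" using \<sigma>z by blast
        then have "?s (?fs ! i * a) = mvar z * ?s a" using il zz by (simp add: nth_append subst_mult)
        then show ?thesis by (simp add: mvar_def)
      qed
      then have "single (single z 1) 1 * ?s a \<in> ?M i" using sm by simp
      then have "edge_divides (edges H) ?\<sigma> (single z 1 + \<mu>)" if "\<mu> \<in> keys (?s a)" for \<mu>
        using that by (auto simp: monomial_ideal_def keys_mult_single)
      moreover have "{z, w} \<notin> edges H" for w using iso by (auto simp: isolated_def neighborhood_def insert_commute)
      ultimately have "edge_divides (edges H) ?\<sigma> \<mu>" if "\<mu> \<in> keys (?s a)" for \<mu>
        using edge_divides_add_single[OF \<sigma>z, of "edges H" \<mu>] that by (auto simp: add.commute)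
      then show ?thesis using sa by (simp add: monomial_ideal_def)
    qed
    then show ?thesis unfolding tk using folded_ideal_iff[OF H f a] by blast
  qed
  show ?thesis
    unfolding edge_ring_def
    by (subst regular_sequence_quotient_iff) (use fV proper reg in auto)
qed

section \<open>The graded maximal ideal\<close>

lemma genideal_mvars:
  assumes H: "simple_graph H"
  shows "genideal (polynomial_ring (verts H)) (edge_ideal H \<union> mvar ` verts H) =
    (pos_ideal H :: ('v, 'k::field) mpolynomial set)"
proof
  let ?X = "edge_ideal H \<union> mvar ` verts H :: ('v, 'k) mpolynomial set"
  have "mvar ` verts H \<subseteq> (pos_ideal H :: ('v, 'k) mpolynomial set)"
    by (rule image_subsetI) (rule mvar_pos)
  then have X: "?X \<subseteq> pos_ideal H" using edge_ideal_pos[OF H] by (rule Un_least[rotated])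
  then show "genideal (polynomial_ring (verts H)) ?X \<subseteq> pos_ideal H"
    by (rule genideal_poly_minimal[OF pos_ideal_subring_ideal])
  have XV: "?X \<subseteq> polys (verts H)" using X by (auto simp: monomial_ideal_def)
  interpret J: subring_ideal "polys (verts H)" "genideal (polynomial_ring (verts H)) ?X"
    by (rule genideal_subring_ideal[OF XV])
  show "pos_ideal H \<subseteq> genideal (polynomial_ring (verts H)) ?X"
  proof (rule monomial_ideal_subset[OF J.subring_ideal_axioms])
    fix \<mu> :: "'v \<Rightarrow>\<^sub>0 nat" assume \<mu>: "keys \<mu> \<subseteq> verts H" "1 \<le> tdeg \<mu>"
    then have "\<mu> \<noteq> 0" by auto
    then obtain v where v: "v \<in> keys \<mu>" by (metis all_not_in_conv keys_eq_empty)
    have e: "\<mu> = (\<mu> - single v 1) + single v 1"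
      using v by (intro poly_mapping_eqI) (auto simp: lookup_add lookup_minus lookup_single when_def in_keys_iff)
    have k: "keys (\<mu> - single v 1) \<subseteq> keys \<mu>" by (auto simp: in_keys_iff lookup_minus)
    have "mvar v \<in> genideal (polynomial_ring (verts H)) ?X"
      using genideal_poly_self[OF XV] v \<mu> by blast
    moreover have "single (\<mu> - single v 1) 1 \<in> polys (verts H)" using k \<mu> by (auto simp: polys_def)
    ultimately have "single (\<mu> - single v 1) 1 * mvar v \<in> genideal (polynomial_ring (verts H)) ?X"
      by (rule J.I_mult[rotated])
    moreover have "single (\<mu> - single v 1) 1 * mvar v = (single \<mu> 1 :: ('v, 'k) mpolynomial)"
      unfolding mvar_def mult_single by (simp only: e[symmetric] mult_1)
    ultimately show "single \<mu> 1 \<in> genideal (polynomial_ring (verts H)) ?X" by simp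
  qed
qed

lemma coset_mem_irrelevant_iff:
  fixes p :: "('v, 'k::field) mpolynomial"
  assumes H: "simple_graph H" and p: "p \<in> polys (verts H)"
  shows "edge_ideal H +>\<^bsub>polynomial_ring (verts H)\<^esub> p \<in> irrelevant_ideal H \<longleftrightarrow> p \<in> pos_ideal H"
proof -
  interpret cring_ideal "polynomial_ring (verts H) :: ('v, 'k) mpolynomial ring" "edge_ideal H"
    by (rule cring_ideal_edge_ideal[OF H])
  have g: "{edge_ideal H +>\<^bsub>polynomial_ring (verts H)\<^esub> mvar v |v. v \<in> verts H} =
      (+>\<^bsub>polynomial_ring (verts H)\<^esub>) (edge_ideal H) ` (mvar ` verts H)" by blast
  have "mvar ` verts H \<subseteq> carrier (polynomial_ring (verts H) :: ('v, 'k) mpolynomial ring)"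
    by (auto intro: polys_closed)
  then show ?thesis
    unfolding irrelevant_ideal_def edge_ring_def g
    using p by (subst coset_mem_genideal_iff) (simp_all add: genideal_mvars[OF H])
qed

lemma irrelevant_ideal_eq:
  assumes H: "simple_graph H"
  shows "(irrelevant_ideal H :: ('v, 'k::field) mpolynomial set set) =
    (+>\<^bsub>polynomial_ring (verts H)\<^esub>) (edge_ideal H) ` pos_ideal H"
proof -
  interpret cring_ideal "polynomial_ring (verts H) :: ('v, 'k) mpolynomial ring" "edge_ideal H"
    by (rule cring_ideal_edge_ideal[OF H])
  interpret Q: cring Q by (rule cring_Q)
  have "{edge_ideal H +>\<^bsub>polynomial_ring (verts H)\<^esub> mvar v |v. v \<in> verts H} \<subseteq> carrier Q"
    unfolding carrier_Q by (auto intro: polys_closed)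
  then have "irrelevant_ideal H \<subseteq> carrier Q"
    unfolding irrelevant_ideal_def edge_ring_def
    by (rule additive_subgroup.a_subset[OF ideal.axioms(1)[OF Q.genideal_ideal]])
  then have 1: "x \<in> irrelevant_ideal H \<Longrightarrow> \<exists>p\<in>polys (verts H). x = edge_ideal H +>\<^bsub>polynomial_ring (verts H)\<^esub> p"
    for x :: "('v, 'k) mpolynomial set"
    unfolding carrier_Q by auto
  have 2: "p \<in> pos_ideal H \<Longrightarrow> p \<in> polys (verts H)" for p :: "('v, 'k) mpolynomial"
    by (simp add: monomial_ideal_def)
  show ?thesis
  proof (intro equalityI subsetI)
    fix x :: "('v, 'k) mpolynomial set" assume x: "x \<in> irrelevant_ideal H"
    then obtain p where "p \<in> polys (verts H)" "x = edge_ideal H +>\<^bsub>polynomial_ring (verts H)\<^esub> p"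
      using 1 by blast
    then show "x \<in> (+>\<^bsub>polynomial_ring (verts H)\<^esub>) (edge_ideal H) ` pos_ideal H"
      using x coset_mem_irrelevant_iff[OF H] by blast
  next
    fix x :: "('v, 'k) mpolynomial set"
    assume "x \<in> (+>\<^bsub>polynomial_ring (verts H)\<^esub>) (edge_ideal H) ` pos_ideal H"
    then obtain p where p: "p \<in> pos_ideal H" "x = edge_ideal H +>\<^bsub>polynomial_ring (verts H)\<^esub> p" by blast
    then show "x \<in> irrelevant_ideal H" using coset_mem_irrelevant_iff[OF H 2[OF p(1)]] by simp
  qed
qed

lemma maximalideal_pos_ideal:
  "maximalideal (pos_ideal H) (polynomial_ring (verts H) :: ('v, 'k::field) mpolynomial ring)"
proof (rule maximalidealI)
  let ?R = "polynomial_ring (verts H) :: ('v, 'k) mpolynomial ring"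
  show "ideal (pos_ideal H) ?R" by (simp add: ideal_polynomial_ring_iff pos_ideal_subring_ideal[simplified])
  have "1 \<in> carrier ?R" "1 \<notin> (pos_ideal H :: ('v, 'k) mpolynomial set)"
    by (simp_all add: polys_closed monomial_ideal_def)
  then show "carrier ?R \<noteq> pos_ideal H" by metis
  fix J assume J: "ideal J ?R" "pos_ideal H \<subseteq> J" "J \<subseteq> carrier ?R"
  interpret J: subring_ideal "polys (verts H)" J using J(1) by (simp add: ideal_polynomial_ring_iff)
  show "J = pos_ideal H \<or> J = carrier ?R"
  proof (rule disjCI)
    assume "J \<noteq> carrier ?R"
    have "J \<subseteq> pos_ideal H"
    proof
      fix p assume p: "p \<in> J"
      show "p \<in> pos_ideal H"
      proof (rule ccontr)
        assume np: "p \<notin> pos_ideal H"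
        have pV: "p \<in> polys (verts H)" using p J.I_sub by blast
        define c where "c = lookup p 0"
        have "c \<noteq> 0"
        proof
          assume "c = 0"
          then have "1 \<le> tdeg \<mu>" if "\<mu> \<in> keys p" for \<mu>
            using that tdeg_eq_0_iff[of \<mu>] by (cases "tdeg \<mu>") (auto simp: c_def in_keys_iff)
          then show False using np pV by (simp add: monomial_ideal_def)
        qed
        have "p - constp c \<in> pos_ideal H"
        proof -
          have "1 \<le> tdeg \<mu>" if "\<mu> \<in> keys (p - constp c)" for \<mu>
            using that tdeg_eq_0_iff[of \<mu>] by (cases "tdeg \<mu>") (auto simp: c_def in_keys_iff lookup_minus)
          then show ?thesis using pV by (simp add: monomial_ideal_def polys_closed)
        qed
        then have pc: "p - constp c \<in> J" using J(2) by blast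
        have "p + - 1 * (p - constp c) \<in> J"
          by (rule J.I_add[OF p J.I_mult[OF _ pc]]) (simp add: polys_closed)
        then have cJ: "constp c \<in> J" by simp
        have oneJ: "constp (inverse c) * constp c \<in> J" by (rule J.I_mult[OF _ cJ]) (rule polys_closed)
        have "constp (inverse c) * constp c = (1 :: ('v, 'k) mpolynomial)" using \<open>c \<noteq> 0\<close> by (simp add: mult_single)
        with oneJ have "1 \<in> J" by simp
        have "q \<in> J" if "q \<in> polys (verts H)" for q
          using J.I_mult[OF that \<open>1 \<in> J\<close>] by simp
        then have "J = carrier ?R" using J.I_sub by auto
        with \<open>J \<noteq> carrier ?R\<close> show False by blast
      qed
    qed
    then show "J = pos_ideal H" using J(2) by blast
  qed
qed

lemma maximalideal_irrelevant:
  assumes H: "simple_graph H"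
  shows "maximalideal (irrelevant_ideal H) (edge_ring H :: ('v, 'k::field) mpolynomial set ring)"
proof -
  interpret cring_ideal "polynomial_ring (verts H) :: ('v, 'k) mpolynomial ring" "edge_ideal H"
    by (rule cring_ideal_edge_ideal[OF H])
  show ?thesis unfolding irrelevant_ideal_eq[OF H] edge_ring_def
    by (rule maximalideal_image[OF maximalideal_pos_ideal edge_ideal_pos[OF H]])
qed

section \<open>Upper bounds for the depth\<close>

lemma ideal_power_one:
  fixes f :: "nat \<Rightarrow> ('v, 'k::field) mpolynomial"
  assumes t: "ring_tuple (polys V) I f r" and k: "k \<le> r"
  shows "ideal_power (polys V) I f k 1 = genideal (polynomial_ring V) (I \<union> f ` {..<k})"
proof -
  interpret ring_tuple "polys V" I f r by fact
  have X: "I \<union> f ` {..<j} \<subseteq> polys V" if "j \<le> r" for j using I_sub f_C that by auto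
  have "ideal_power (polys V) I f j 1 \<subseteq> genideal (polynomial_ring V) (I \<union> f ` {..<j})" if "j \<le> r" for j
    using that
  proof (induction j)
    case 0
    then show ?case using genideal_poly_self[OF X[of 0]] by simp
  next
    case (Suc j)
    interpret G: subring_ideal "polys V" "genideal (polynomial_ring V) (I \<union> f ` {..<Suc j})"
      by (rule genideal_subring_ideal[OF X[OF Suc.prems]])
    show ?case
    proof
      fix x assume "x \<in> ideal_power (polys V) I f (Suc j) 1"
      then obtain a b where x: "x = a + f j * b" "a \<in> ideal_power (polys V) I f j 1" "b \<in> polys V" by auto
      have "a \<in> genideal (polynomial_ring V) (I \<union> f ` {..<j})" using Suc x(2) by auto
      moreover have "I \<union> f ` {..<j} \<subseteq> I \<union> f ` {..<Suc j}" by auto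
      ultimately have "a \<in> genideal (polynomial_ring V) (I \<union> f ` {..<Suc j})"
        using genideal_poly_mono[OF X[OF Suc.prems]] by blast
      moreover have "f j \<in> genideal (polynomial_ring V) (I \<union> f ` {..<Suc j})"
        using genideal_poly_self[OF X[OF Suc.prems]] by auto
      then have "b * f j \<in> genideal (polynomial_ring V) (I \<union> f ` {..<Suc j})" by (rule G.I_mult[OF x(3)])
      ultimately show "x \<in> genideal (polynomial_ring V) (I \<union> f ` {..<Suc j})"
        using G.I_add[of a "b * f j"] x(1) by (simp add: mult.commute)
    qed
  qed
  moreover have "genideal (polynomial_ring V) (I \<union> f ` {..<k}) \<subseteq> ideal_power (polys V) I f k 1"
  proof (rule genideal_poly_minimal)
    show "subring_ideal (polys V) (ideal_power (polys V) I f k 1)"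
      using P_C[OF k] P_zero[OF k] P_add[OF k] P_mult[OF k] by unfold_locales (auto simp: polys_closed)
    have "f j \<in> ideal_power (polys V) I f k 1" if "j < k" for j
      using gen_mult_P[OF k that, of 1 0] by (simp add: polys_closed)
    then show "I \<union> f ` {..<k} \<subseteq> ideal_power (polys V) I f k 1" using P_I[OF k] by auto
  qed
  ultimately show ?thesis using k by auto
qed

text \<open>Representatives of a regular sequence in the graded maximal ideal of the edge ring are a regular tuple
of polynomials without constant term, so the bounds on the length of such tuples apply.\<close>

lemma regular_sequence_lift:
  fixes xs :: "('v, 'k::field) mpolynomial set list"
  assumes H: "simple_graph H" and xs: "regular_sequence (edge_ring H) xs" "set xs \<subseteq> irrelevant_ideal H"
  shows "\<exists>f :: nat \<Rightarrow> ('v, 'k) mpolynomial.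
    monomial_regular_tuple (verts H) (edge_divides (edges H) id) f (length xs)"
proof -
  let ?V = "verts H" and ?I = "edge_ideal H :: ('v, 'k) mpolynomial set"
  let ?R = "polynomial_ring ?V :: ('v, 'k) mpolynomial ring"
  interpret cring_ideal ?R ?I by (rule cring_ideal_edge_ideal[OF H])
  have "\<exists>p. p \<in> pos_ideal H \<and> x = ?I +>\<^bsub>?R\<^esub> p" if "x \<in> set xs" for x
    using that xs(2) unfolding irrelevant_ideal_eq[OF H] by blast
  then obtain g where g: "\<And>x. x \<in> set xs \<Longrightarrow> g x \<in> pos_ideal H" "\<And>x. x \<in> set xs \<Longrightarrow> x = ?I +>\<^bsub>?R\<^esub> g x" by metis
  define fs where "fs = map g xs"
  have xsf: "xs = map ((+>\<^bsub>?R\<^esub>) ?I) fs" unfolding fs_def using g(2) by (simp add: map_idI)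
  have len: "length fs = length xs" by (simp add: fs_def)
  have fpos: "set fs \<subseteq> pos_ideal H" using g(1) by (auto simp: fs_def)
  then have fV: "set fs \<subseteq> polys ?V" by (auto simp: monomial_ideal_def)
  have reg: "a \<in> genideal ?R (?I \<union> set (take i fs))"
    if "i < length fs" "a \<in> polys ?V" "fs ! i * a \<in> genideal ?R (?I \<union> set (take i fs))" for i a
    using xs(1) fV that regular_sequence_quotient_iff[of fs] unfolding edge_ring_def xsf by simp
  let ?f = "\<lambda>i. fs ! i"
  have t: "ring_tuple (polys ?V) (monomial_ideal ?V (edge_divides (edges H) id)) ?f (length xs)"
    unfolding ring_tuple_def ring_tuple_axioms_def
    using fV len by (auto intro!: monomial_ideal_subring_ideal up_closed_edge_divides)
  have ip: "ideal_power (polys ?V) (monomial_ideal ?V (edge_divides (edges H) id)) ?f i 1 =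
      genideal ?R (?I \<union> set (take i fs))" if "i \<le> length xs" for i
  proof -
    have "?f ` {..<i} = set (take i fs)" using nth_image[of i fs] that len by (simp add: atLeast0LessThan)
    then show ?thesis using ideal_power_one[OF t that] by (simp only: edge_ideal_eq[OF H])
  qed
  have "monomial_regular_tuple ?V (edge_divides (edges H) id) ?f (length xs)"
    unfolding monomial_regular_tuple_def monomial_regular_tuple_axioms_def regular_tuple_def regular_tuple_axioms_def
  proof (intro conjI t up_closed_edge_divides allI impI)
    fix i a assume i: "i < length xs" and a: "a \<in> polys ?V"
      and m: "fs ! i * a \<in> ideal_power (polys ?V) (monomial_ideal ?V (edge_divides (edges H) id)) ?f i 1"
    have il: "i \<le> length xs" using i by simp
    show "a \<in> ideal_power (polys ?V) (monomial_ideal ?V (edge_divides (edges H) id)) ?f i 1"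
      using reg[of i a] i a m len unfolding ip[OF il] by simp
  next
    fix i assume "i < length xs"
    then show "fs ! i \<in> pos_ideal H" using fpos len nth_mem[of i fs] by auto
  qed
  then show ?thesis by blast
qed

lemma edge_ring_depth_leI:
  fixes H :: "'v graph"
  assumes H: "simple_graph H"
    and le: "\<And>(f :: nat \<Rightarrow> ('v, 'k::field) mpolynomial) r.
      monomial_regular_tuple (verts H) (edge_divides (edges H) id) f r \<Longrightarrow> r \<le> n"
  shows "edge_ring_depth TYPE('k) H \<le> enat n"
  unfolding edge_ring_depth_def ideal_depth_def
proof (rule Sup_least)
  fix d assume "d \<in> {enat (length xs) |xs. regular_sequence (edge_ring H :: ('v, 'k) mpolynomial set ring) xs \<and>
    set xs \<subseteq> irrelevant_ideal H}"
  then obtain xs :: "('v, 'k) mpolynomial set list" where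
    "d = enat (length xs)" "regular_sequence (edge_ring H) xs" "set xs \<subseteq> irrelevant_ideal H" by blast
  then show "d \<le> enat n" using regular_sequence_lift[OF H] le by auto
qed

definition independent_set :: "'v graph \<Rightarrow> 'v set \<Rightarrow> bool" where
  "independent_set H F \<longleftrightarrow> F \<subseteq> verts H \<and> (\<forall>u\<in>F. \<forall>v\<in>F. {u, v} \<notin> edges H)"

definition maximal_independent :: "'v graph \<Rightarrow> 'v set \<Rightarrow> bool" where
  "maximal_independent H F \<longleftrightarrow> independent_set H F \<and> (\<forall>v\<in>verts H - F. \<exists>u\<in>F. {u, v} \<in> edges H)"

definition squarefree :: "'v set \<Rightarrow> 'v \<Rightarrow>\<^sub>0 nat" where
  "squarefree F = (\<Sum>v\<in>F. single v 1)"

lemma lookup_squarefree: "finite F \<Longrightarrow> lookup (squarefree F) v = (if v \<in> F then 1 else 0)"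
  by (simp add: squarefree_def lookup_sum lookup_single when_def)

lemma keys_squarefree: "finite F \<Longrightarrow> keys (squarefree F) = F"
  by (auto simp: in_keys_iff lookup_squarefree split: if_splits)

lemma independent_finite: "simple_graph H \<Longrightarrow> independent_set H F \<Longrightarrow> finite F"
  by (auto simp: independent_set_def simple_graph_def intro: finite_subset)

lemma edge_divides_id: 
  assumes "simple_graph H"
  shows "edge_divides (edges H) id \<mu> \<longleftrightarrow> (\<exists>u v. {u, v} \<in> edges H \<and> u \<in> keys \<mu> \<and> v \<in> keys \<mu>)"
  by (rule edge_divides_id_iff) (use simple_graph_edge[OF assms] in blast)

text \<open>The product of the vertices of \<open>F\<close> is not in the edge ideal since \<open>F\<close> is independent, and it is killed by
every other variable since \<open>F\<close> is maximal.\<close>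

theorem depth_le_maximal_independent:
  fixes H :: "'v graph"
  assumes H: "simple_graph H" and F: "maximal_independent H F"
  shows "edge_ring_depth TYPE('k::field) H \<le> enat (card F)"
proof (rule edge_ring_depth_leI[OF H])
  fix f :: "nat \<Rightarrow> ('v, 'k) mpolynomial" and r
  assume "monomial_regular_tuple (verts H) (edge_divides (edges H) id) f r"
  then interpret monomial_regular_tuple "verts H" "edge_divides (edges H) id" f r .
  have ind: "independent_set H F" using F by (simp add: maximal_independent_def)
  have fin: "finite F" by (rule independent_finite[OF H ind])
  have FV: "F \<subseteq> verts H" using ind by (simp add: independent_set_def)
  let ?z = "single (squarefree F) 1 :: ('v, 'k) mpolynomial"
  show "r \<le> card F"
  proof (rule length_le_annihilated[OF fin, of ?z])
    show "?z \<in> polys (verts H)" using FV fin by (simp add: polys_def keys_squarefree)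
    show "?z \<notin> monomial_ideal (verts H) (edge_divides (edges H) id)"
      using ind fin by (auto simp: monomial_ideal_def edge_divides_id[OF H] keys_squarefree independent_set_def)
    fix p :: "('v, 'k) mpolynomial" assume p: "p \<in> polys (verts H)" "restrict_vars F p = 0"
    have "edge_divides (edges H) id \<mu>" if \<mu>: "\<mu> \<in> keys (?z * p)" for \<mu>
    proof -
      obtain \<nu> where \<nu>: "\<nu> \<in> keys p" "\<mu> = squarefree F + \<nu>" using \<mu> by (auto simp: keys_mult_single)
      then obtain v where v: "v \<in> keys \<nu>" "v \<notin> F" using p(2) by (auto simp: restrict_vars_eq_0_iff)
      moreover have "v \<in> verts H" using v(1) \<nu>(1) p(1) by (auto simp: polys_def)
      ultimately obtain u where "u \<in> F" "{u, v} \<in> edges H" using F by (auto simp: maximal_independent_def)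
      then show ?thesis using v \<nu> fin by (auto simp: edge_divides_id[OF H] keys_add_nat keys_squarefree)
    qed
    then show "p * ?z \<in> monomial_ideal (verts H) (edge_divides (edges H) id)"
      using p(1) FV fin polys_mult[of ?z "verts H" p]
      by (simp add: monomial_ideal_def mult.commute) (simp add: polys_def keys_squarefree)
  qed
qed


lemma mvar_neq_0: "mvar v \<noteq> (0 :: ('v, 'k::field) mpolynomial)"
proof
  assume "mvar v = (0 :: ('v, 'k) mpolynomial)"
  then have "lookup (mvar v) (single v 1) = lookup (0 :: ('v, 'k) mpolynomial) (single v 1)" by (rule arg_cong)
  then show False by (simp add: mvar_def)
qed

lemma squarefree_insert: "finite F \<Longrightarrow> v \<notin> F \<Longrightarrow> squarefree (insert v F) = single v 1 + squarefree F"
  by (simp add: squarefree_def)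

lemma tdeg_squarefree: "finite F \<Longrightarrow> tdeg (squarefree F) = card F"
  by (induction F rule: finite_induct) (simp_all add: squarefree_insert tdeg_add, simp add: squarefree_def)

lemma matched_pair_nonzerodivisor:
  fixes a :: "('v, 'k::field) mpolynomial"
  assumes H: "simple_graph H" and xy: "x \<noteq> y"
    and tr: "\<And>w w'. {x, w} \<in> edges H \<Longrightarrow> {y, w'} \<in> edges H \<Longrightarrow> {w, w'} \<in> edges H"
    and a: "a \<in> polys (verts H)"
      "(mvar x - mvar y) * a \<in> monomial_ideal (verts H) (edge_divides (edges H) id)"
  shows "a \<in> monomial_ideal (verts H) (edge_divides (edges H) id)"
proof (rule mvar_diff_nonzerodivisor[OF up_closed_edge_divides xy _ a])
  fix \<mu> assume 1: "edge_divides (edges H) id (\<mu> + single x 1)" "edge_divides (edges H) id (\<mu> + single y 1)"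
  show "edge_divides (edges H) id \<mu>"
  proof (rule ccontr)
    assume n: "\<not> ?thesis"
    obtain w where "{x, w} \<in> edges H" "w \<in> keys \<mu>"
      using edge_divides_add_single[of id x, OF _ 1(1)] n by auto
    moreover obtain w' where "{y, w'} \<in> edges H" "w' \<in> keys \<mu>"
      using edge_divides_add_single[of id y, OF _ 1(2)] n by auto
    ultimately show False using tr n unfolding edge_divides_id[OF H] by blast
  qed
qed

text \<open>Let \<open>z\<close> be the product of \<open>x\<close> and the vertices of \<open>F\<close>. Modulo \<open>x - y\<close> it is killed by
every variable outside \<open>F\<close>: by \<open>x\<close> and \<open>y\<close> since \<open>x y\<close> is an edge, by the neighbours of \<open>y\<close> since \<open>x\<close> in \<open>z\<close> can be
traded for \<open>y\<close>, and by all others as in the edge ring itself. So dividing by the nonzerodivisor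
\<open>x - y\<close> leaves depth at most \<open>card F\<close>.\<close>

theorem depth_le_pinched_pair:
  fixes H :: "'v graph"
  assumes H: "simple_graph H" and xy: "{x, y} \<in> edges H"
    and tr: "\<And>w w'. {x, w} \<in> edges H \<Longrightarrow> {y, w'} \<in> edges H \<Longrightarrow> {w, w'} \<in> edges H"
    and Fx: "independent_set H (insert x F)" "x \<notin> F" and Fy: "independent_set H (insert y F)" "y \<notin> F"
    and mx: "\<And>t. t \<in> verts H - insert x (insert y F) \<Longrightarrow> \<exists>u\<in>insert x (insert y F). {u, t} \<in> edges H"
  shows "edge_ring_depth TYPE('k::field) H \<le> enat (card F + 1)"
proof (rule edge_ring_depth_leI[OF H])
  fix f :: "nat \<Rightarrow> ('v, 'k) mpolynomial" and r
  let ?V = "verts H" and ?B = "edge_divides (edges H) id"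
  let ?I = "monomial_ideal ?V ?B :: ('v, 'k) mpolynomial set"
  assume "monomial_regular_tuple ?V ?B f r"
  then interpret monomial_regular_tuple ?V ?B f r .
  have fin: "finite F" and FV: "F \<subseteq> ?V" and V: "x \<in> ?V" "y \<in> ?V"
    using independent_finite[OF H Fx(1)] Fx(1) Fy(1) by (auto simp: independent_set_def)
  have ne: "x \<noteq> y" using simple_graph_edge[OF H xy] by simp
  let ?\<theta> = "mvar x - mvar y :: ('v, 'k) mpolynomial"
  let ?m = "single (squarefree F) 1 :: ('v, 'k) mpolynomial"
  let ?z = "mvar x * ?m"
  let ?X = "single x 1 + squarefree F" and ?Y = "single y 1 + squarefree F"
  have zs: "?z = single ?X 1" by (simp add: mvar_def mult_single)
  have mV: "?m \<in> polys ?V" using FV fin by (simp add: polys_def keys_squarefree)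
  have \<theta>V: "?\<theta> \<in> polys ?V" using V by (intro polys_diff polys_basic)
  have kX: "keys ?X = insert x F" and kY: "keys ?Y = insert y F"
    using fin by (simp_all add: keys_add_nat keys_squarefree)
  have BX: "\<not> ?B ?X" "\<not> ?B ?Y"
    unfolding edge_divides_id[OF H] kX kY using Fx(1) Fy(1) unfolding independent_set_def by blast+
  show "r \<le> card F + 1"
  proof (rule length_le_annihilated_mod_nonzerodivisor[OF fin \<theta>V, of ?z "card F + 2"])
    show "?z \<in> polys ?V" using V mV by (intro polys_mult polys_basic)
    show "a \<in> ?I" if "a \<in> polys ?V" "?\<theta> * a \<in> ?I" for a :: "('v, 'k) mpolynomial"
      by (rule matched_pair_nonzerodivisor[OF H ne tr that])
  next
    fix w :: "('v, 'k) mpolynomial" assume "w \<in> polys ?V"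
    \<comment> \<open>The sum of the coefficients at \<open>?X\<close> and \<open>?Y\<close> vanishes for multiples of \<open>x - y\<close>, but is \<open>1\<close> for \<open>z\<close>. So
one of these two monomials, which are outside the edge ideal and of small degree, occurs in \<open>q\<close>.\<close>
    define q where "q = ?z - ?\<theta> * w"
    have lq: "lookup q \<mu> = lookup ?z \<mu> - (lookup (mvar x * w) \<mu> - lookup (mvar y * w) \<mu>)" for \<mu>
      by (simp add: q_def lookup_minus left_diff_distrib)
    have 1: "lookup (mvar x * w) ?X = lookup w (squarefree F)" "lookup (mvar y * w) ?Y = lookup w (squarefree F)"
      by (simp_all add: lookup_mvar_mult keys_add_nat)
    have 2: "lookup (mvar y * w) ?X = 0" "lookup (mvar x * w) ?Y = 0"
    proof -
      have "y \<notin> keys ?X" "x \<notin> keys ?Y" unfolding kX kY using ne Fx(2) Fy(2) by auto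
      then show "lookup (mvar y * w) ?X = 0" "lookup (mvar x * w) ?Y = 0"
        by (simp_all only: lookup_mvar_mult if_False)
    qed
    have "?X \<noteq> ?Y" using kX kY ne Fx(2) by (metis insertE insertI1)
    then have "lookup ?z ?X = 1" "lookup ?z ?Y = 0" unfolding zs by (auto simp: lookup_single when_def)
    then have "lookup q ?X + lookup q ?Y = 1" unfolding lq 1 2 by simp
    then have "lookup q ?X \<noteq> 0 \<or> lookup q ?Y \<noteq> 0" by auto
    then have "?X \<in> keys q \<or> ?Y \<in> keys q" by (simp add: in_keys_iff)
    moreover have "tdeg ?X = card F + 1" "tdeg ?Y = card F + 1" using fin by (simp_all add: tdeg_add tdeg_squarefree)
    ultimately have "q \<notin> monomial_ideal ?V (\<lambda>\<mu>. ?B \<mu> \<or> card F + 2 \<le> tdeg \<mu>)"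
      using BX by (auto simp: monomial_ideal_def)
    then show "?z - ?\<theta> * w \<notin> monomial_ideal ?V (\<lambda>\<mu>. ?B \<mu> \<or> card F + 2 \<le> tdeg \<mu>)"
      unfolding q_def .
  next
    fix p :: "('v, 'k) mpolynomial" assume p: "p \<in> polys ?V" "restrict_vars F p = 0"
    \<comment> \<open>The multipliers that take \<open>z\<close> into \<open>I\<close> modulo \<open>x - y\<close> form an ideal, so it suffices to find in it
the variables outside \<open>F\<close>.\<close>
    define K where "K = {q \<in> polys ?V. \<exists>b\<in>polys ?V. q * ?z - ?\<theta> * b \<in> ?I}"
    have zV: "?z \<in> polys ?V" using V mV by (intro polys_mult polys_basic)
    have K: "subring_ideal (polys ?V) K"
    proof
      show "0 \<in> K" unfolding K_def using I_zero by (auto simp: polys_closed intro!: bexI[of _ 0])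
      show "a + b \<in> K" if ab: "a \<in> K" "b \<in> K" for a b
      proof -
        obtain a' b' where *: "a' \<in> polys ?V" "a * ?z - ?\<theta> * a' \<in> ?I" "b' \<in> polys ?V" "b * ?z - ?\<theta> * b' \<in> ?I"
          using ab unfolding K_def by blast
        have "(a + b) * ?z - ?\<theta> * (a' + b') = (a * ?z - ?\<theta> * a') + (b * ?z - ?\<theta> * b')" by (simp add: algebra_simps)
        also have "\<dots> \<in> ?I" by (rule I_add[OF *(2,4)])
        finally show ?thesis using * ab polys_add unfolding K_def by blast
      qed
      show "c * a \<in> K" if ca: "c \<in> polys ?V" "a \<in> K" for c a
      proof -
        obtain a' where *: "a' \<in> polys ?V" "a * ?z - ?\<theta> * a' \<in> ?I" using ca unfolding K_def by blast
        have "(c * a) * ?z - ?\<theta> * (c * a') = c * (a * ?z - ?\<theta> * a')" by (simp add: algebra_simps)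
        also have "\<dots> \<in> ?I" by (rule I_mult[OF ca(1) *(2)])
        finally show ?thesis using * ca polys_mult unfolding K_def by blast
      qed
    qed (auto simp: polys_closed K_def)
    have tz: "mvar t * ?z \<in> ?I" if t: "t \<in> ?V" "u \<in> insert x F" "{u, t} \<in> edges H" for t u
    proof -
      have e: "mvar t * ?z = single (single t 1 + ?X) 1" by (simp add: zs mvar_def mult_single)
      have k: "keys (single t 1 + ?X) = insert t (insert x F)"
        using fin by (auto simp: keys_add_nat keys_squarefree)
      show ?thesis unfolding e
      proof (rule single_mem_monomial_ideal)
        show "keys (single t 1 + ?X) \<subseteq> ?V" unfolding k using t FV V by auto
        show "?B (single t 1 + ?X)" unfolding edge_divides_id[OF H] k using t by blast
      qed
    qed
    have tK: "mvar t \<in> K" if t: "t \<in> ?V" "t \<notin> F" for t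
    proof -
      have tV: "mvar t \<in> polys ?V" using t by (simp add: polys_closed)
      consider "t = x" | "\<exists>u\<in>insert x F. {u, t} \<in> edges H" | "{y, t} \<in> edges H"
        using mx[of t] t xy by auto
      then show ?thesis
      proof cases
        case 1
        have "mvar t * ?z - ?\<theta> * ?z = mvar y * ?z" by (simp add: 1 algebra_simps)
        also have "\<dots> \<in> ?I" by (rule tz[OF V(2) _ xy]) simp
        finally show ?thesis using tV zV unfolding K_def by blast
      next
        case 2
        then have "mvar t * ?z \<in> ?I" using tz[OF t(1)] by blast
        then have "mvar t * ?z - ?\<theta> * 0 \<in> ?I" by simp
        then show ?thesis using tV polys_basic(2) unfolding K_def by blast
      next
        case 3
        have "mvar t * ?z - ?\<theta> * (mvar t * ?m) = mvar t * (mvar y * ?m)" by (simp add: algebra_simps)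
        also have "\<dots> = single (single t 1 + ?Y) 1" by (simp add: mvar_def mult_single)
        also have "\<dots> \<in> ?I"
        proof (rule single_mem_monomial_ideal)
          have k: "keys (single t 1 + ?Y) = insert t (insert y F)"
            using fin by (auto simp: keys_add_nat keys_squarefree)
          show "keys (single t 1 + ?Y) \<subseteq> ?V" unfolding k using t FV V by auto
          show "?B (single t 1 + ?Y)" unfolding edge_divides_id[OF H] k using 3 by blast
        qed
        finally show ?thesis using tV polys_mult[OF tV mV] unfolding K_def by blast
      qed
    qed
    have "p \<in> monomial_ideal ?V (\<lambda>\<mu>. \<not> keys \<mu> \<subseteq> F)"
      using p by (simp add: monomial_ideal_def restrict_vars_eq_0_iff)
    also have "\<dots> \<subseteq> K"
    proof (rule monomial_ideal_subset[OF K])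
      fix \<mu> :: "'v \<Rightarrow>\<^sub>0 nat" assume \<mu>: "keys \<mu> \<subseteq> ?V" "\<not> keys \<mu> \<subseteq> F"
      then obtain t where t: "t \<in> keys \<mu>" "t \<notin> F" "t \<in> ?V" by blast
      have e: "\<mu> = (\<mu> - single t 1) + single t 1"
        using t by (intro poly_mapping_eqI) (auto simp: lookup_add lookup_minus lookup_single when_def in_keys_iff)
      have k: "keys (\<mu> - single t 1) \<subseteq> keys \<mu>" by (auto simp: in_keys_iff lookup_minus)
      have "single (\<mu> - single t 1) 1 * mvar t \<in> K"
        by (rule subring_ideal.I_mult[OF K _ tK[OF t(3,2)]]) (use k \<mu> in \<open>auto simp: polys_def\<close>)
      moreover have "single (\<mu> - single t 1) 1 * mvar t = (single \<mu> 1 :: ('v, 'k) mpolynomial)"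
        unfolding mvar_def mult_single by (simp only: e[symmetric] mult_1)
      ultimately show "single \<mu> 1 \<in> K" by simp
    qed
    finally have "p \<in> K" .
    then show "\<exists>b\<in>polys ?V. p * ?z - ?\<theta> * b \<in> ?I" unfolding K_def by blast
  qed
qed

section \<open>Cohen--Macaulay graphs\<close>

text \<open>Polynomials form a domain if the exponents are linearly ordered, which an injection of the variables into
the natural numbers achieves.\<close>

lemma polys_domain:
  fixes p q :: "('v, 'k::field) mpolynomial"
  assumes F: "finite F" and p: "p \<in> polys F" and q: "q \<in> polys F" and pq: "p * q = 0"
  shows "p = 0 \<or> q = 0"
proof -
  obtain \<iota> :: "'v \<Rightarrow> nat" where \<iota>: "inj_on \<iota> F" using finite_imp_inj_to_nat_seg[OF F] by blast
  let ?h = "subst (\<lambda>v. mvar (\<iota> v)) :: ('v, 'k) mpolynomial \<Rightarrow> (nat, 'k) mpolynomial"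
  let ?g = "subst (\<lambda>i. mvar (inv_into F \<iota> i)) :: (nat, 'k) mpolynomial \<Rightarrow> ('v, 'k) mpolynomial"
  have gh: "?g (?h a) = a" if "a \<in> polys F" for a
  proof -
    have "?g (?h a) = subst (\<lambda>v. mvar (inv_into F \<iota> (\<iota> v))) a" by (simp add: subst_subst)
    also have "\<dots> = subst mvar a" by (rule subst_cong_polys[OF that]) (simp add: \<iota>)
    finally show ?thesis by simp
  qed
  have "?h p * ?h q = 0" using pq by (simp flip: subst_mult)
  then have "?h p = 0 \<or> ?h q = 0" by simp
  then show ?thesis using gh[OF p] gh[OF q] subst_zero by metis
qed

text \<open>The prime ideal generated by the variables in \<open>V - F\<close>.\<close>

definition vanishing :: "'v set \<Rightarrow> 'v set \<Rightarrow> ('v, 'k::field) mpolynomial set" where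
  "vanishing V F = {p \<in> polys V. restrict_vars F p = 0}"

lemma primeideal_vanishing:
  assumes F: "finite F"
  shows "primeideal (vanishing V F) (polynomial_ring V :: ('v, 'k::field) mpolynomial ring)"
proof (rule primeidealI)
  let ?R = "polynomial_ring V :: ('v, 'k) mpolynomial ring"
  show "ideal (vanishing V F) ?R"
    unfolding ideal_polynomial_ring_iff vanishing_def restrict_vars_def
    by unfold_locales (auto simp: polys_closed subst_add subst_mult)
  show "cring ?R" by (rule cring_polynomial_ring)
  have "1 \<notin> (vanishing V F :: ('v, 'k) mpolynomial set)" by (simp add: vanishing_def restrict_vars_def)
  then show "carrier ?R \<noteq> vanishing V F" using polys_basic(1) by (metis carrier_polynomial_ring)
  fix a b :: "('v, 'k) mpolynomial"
  assume ab: "a \<in> carrier ?R" "b \<in> carrier ?R" "a \<otimes>\<^bsub>?R\<^esub> b \<in> vanishing V F"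
  then have "restrict_vars F a * restrict_vars F b = 0"
    by (simp add: vanishing_def restrict_vars_def subst_mult)
  then have "restrict_vars F a = 0 \<or> restrict_vars F b = 0"
    by (rule polys_domain[OF F restrict_vars_polys restrict_vars_polys])
  then show "a \<in> vanishing V F \<or> b \<in> vanishing V F" using ab by (simp add: vanishing_def)
qed

text \<open>Omitting the elements of \<open>F\<close> one after the other gives a chain of monomial primes that ends with the graded maximal
ideal and starts with a prime containing the edge ideal.\<close>

theorem height_ge_independent:
  fixes H :: "'v graph"
  assumes H: "simple_graph H" and F: "independent_set H F"
  shows "enat (card F) \<le> prime_height (edge_ring H :: ('v, 'k::field) mpolynomial set ring) (irrelevant_ideal H)"
proof -
  let ?V = "verts H" and ?I = "edge_ideal H :: ('v, 'k) mpolynomial set"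
  let ?R = "polynomial_ring ?V :: ('v, 'k) mpolynomial ring"
  interpret cring_ideal ?R ?I by (rule cring_ideal_edge_ideal[OF H])
  have fin: "finite F" by (rule independent_finite[OF H F])
  then obtain xs where xs: "set xs = F" "distinct xs" using finite_distinct_list by blast
  have len: "length xs = card F" using xs distinct_card by metis
  let ?P = "\<lambda>i. vanishing ?V (set (drop i xs)) :: ('v, 'k) mpolynomial set"
  define Qi where "Qi i = (+>\<^bsub>?R\<^esub>) ?I ` ?P i" for i
  have sub: "set (drop i xs) \<subseteq> F" for i using xs set_drop_subset by metis
  have prime: "primeideal (?P i) ?R" for i by (rule primeideal_vanishing) simp
  have IP: "?I \<subseteq> ?P i" for i
  proof
    fix p assume "p \<in> ?I"
    then have p: "p \<in> polys ?V" "\<And>\<mu>. \<mu> \<in> keys p \<Longrightarrow> edge_divides (edges H) id \<mu>"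
      unfolding edge_ideal_eq[OF H] monomial_ideal_def by simp_all
    have "\<not> keys \<mu> \<subseteq> set (drop i xs)" if \<mu>: "\<mu> \<in> keys p" for \<mu>
    proof
      assume "keys \<mu> \<subseteq> set (drop i xs)"
      then have k: "keys \<mu> \<subseteq> F" using sub by (rule subset_trans)
      obtain u v where "{u, v} \<in> edges H" "u \<in> keys \<mu>" "v \<in> keys \<mu>"
        using p(2)[OF \<mu>] unfolding edge_divides_id[OF H] by blast
      then show False using k F unfolding independent_set_def by blast
    qed
    then show "p \<in> ?P i" using p(1) by (simp add: vanishing_def restrict_vars_eq_0_iff)
  qed
  have strict: "?P i \<subset> ?P (Suc i)" if i: "i < length xs" for i
  proof
    have d: "set (drop i xs) = insert (xs ! i) (set (drop (Suc i) xs))"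
      using Cons_nth_drop_Suc[OF i] by (metis list.simps(15))
    have nin: "xs ! i \<notin> set (drop (Suc i) xs)"
      using xs(2) Cons_nth_drop_Suc[OF i] by (metis distinct.simps(2) distinct_drop)
    show "?P i \<subseteq> ?P (Suc i)" unfolding vanishing_def restrict_vars_eq_0_iff d by blast
    have "xs ! i \<in> ?V" using i xs(1) F nth_mem[OF i] by (auto simp: independent_set_def)
    then have "mvar (xs ! i) \<in> ?P (Suc i)" "mvar (xs ! i) \<notin> ?P i"
      using nin d by (simp_all add: vanishing_def restrict_vars_def polys_closed mvar_neq_0)
    then show "?P i \<noteq> ?P (Suc i)" by metis
  qed
  have last: "?P (length xs) = pos_ideal H"
  proof -
    have "(\<mu> \<noteq> 0) = (1 \<le> tdeg \<mu>)" for \<mu> :: "'v \<Rightarrow>\<^sub>0 nat" using tdeg_eq_0_iff[of \<mu>] by linarith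
    then have "p \<in> ?P (length xs) \<longleftrightarrow> p \<in> pos_ideal H" for p
      by (simp add: vanishing_def restrict_vars_eq_0_iff monomial_ideal_def)
    then show ?thesis by blast
  qed
  have "enat (length xs) \<in> {enat n |n. \<exists>Q. (\<forall>i\<le>n. primeideal (Q i) (edge_ring H)) \<and>
      (\<forall>i<n. Q i \<subset> Q (Suc i)) \<and> Q n = (irrelevant_ideal H :: ('v, 'k) mpolynomial set set)}"
  proof (intro CollectI exI[of _ "length xs"] exI[of _ Qi] conjI allI impI refl)
    show "primeideal (Qi i) (edge_ring H)" for i
      unfolding Qi_def edge_ring_def by (rule primeideal_image[OF prime IP])
    show "Qi i \<subset> Qi (Suc i)" if "i < length xs" for i
      unfolding Qi_def
      by (rule image_strict_mono[OF primeideal.axioms(1)[OF prime] IP primeideal.axioms(1)[OF prime] strict[OF that]])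
    show "Qi (length xs) = irrelevant_ideal H" unfolding Qi_def last irrelevant_ideal_eq[OF H] ..
  qed
  then show ?thesis unfolding prime_height_def len by (rule Sup_upper)
qed

text \<open>The depth is at most \<open>card F\<close>, which is at most the height, which equals the depth. In particular all
maximal independent sets have the same size.\<close>

theorem cohen_macaulay_depth:
  fixes H :: "'v graph"
  assumes H: "simple_graph H" and CM: "cohen_macaulay_graph TYPE('k::field) H" and F: "maximal_independent H F"
  shows "edge_ring_depth TYPE('k) H = enat (card F)"
proof (rule antisym)
  show "edge_ring_depth TYPE('k) H \<le> enat (card F)" by (rule depth_le_maximal_independent[OF H F])
  have "cohen_macaulay_ring (edge_ring H :: ('v, 'k) mpolynomial set ring)"
    using CM by (simp only: cohen_macaulay_graph_def)
  then have "\<forall>M. maximalideal M (edge_ring H :: ('v, 'k) mpolynomial set ring) \<longrightarrow>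
      ideal_depth (edge_ring H) M = prime_height (edge_ring H) M"
    unfolding cohen_macaulay_ring_def by (elim conjE)
  from mp[OF spec[OF this] maximalideal_irrelevant[OF H]]
  have "edge_ring_depth TYPE('k) H =
      prime_height (edge_ring H :: ('v, 'k) mpolynomial set ring) (irrelevant_ideal H)"
    unfolding edge_ring_depth_def .
  moreover have "independent_set H F" using F unfolding maximal_independent_def by (rule conjunct1)
  note height_ge_independent[OF H this, where 'k = 'k]
  ultimately show "enat (card F) \<le> edge_ring_depth TYPE('k) H" by (simp only:)
qed

section \<open>Hall's marriage theorem\<close>

text \<open>The proof of Halmos and Vaughan. If every nonempty proper subset has more neighbours than elements, the partner of
the first element can be chosen at will. Otherwise a set with as many neighbours as elements
is matched first, and its complement with the remaining elements.\<close>

theorem hall_marriage: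
  fixes N :: "'a \<Rightarrow> 'b set"
  assumes "finite A" "\<And>a. a \<in> A \<Longrightarrow> finite (N a)"
    and "\<And>X. X \<subseteq> A \<Longrightarrow> card X \<le> card (\<Union>(N ` X))"
  shows "\<exists>m. inj_on m A \<and> (\<forall>a\<in>A. m a \<in> N a)"
  using assms
proof (induction A arbitrary: N rule: finite_psubset_induct)
  case (psubset A)
  consider "A = {}" | "A \<noteq> {}" "\<And>X. X \<subset> A \<Longrightarrow> X \<noteq> {} \<Longrightarrow> card X < card (\<Union>(N ` X))"
    | X where "X \<subset> A" "X \<noteq> {}" "card X = card (\<Union>(N ` X))"
  proof (cases "\<exists>X. X \<subset> A \<and> X \<noteq> {} \<and> card X = card (\<Union>(N ` X))")
    case True
    then show ?thesis using that(3) by blast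
  next
    case False
    have "card X < card (\<Union>(N ` X))" if "X \<subset> A" "X \<noteq> {}" for X
    proof -
      have "card X \<le> card (\<Union>(N ` X))" using that(1) by (intro psubset.prems(2)) blast
      moreover have "card X \<noteq> card (\<Union>(N ` X))" using False that by blast
      ultimately show ?thesis by simp
    qed
    then show ?thesis using that(1,2) by blast
  qed
  then show ?case
  proof cases
    case 1
    then show ?thesis by simp
  next
    case 2
    then obtain a where a: "a \<in> A" by blast
    have "card {a} \<le> card (\<Union>(N ` {a}))" using psubset.prems(2)[of "{a}"] a by blast
    then have "N a \<noteq> {}" by auto
    then obtain b where b: "b \<in> N a" by blast
    let ?N = "\<lambda>x. N x - {b}"
    have "\<exists>m. inj_on m (A - {a}) \<and> (\<forall>x\<in>A - {a}. m x \<in> ?N x)"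
    proof (rule psubset.IH)
      show "A - {a} \<subset> A" using a by blast
      show "finite (?N x)" if "x \<in> A - {a}" for x using that psubset.prems(1) by blast
      show "card X \<le> card (\<Union>(?N ` X))" if X: "X \<subseteq> A - {a}" for X
      proof (cases "X = {}")
        case False
        then have "card X < card (\<Union>(N ` X))" using 2(2)[of X] X a by blast
        moreover have "\<Union>(?N ` X) = \<Union>(N ` X) - {b}" by blast
        moreover have "card (\<Union>(N ` X)) - 1 \<le> card (\<Union>(N ` X) - {b})"
          using diff_card_le_card_Diff[of "{b}" "\<Union>(N ` X)"] by simp
        ultimately show ?thesis by simp
      qed simp
    qed
    then obtain m where m: "inj_on m (A - {a})" "\<forall>x\<in>A - {a}. m x \<in> ?N x" by blast
    have "inj_on (m(a := b)) A"
    proof (rule inj_onI)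
      fix x y assume "x \<in> A" "y \<in> A" "(m(a := b)) x = (m(a := b)) y"
      then show "x = y" using m(2) inj_onD[OF m(1), of x y] by (cases "x = a"; cases "y = a") auto
    qed
    moreover have "\<forall>x\<in>A. (m(a := b)) x \<in> N x" using m(2) b by auto
    ultimately show ?thesis by blast
  next
    case 3
    have XA: "X \<subseteq> A" using 3(1) by (rule psubset_imp_subset)
    have "\<exists>m. inj_on m X \<and> (\<forall>x\<in>X. m x \<in> N x)"
    proof (rule psubset.IH[OF 3(1)])
      show "finite (N a)" if "a \<in> X" for a by (rule psubset.prems(1)[OF subsetD[OF XA that]])
      show "card Y \<le> card (\<Union>(N ` Y))" if "Y \<subseteq> X" for Y
        by (rule psubset.prems(2)[OF subset_trans[OF that XA]])
    qed
    then obtain m1 where m1: "inj_on m1 X" "\<forall>x\<in>X. m1 x \<in> N x" by blast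
    let ?U = "\<Union>(N ` X)"
    let ?N = "\<lambda>x. N x - ?U"
    have "\<exists>m. inj_on m (A - X) \<and> (\<forall>x\<in>A - X. m x \<in> ?N x)"
    proof (rule psubset.IH)
      show "A - X \<subset> A" using 3(1,2) by blast
      show "finite (?N x)" if "x \<in> A - X" for x using that psubset.prems(1) by blast
      show "card Y \<le> card (\<Union>(?N ` Y))" if Y: "Y \<subseteq> A - X" for Y
      proof -
        have fin: "finite X" "finite Y" using XA Y psubset.hyps by (auto intro: finite_subset)
        have YA: "Y \<subseteq> A" using Y by blast
        have "\<Union>(N ` (X \<union> Y)) = ?U \<union> \<Union>(?N ` Y)" by auto
        then have "card (\<Union>(N ` (X \<union> Y))) \<le> card ?U + card (\<Union>(?N ` Y))" by (simp only: card_Un_le)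
        moreover have "card (X \<union> Y) \<le> card (\<Union>(N ` (X \<union> Y)))"
          by (rule psubset.prems(2)[OF Un_least[OF XA YA]])
        moreover have "card (X \<union> Y) = card X + card Y" using Y by (intro card_Un_disjoint fin) blast
        ultimately show ?thesis using 3(3) by linarith
      qed
    qed
    then obtain m2 where m2: "inj_on m2 (A - X)" "\<forall>x\<in>A - X. m2 x \<in> ?N x" by blast
    let ?m = "\<lambda>x. if x \<in> X then m1 x else m2 x"
    have sep: "m1 x \<noteq> m2 y" if "x \<in> X" "y \<in> A - X" for x y
    proof -
      have "m1 x \<in> ?U" using m1(2) that(1) by blast
      moreover have "m2 y \<notin> ?U" using m2(2) that(2) by blast
      ultimately show ?thesis by metis
    qed
    have "inj_on ?m A"
    proof (rule inj_onI)
      fix x y assume xy: "x \<in> A" "y \<in> A" "?m x = ?m y"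
      show "x = y"
      proof (cases "x \<in> X"; cases "y \<in> X")
        assume "x \<in> X" "y \<in> X"
        then show ?thesis using xy(3) inj_onD[OF m1(1), of x y] by simp
      next
        assume "x \<in> X" "y \<notin> X"
        then show ?thesis using xy sep[of x y] by simp
      next
        assume "x \<notin> X" "y \<in> X"
        then show ?thesis using xy sep[of y x] by force
      next
        assume "x \<notin> X" "y \<notin> X"
        then show ?thesis using xy inj_onD[OF m2(1), of x y] by simp
      qed
    qed
    moreover have "\<forall>x\<in>A. ?m x \<in> N x" using m1(2) m2(2) by auto
    ultimately show ?thesis by blast
  qed
qed

section \<open>Matchings in Cohen--Macaulay bipartite graphs\<close>

lemma edges_sym: "{u, v} \<in> edges H \<longleftrightarrow> {v, u} \<in> edges H"
  by (simp add: insert_commute)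

lemma independent_subset: "independent_set H F \<Longrightarrow> F' \<subseteq> F \<Longrightarrow> independent_set H F'"
  unfolding independent_set_def by blast

lemma independent_insert_iff:
  assumes "simple_graph H"
  shows "independent_set H (insert t F) \<longleftrightarrow> independent_set H F \<and> t \<in> verts H \<and> (\<forall>u\<in>F. {u, t} \<notin> edges H)"
proof
  assume "independent_set H (insert t F)"
  then show "independent_set H F \<and> t \<in> verts H \<and> (\<forall>u\<in>F. {u, t} \<notin> edges H)"
    unfolding independent_set_def by blast
next
  assume r: "independent_set H F \<and> t \<in> verts H \<and> (\<forall>u\<in>F. {u, t} \<notin> edges H)"
  have tt: "{t, t} \<notin> edges H" using simple_graph_edge(3)[OF assms, of t t] by blast
  have "{a, b} \<notin> edges H" if "a \<in> insert t F" "b \<in> insert t F" for a b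
  proof (cases "a = t")
    case True
    then show ?thesis using that(2) r tt edges_sym[of t b H] by (cases "b = t") auto
  next
    case False
    then show ?thesis using that r by (cases "b = t") (auto simp: independent_set_def)
  qed
  then show "independent_set H (insert t F)" using r unfolding independent_set_def by blast
qed

lemma maximal_property_extend:
  assumes "finite V" "P F0" "\<And>F. P F \<Longrightarrow> F \<subseteq> V"
  shows "\<exists>F. F0 \<subseteq> F \<and> P F \<and> (\<forall>F'. P F' \<longrightarrow> F \<subseteq> F' \<longrightarrow> F' = F)"
proof -
  let ?S = "{F. P F \<and> F0 \<subseteq> F}"
  have "?S \<subseteq> Pow V" using assms(3) by blast
  then have "finite ?S" using assms(1) by (meson finite_Pow_iff finite_subset)
  moreover have "F0 \<in> ?S" using assms(2) by simp
  ultimately obtain F where F: "F \<in> ?S" "\<forall>F'\<in>?S. F \<subseteq> F' \<longrightarrow> F = F'"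
    by (metis (no_types, lifting) finite_has_maximal2)
  have "F' = F" if "P F'" "F \<subseteq> F'" for F'
    using F(2)[rule_format, of F'] that F(1) by blast
  then show ?thesis using F(1) by blast
qed

lemma maximal_independent_extend:
  assumes H: "simple_graph H" and F0: "independent_set H F0"
  obtains F where "F0 \<subseteq> F" "maximal_independent H F"
proof -
  have "finite (verts H)" using H by (simp add: simple_graph_def)
  then obtain F where F: "F0 \<subseteq> F" "independent_set H F" "\<And>F'. independent_set H F' \<Longrightarrow> F \<subseteq> F' \<Longrightarrow> F' = F"
    using maximal_property_extend[of "verts H" "independent_set H" F0] F0 by (auto simp: independent_set_def)
  have "\<exists>u\<in>F. {u, v} \<in> edges H" if "v \<in> verts H - F" for v
    using F(3)[of "insert v F"] F(2) that independent_insert_iff[OF H, of v F] by blast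
  then show ?thesis using that F by (auto simp: maximal_independent_def)
qed

definition matching :: "'v graph \<Rightarrow> ('v \<times> 'v) list \<Rightarrow> bool" where
  "matching H ps \<longleftrightarrow> distinct (map fst ps @ map snd ps) \<and> (\<forall>(x, y)\<in>set ps. {x, y} \<in> edges H)"

definition covered :: "('v \<times> 'v) list \<Rightarrow> 'v set" where
  "covered ps = fst ` set ps \<union> snd ` set ps"

lemma matching_edge: "matching H ps \<Longrightarrow> (x, y) \<in> set ps \<Longrightarrow> {x, y} \<in> edges H"
  by (auto simp: matching_def)

lemma distinct_pairs:
  assumes "distinct (map fst ps @ map snd ps)" "(x, y) \<in> set ps" "(x', y') \<in> set ps"
  shows "x = x' \<longleftrightarrow> y = y'" "x \<noteq> y'"
  using assms by (auto simp: distinct_map inj_on_def) force+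

text \<open>An independent set contains at most one end of each matched edge.\<close>

lemma independent_card_le_pairs:
  assumes H: "simple_graph H" and m: "matching H ps" and F: "independent_set H F" "F \<subseteq> covered ps"
    and S: "\<And>x y. (x, y) \<in> set ps \<Longrightarrow> x \<in> F \<or> y \<in> F \<Longrightarrow> (x, y) \<in> S" "finite S"
  shows "card F \<le> card S"
proof -
  have "\<exists>p. p \<in> set ps \<and> v \<in> {fst p, snd p}" if "v \<in> F" for v
    using subsetD[OF F(2) that] unfolding covered_def by blast
  then obtain \<pi> where \<pi>: "\<And>v. v \<in> F \<Longrightarrow> \<pi> v \<in> set ps \<and> v \<in> {fst (\<pi> v), snd (\<pi> v)}" by metis
  have "inj_on \<pi> F"
  proof (rule inj_onI, rule ccontr)
    fix v w assume v: "v \<in> F" and w: "w \<in> F" and e: "\<pi> v = \<pi> w" and n: "v \<noteq> w"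
    obtain x y where xy: "\<pi> v = (x, y)" by force
    have "v \<in> {x, y}" using \<pi>[OF v] xy by simp
    moreover have "w \<in> {x, y}" using \<pi>[OF w] xy by (simp flip: e)
    ultimately have "{v, w} = {x, y}" using n by auto
    moreover have "{x, y} \<in> edges H" using matching_edge[OF m] \<pi>[OF v] xy by auto
    ultimately show False using F(1) v w unfolding independent_set_def by metis
  qed
  moreover have "\<pi> ` F \<subseteq> S"
  proof
    fix p assume "p \<in> \<pi> ` F"
    then obtain v where v: "v \<in> F" "p = \<pi> v" by blast
    obtain x y where xy: "p = (x, y)" by force
    have "\<pi> v = (x, y)" using v(2) xy by simp
    then have "v \<in> {x, y}" "(x, y) \<in> set ps" using \<pi>[OF v(1)] by simp_all
    then show "p \<in> S" using S(1)[of x y] v(1) xy by auto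
  qed
  ultimately show ?thesis using S(2) by (rule card_inj_on_le)
qed

lemma card_set_matching: "matching H ps \<Longrightarrow> card (set ps) = length ps"
  by (rule distinct_card) (auto simp: matching_def distinct_map)

text \<open>Both colour classes are maximal independent sets, as there are no isolated vertices, and so they have \<open>n\<close> elements. For \<open>X\<close> in one
class, \<open>X\<close> and the vertices of the other class without neighbours in \<open>X\<close> form an
independent set. It has at most \<open>n\<close> elements, which is the condition of Hall.\<close>

lemma bipartite_unmixed_matching:
  assumes H: "simple_graph H" and ni: "no_isolated_vertices H"
    and AB: "A \<union> B = verts H" "A \<inter> B = {}" "\<forall>e\<in>edges H. \<exists>a\<in>A. \<exists>b\<in>B. e = {a, b}"
    and un: "\<And>F. maximal_independent H F \<Longrightarrow> card F = n"
  shows "\<exists>ps. matching H ps \<and> covered ps = verts H \<and> length ps = n"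
proof -
  have fin: "finite A" "finite B" using H AB by (auto simp: simple_graph_def intro: finite_subset)
  have eAB: "u \<in> A \<and> v \<in> B \<or> u \<in> B \<and> v \<in> A" if e: "{u, v} \<in> edges H" for u v
  proof -
    obtain a b where "a \<in> A" "b \<in> B" "{u, v} = {a, b}" using bspec[OF AB(3) e] by blast
    then show ?thesis by (auto simp: doubleton_eq_iff)
  qed
  have nb: "\<exists>u. {u, v} \<in> edges H" if "v \<in> verts H" for v
    using ni that by (auto simp: no_isolated_vertices_def neighborhood_def)
  have "maximal_independent H A"
    unfolding maximal_independent_def independent_set_def
  proof (intro conjI ballI)
    show "A \<subseteq> verts H" using AB(1) by blast
    show "{u, v} \<notin> edges H" if "u \<in> A" "v \<in> A" for u v using eAB[of u v] that AB(2) by blast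
    fix v assume v: "v \<in> verts H - A"
    then obtain u where u: "{u, v} \<in> edges H" using nb by blast
    then show "\<exists>u\<in>A. {u, v} \<in> edges H" using eAB[OF u] v AB(1) by blast
  qed
  then have cA: "card A = n" by (rule un)
  have "maximal_independent H B"
    unfolding maximal_independent_def independent_set_def
  proof (intro conjI ballI)
    show "B \<subseteq> verts H" using AB(1) by blast
    show "{u, v} \<notin> edges H" if "u \<in> B" "v \<in> B" for u v using eAB[of u v] that AB(2) by blast
    fix v assume v: "v \<in> verts H - B"
    then obtain u where u: "{u, v} \<in> edges H" using nb by blast
    then show "\<exists>u\<in>B. {u, v} \<in> edges H" using eAB[OF u] v AB(1) by blast
  qed
  then have cB: "card B = n" by (rule un)
  let ?N = "\<lambda>a. {b. {a, b} \<in> edges H}"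
  have NB: "?N a \<subseteq> B" if "a \<in> A" for a using eAB[of a] that AB(2) by blast
  have hall_cond: "card X \<le> card (\<Union>(?N ` X))" if X: "X \<subseteq> A" for X
  proof -
    let ?U = "\<Union>(?N ` X)"
    have UB: "?U \<subseteq> B" using NB X by blast
    have "independent_set H (X \<union> (B - ?U))"
      unfolding independent_set_def
    proof (intro conjI ballI)
      show "X \<union> (B - ?U) \<subseteq> verts H" using X AB(1) by blast
      fix u v assume uv: "u \<in> X \<union> (B - ?U)" "v \<in> X \<union> (B - ?U)"
      show "{u, v} \<notin> edges H"
      proof
        assume e: "{u, v} \<in> edges H"
        then have e': "{v, u} \<in> edges H" by (simp add: edges_sym)
        from eAB[OF e] show False
        proof
          assume "u \<in> A \<and> v \<in> B"
          then have "u \<in> X" "v \<notin> ?U" using uv X AB(2) by blast+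
          then show False using e by blast
        next
          assume "u \<in> B \<and> v \<in> A"
          then have "v \<in> X" "u \<notin> ?U" using uv X AB(2) by blast+
          then show False using e' by blast
        qed
      qed
    qed
    then obtain F where F: "X \<union> (B - ?U) \<subseteq> F" "maximal_independent H F"
      using maximal_independent_extend[OF H] by blast
    have "finite F" using F(2) independent_finite[OF H] by (auto simp: maximal_independent_def)
    then have "card (X \<union> (B - ?U)) \<le> n" using card_mono[OF _ F(1)] un[OF F(2)] by simp
    moreover have "card (X \<union> (B - ?U)) = card X + card (B - ?U)"
      using X AB(2) fin by (intro card_Un_disjoint) (auto intro: finite_subset)
    moreover have "card (B - ?U) = card B - card ?U" using UB fin(2) by (intro card_Diff_subset) (auto intro: finite_subset)
    moreover have "card ?U \<le> card B" by (rule card_mono[OF fin(2) UB])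
    ultimately show ?thesis using cB by linarith
  qed
  obtain m where m: "inj_on m A" "\<forall>a\<in>A. m a \<in> ?N a"
    using hall_marriage[of A ?N] fin NB hall_cond by (meson finite_subset)
  have mB: "m ` A = B"
    using m NB cA cB fin by (intro card_subset_eq) (auto simp: card_image)
  obtain xs where xs: "set xs = A" "distinct xs" using finite_distinct_list[OF fin(1)] by blast
  let ?ps = "map (\<lambda>a. (a, m a)) xs"
  have fs: "map fst ?ps = xs" "map snd ?ps = map m xs" by (simp_all add: o_def)
  have "matching H ?ps"
    unfolding matching_def fs using xs m AB(2) mB by (auto simp: distinct_map)
  moreover have "covered ?ps = verts H"
    unfolding covered_def using xs mB AB(1) by (auto simp: image_image)
  moreover have "length ?ps = n" using xs cA distinct_card by fastforce
  ultimately show ?thesis by blast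
qed

text \<open>If \<open>w\<close> and \<open>w'\<close> were not adjacent, a maximal independent set containing both would miss the pair \<open>x, y\<close> and be too
small. If they were another matched pair, \<open>depth_le_pinched_pair\<close> would apply to a
set \<open>F\<close> that misses two pairs, and the depth would be too small.\<close>

theorem cohen_macaulay_bipartite_foldable:
  fixes H :: "'v graph"
  assumes H: "simple_graph H" and ni: "no_isolated_vertices H" and bip: "bipartite H"
    and CM: "cohen_macaulay_graph TYPE('k::field) H"
  shows "\<exists>ps. matching H ps \<and> foldable H ps \<and> covered ps = verts H \<and>
    edge_ring_depth TYPE('k) H = enat (length ps)"
proof -
  obtain A B where AB: "A \<union> B = verts H" "A \<inter> B = {}" "\<forall>e\<in>edges H. \<exists>a\<in>A. \<exists>b\<in>B. e = {a, b}"
    using bip unfolding bipartite_def by blast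
  have "independent_set H {}" by (simp add: independent_set_def)
  then obtain F0 where F0: "maximal_independent H F0" using maximal_independent_extend[OF H] by blast
  define n where "n = card F0"
  have depth: "edge_ring_depth TYPE('k) H = enat n" unfolding n_def by (rule cohen_macaulay_depth[OF H CM F0])
  have un: "card F = n" if "maximal_independent H F" for F
    using cohen_macaulay_depth[OF H CM that] depth by simp
  obtain ps where m: "matching H ps" and cov: "covered ps = verts H" and len: "length ps = n"
    using bipartite_unmixed_matching[OF H ni AB un] by blast
  have d: "distinct (map fst ps @ map snd ps)" using m by (simp add: matching_def)
  have psV: "set ps \<subseteq> verts H \<times> verts H" using cov unfolding covered_def by force
  have cardps: "card (set ps) = n" using card_set_matching[OF m] len by simp
  have tr: "{w, w'} \<in> edges H" if xy: "(x, y) \<in> set ps" and w: "{x, w} \<in> edges H" "{y, w'} \<in> edges H" for x y w w'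
  proof (rule ccontr)
    assume nw: "{w, w'} \<notin> edges H"
    have V: "w \<in> verts H" "w' \<in> verts H" using simple_graph_edge[OF H w(1)] simple_graph_edge[OF H w(2)] by auto
    have "independent_set H {w, w'}"
      unfolding independent_set_def using V nw simple_graph_edge(3)[OF H, of w w] simple_graph_edge(3)[OF H, of w' w'] edges_sym[of w w' H]
      by auto
    then obtain F where F: "{w, w'} \<subseteq> F" "maximal_independent H F" using maximal_independent_extend[OF H] by blast
    then have ind: "independent_set H F" by (simp add: maximal_independent_def)
    have "x \<notin> F" "y \<notin> F" using ind F(1) w unfolding independent_set_def by blast+
    then have "card F \<le> card (set ps - {(x, y)})"
      using ind cov by (intro independent_card_le_pairs[OF H m]) (auto simp: independent_set_def)
    also have "\<dots> < n" unfolding cardps[symmetric] using xy by (intro card_Diff1_less) auto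
    finally show False using un[OF F(2)] by simp
  qed
  have acyclic: "{w, w'} \<noteq> {x', y'}"
    if xy: "(x, y) \<in> set ps" and w: "{x, w} \<in> edges H" "{y, w'} \<in> edges H"
      and xy': "(x', y') \<in> set ps" "(x', y') \<noteq> (x, y)" for x y w w' x' y'
  proof
    assume ww: "{w, w'} = {x', y'}"
    have exy: "{x, y} \<in> edges H" by (rule matching_edge[OF m xy])
    have V: "x \<in> verts H" "y \<in> verts H" using simple_graph_edge[OF H exy] by auto
    \<comment> \<open>A maximal such \<open>F\<close> satisfies the hypotheses of \<open>depth_le_pinched_pair\<close>: a vertex that could not be
added is adjacent to \<open>F\<close> or to one of \<open>x\<close> and \<open>y\<close>.\<close>
    define P where "P F \<longleftrightarrow> independent_set H (insert x F) \<and> independent_set H (insert y F) \<and> x \<notin> F \<and> y \<notin> F" for F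
    have fV: "finite (verts H)" using H by (simp add: simple_graph_def)
    have P0: "P {}" unfolding P_def independent_insert_iff[OF H] using V by (simp add: independent_set_def)
    have PV: "P F \<Longrightarrow> F \<subseteq> verts H" for F unfolding P_def independent_set_def by blast
    obtain F where F: "P F" "\<And>F'. P F' \<Longrightarrow> F \<subseteq> F' \<Longrightarrow> F' = F"
      using maximal_property_extend[of "verts H" P "{}", OF fV P0 PV] by blast
    have Fx: "independent_set H (insert x F)" "x \<notin> F" and Fy: "independent_set H (insert y F)" "y \<notin> F"
      using F(1) by (auto simp: P_def)
    have ind: "independent_set H F" by (rule independent_subset[OF Fx(1)]) blast
    have mx: "\<exists>u\<in>insert x (insert y F). {u, t} \<in> edges H" if t: "t \<in> verts H - insert x (insert y F)" for t
    proof (rule ccontr)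
      assume no: "\<not> ?thesis"
      have "independent_set H (insert t (insert x F))" "independent_set H (insert t (insert y F))"
        unfolding independent_insert_iff[OF H, of t] using Fx Fy t no by auto
      then have "P (insert t F)" using t Fx Fy by (auto simp: P_def insert_commute)
      then show False using F(2)[of "insert t F"] t by blast
    qed
    have "enat n \<le> enat (card F + 1)"
      using depth_le_pinched_pair[OF H exy tr[OF xy] Fx Fy mx, where 'k = 'k] depth by simp
    then have "n \<le> card F + 1" by simp
    have "w \<notin> F" "w' \<notin> F" using Fx(1) Fy(1) w unfolding independent_set_def by blast+
    then have nF: "x' \<notin> F" "y' \<notin> F" using ww by (auto simp: doubleton_eq_iff)
    have "card F \<le> card (set ps - {(x, y)} - {(x', y')})"
      using ind cov nF Fx Fy by (intro independent_card_le_pairs[OF H m]) (auto simp: independent_set_def)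
    moreover have "card (set ps - {(x, y)} - {(x', y')}) < card (set ps - {(x, y)})"
      using xy' by (intro card_Diff1_less) auto
    moreover have "card (set ps - {(x, y)}) < n" unfolding cardps[symmetric] using xy by (intro card_Diff1_less) auto
    ultimately show False using \<open>n \<le> card F + 1\<close> by linarith
  qed
  have "foldable H ps" by (rule foldableI[OF d psV tr acyclic])
  then show ?thesis using m cov depth len by blast
qed

section \<open>Gluing two graphs\<close>

lemma matching_remove_leaf:
  assumes H: "simple_graph H" and m: "matching H ps" and cov: "covered ps = verts H"
    and u: "u \<in> verts H" "neighborhood H u = {v}"
  obtains qs where "length ps = Suc (length qs)" "set qs \<subseteq> set ps"
    "distinct (map fst qs @ map snd qs)" "verts H = insert u (insert v (covered qs))"
    "u \<notin> covered qs" "v \<notin> covered qs"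
proof -
  have d: "distinct (map fst ps @ map snd ps)" using m by (simp add: matching_def)
  have "distinct ps" using d by (simp add: distinct_map)
  obtain x y where xy: "(x, y) \<in> set ps" "u \<in> {x, y}"
    using u(1) unfolding cov[symmetric] covered_def by fastforce
  have "{x, y} \<in> edges H" by (rule matching_edge[OF m xy(1)])
  moreover have "w = v" if "{u, w} \<in> edges H" for w
    using that u(2) edges_sym[of u w H] by (auto simp: neighborhood_def)
  ultimately have uv: "{x, y} = {u, v}"
    using xy(2) edges_sym[of x y H] by (auto simp: doubleton_eq_iff)
  define qs where "qs = remove1 (x, y) ps"
  have sq: "set qs = set ps - {(x, y)}" unfolding qs_def by (rule set_remove1_eq[OF \<open>distinct ps\<close>])
  have "length ps > 0" using xy(1) by (cases ps) auto
  then have len: "length ps = Suc (length qs)" using xy(1) by (simp add: qs_def length_remove1)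
  have q: "x \<notin> covered qs" "y \<notin> covered qs"
    using distinct_pairs[OF d xy(1)] distinct_pairs[OF d _ xy(1)] unfolding covered_def sq by fastforce+
  have c: "covered ps = {x, y} \<union> covered qs"
    unfolding covered_def sq using xy(1) by force
  have "inj_on fst (set ps)" "inj_on snd (set ps)" "fst ` set ps \<inter> snd ` set ps = {}"
    using d by (auto simp: distinct_map)
  then have "distinct (map fst qs @ map snd qs)"
    using \<open>distinct ps\<close> unfolding distinct_append distinct_map sq set_map
    by (auto simp: qs_def inj_on_diff)
  moreover have "verts H = insert u (insert v (covered qs))" using c uv cov by auto
  moreover have "u \<notin> covered qs" "v \<notin> covered qs" using q uv by (auto simp: doubleton_eq_iff)
  ultimately show ?thesis using that[of qs] len sq by blast
qed

lemma depth_ge_foldable: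
  fixes H :: "'v graph"
  assumes H: "simple_graph H" and f: "foldable H ps"
    and zs: "length zs \<le> 1" "\<And>z. z \<in> set zs \<Longrightarrow> isolated H z \<and> z \<notin> covered ps"
  shows "enat (length ps + length zs) \<le> edge_ring_depth TYPE('k::field) H"
proof -
  let ?h = "(+>\<^bsub>polynomial_ring (verts H)\<^esub>) (edge_ideal H) :: ('v, 'k) mpolynomial \<Rightarrow> _"
  let ?fs = "map (\<lambda>(x, y). mvar x - mvar y) ps @ map mvar zs :: ('v, 'k) mpolynomial list"
  have reg: "regular_sequence (edge_ring H) (map ?h ?fs)"
    by (rule foldable_regular_sequence[OF H f zs(1)]) (use zs(2) in \<open>auto simp: covered_def\<close>)
  have "set (map ?h ?fs) \<subseteq> irrelevant_ideal H"
  proof -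
    have "set ?fs \<subseteq> pos_ideal H"
      by (rule foldable_sequence_pos[OF f]) (use zs(2) in \<open>auto simp: isolated_def\<close>)
    then show ?thesis unfolding irrelevant_ideal_eq[OF H] set_map[of ?h] by blast
  qed
  with reg have "enat (length (map ?h ?fs)) \<in> {enat (length xs) |xs.
      regular_sequence (edge_ring H :: ('v, 'k) mpolynomial set ring) xs \<and> set xs \<subseteq> irrelevant_ideal H}"
    by (intro CollectI exI[of _ "map ?h ?fs"] conjI refl)
  then show ?thesis unfolding edge_ring_depth_def ideal_depth_def by (intro Sup_upper) simp
qed

locale glueing =
  fixes G1 G2 G :: "'v graph" and u1 u2 v1 v2 :: 'v
  assumes S1: "simple_graph G1" and S2: "simple_graph G2" and disj: "verts G1 \<inter> verts G2 = {}"
    and u1: "u1 \<in> verts G1" and u2: "u2 \<in> verts G2"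
    and N1: "neighborhood G1 u1 = {v1}" and N2: "neighborhood G2 u2 = {v2}"
    and G: "G = circ G1 u1 G2 u2"
begin

definition \<phi> where "\<phi> = id(v2 := v1)"

lemma nbr: "{w, u1} \<in> edges G1 \<longleftrightarrow> w = v1" "{w, u2} \<in> edges G2 \<longleftrightarrow> w = v2"
  using N1 N2 by (auto simp: neighborhood_def)

lemma v_mem: "v1 \<in> verts G1" "v2 \<in> verts G2" "v1 \<noteq> u1" "v2 \<noteq> u2" "v1 \<notin> verts G2" "v2 \<notin> verts G1"
  using simple_graph_edge[OF S1, of v1 u1] simple_graph_edge[OF S2, of v2 u2] nbr disj by auto

lemma verts_G: "verts G = (verts G1 - {u1}) \<union> (verts G2 - {u2, v2})"
  using v_mem by (auto simp: G circ_def N1 N2 graph_union_def remove_vertex_def map_graph_def)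

lemma edges_G: "edges G = {e \<in> edges G1. u1 \<notin> e} \<union> (\<lambda>e. \<phi> ` e) ` {e \<in> edges G2. u2 \<notin> e}"
  by (simp add: G circ_def N1 N2 graph_union_def remove_vertex_def map_graph_def \<phi>_def)

lemma edge_G1: "{a, b} \<in> edges G1 \<Longrightarrow> a \<noteq> u1 \<Longrightarrow> b \<noteq> u1 \<Longrightarrow> {a, b} \<in> edges G"
  unfolding edges_G by (rule UnI1) simp

lemma edge_G2:
  assumes "{a, b} \<in> edges G2" "a \<noteq> u2" "b \<noteq> u2"
  shows "{\<phi> a, \<phi> b} \<in> edges G"
proof -
  have "{a, b} \<in> {e \<in> edges G2. u2 \<notin> e}" using assms by simp
  then have "\<phi> ` {a, b} \<in> edges G" unfolding edges_G by (rule UnI2[OF imageI])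
  then show ?thesis by simp
qed

lemma pair_of_edge:
  assumes "simple_graph H" "e \<in> edges H"
  obtains a b where "e = {a, b}" "a \<noteq> b"
proof -
  have "card e = 2" using assms by (simp add: simple_graph_def)
  then obtain a b where "e = {a, b}" "a \<noteq> b" unfolding card_2_iff by (elim exE conjE)
  then show ?thesis by (rule that)
qed

lemma edge_G_cases:
  assumes "{x, w} \<in> edges G"
  obtains "{x, w} \<in> edges G1" "x \<noteq> u1" "w \<noteq> u1"
  | a b where "x = \<phi> a" "w = \<phi> b" "{a, b} \<in> edges G2" "a \<noteq> u2" "b \<noteq> u2"
proof -
  consider "{x, w} \<in> edges G1" "u1 \<notin> {x, w}" | e where "e \<in> edges G2" "u2 \<notin> e" "{x, w} = \<phi> ` e"
    using assms unfolding edges_G by (elim UnE imageE CollectE conjE)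
  then show ?thesis
  proof cases
    case 1
    then show ?thesis by (intro that(1)) auto
  next
    case 2
    obtain a b where ab: "e = {a, b}" by (rule pair_of_edge[OF S2 2(1)])
    then have "{x, w} = {\<phi> a, \<phi> b}" using 2(3) by simp
    then consider "x = \<phi> a" "w = \<phi> b" | "x = \<phi> b" "w = \<phi> a" by (auto simp: doubleton_eq_iff)
    then show ?thesis
    proof cases
      case 1
      then show ?thesis by (rule that(2)) (use \<open>e \<in> edges G2\<close> \<open>u2 \<notin> e\<close> ab in auto)
    next
      case 2
      then show ?thesis
        by (rule that(2)) (use \<open>e \<in> edges G2\<close> \<open>u2 \<notin> e\<close> ab edges_sym[of a b G2] in auto)
    qed
  qed
qed

lemma phi_V2: "a \<in> verts G2 \<Longrightarrow> \<phi> a = (if a = v2 then v1 else a)"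
  by (simp add: \<phi>_def)

lemma simple_G: "simple_graph G"
  unfolding simple_graph_def
proof (intro conjI ballI)
  show "finite (verts G)" using S1 S2 by (simp add: verts_G simple_graph_def)
  fix e assume "e \<in> edges G"
  then consider "e \<in> edges G1" "u1 \<notin> e" | e' where "e' \<in> edges G2" "u2 \<notin> e'" "e = \<phi> ` e'"
    unfolding edges_G by (elim UnE imageE CollectE conjE)
  then have "e \<subseteq> verts G \<and> card e = 2"
  proof cases
    case 1
    then show ?thesis using S1 by (auto simp: simple_graph_def verts_G)
  next
    case 2
    obtain a b where ab: "e' = {a, b}" "a \<noteq> b" by (rule pair_of_edge[OF S2 2(1)])
    have V: "a \<in> verts G2" "b \<in> verts G2" using simple_graph_edge[OF S2, of a b] 2(1) ab by auto
    have "\<phi> a \<noteq> \<phi> b" using V ab(2) v_mem by (auto simp: phi_V2)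
    moreover have "\<phi> a \<in> verts G" "\<phi> b \<in> verts G" using V v_mem 2(2) ab by (auto simp: phi_V2 verts_G)
    ultimately show ?thesis using 2(3) ab(1) by simp
  qed
  then show "e \<subseteq> verts G" "card e = 2" by auto
qed

lemma nbr_G_left:
  assumes "{x, w} \<in> edges G" "x \<in> verts G1" "x \<noteq> v1"
  shows "{x, w} \<in> edges G1" "w \<noteq> u1"
proof -
  have "{x, w} \<in> edges G1 \<and> w \<noteq> u1"
    using assms(1)
  proof (cases rule: edge_G_cases)
    case (2 a b)
    have "a \<in> verts G2" using simple_graph_edge[OF S2 2(3)] by simp
    then have "x \<in> insert v1 (verts G2)" using 2(1) by (auto simp: phi_V2)
    then show ?thesis using assms(2,3) disj by blast
  qed simp
  then show "{x, w} \<in> edges G1" "w \<noteq> u1" by auto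
qed

lemma nbr_G_right:
  assumes "{x, w} \<in> edges G" "x \<in> verts G2" "x \<noteq> v2"
  shows "\<exists>b. w = \<phi> b \<and> {x, b} \<in> edges G2 \<and> b \<noteq> u2"
  using assms(1)
proof (cases rule: edge_G_cases)
  case 1
  then have "x \<in> verts G1" using simple_graph_edge[OF S1 1(1)] by simp
  then show ?thesis using assms(2) disj by blast
next
  case (2 a b)
  have "a \<in> verts G2" using simple_graph_edge[OF S2 2(3)] by simp
  then have "a = x" using 2(1) assms v_mem by (auto simp: phi_V2 split: if_splits)
  then show ?thesis using 2 by blast
qed

text \<open>The ends of the remaining matched edges differ from \<open>v1\<close> and \<open>v2\<close>, so all their neighbours come from
the same graph \<open>G1\<close> or \<open>G2\<close>, and the conditions are inherited from there.\<close>

lemma glued_foldable: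
  assumes f1: "foldable G1 ps1" and f2: "foldable G2 ps2"
    and q1: "set qs1 \<subseteq> set ps1" "distinct (map fst qs1 @ map snd qs1)" "u1 \<notin> covered qs1" "v1 \<notin> covered qs1"
    and q2: "set qs2 \<subseteq> set ps2" "distinct (map fst qs2 @ map snd qs2)" "u2 \<notin> covered qs2" "v2 \<notin> covered qs2"
  shows "foldable G (qs1 @ qs2)"
proof -
  have V1: "x \<in> verts G1 - {u1, v1}" "y \<in> verts G1 - {u1, v1}" if "(x, y) \<in> set qs1" for x y
    using f1 q1 that by (auto simp: foldable_def covered_def rev_image_eqI)
  have V2: "x \<in> verts G2 - {u2, v2}" "y \<in> verts G2 - {u2, v2}" if "(x, y) \<in> set qs2" for x y
    using f2 q2 that by (auto simp: foldable_def covered_def rev_image_eqI)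
  have c1: "covered qs1 \<subseteq> verts G1 - {u1, v1}"
  proof
    fix z assume "z \<in> covered qs1"
    then obtain x y where "(x, y) \<in> set qs1" "z = x \<or> z = y" unfolding covered_def by force
    then show "z \<in> verts G1 - {u1, v1}" using V1[of x y] by blast
  qed
  have c2: "covered qs2 \<subseteq> verts G2 - {u2, v2}"
  proof
    fix z assume "z \<in> covered qs2"
    then obtain x y where "(x, y) \<in> set qs2" "z = x \<or> z = y" unfolding covered_def by force
    then show "z \<in> verts G2 - {u2, v2}" using V2[of x y] by blast
  qed
  have d: "distinct (map fst (qs1 @ qs2) @ map snd (qs1 @ qs2))"
  proof -
    have "covered qs1 \<inter> covered qs2 = {}" using c1 c2 disj by blast
    then show ?thesis using q1(2) q2(2) unfolding covered_def by auto
  qed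
  have sub: "set (qs1 @ qs2) \<subseteq> verts G \<times> verts G"
  proof
    fix p assume p: "p \<in> set (qs1 @ qs2)"
    obtain x y where xy: "p = (x, y)" by force
    have "x \<in> verts G \<and> y \<in> verts G" using p V1[of x y] V2[of x y] unfolding xy by (auto simp: verts_G)
    then show "p \<in> verts G \<times> verts G" by (simp add: xy)
  qed
  have pair1: "{w, w'} \<in> edges G"
      "\<And>x' y'. (x', y') \<in> set (qs1 @ qs2) \<Longrightarrow> (x', y') \<noteq> (x, y) \<Longrightarrow> {w, w'} \<noteq> {x', y'}"
    if xy: "(x, y) \<in> set qs1" and w: "{x, w} \<in> edges G" "{y, w'} \<in> edges G" for x y w w'
  proof -
    have xy1: "(x, y) \<in> set ps1" using xy q1(1) by blast
    have w1: "{x, w} \<in> edges G1" "w \<noteq> u1" using nbr_G_left[OF w(1)] V1[OF xy] by auto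
    have w2: "{y, w'} \<in> edges G1" "w' \<noteq> u1" using nbr_G_left[OF w(2)] V1[OF xy] by auto
    have e: "{w, w'} \<in> edges G1" by (rule foldableD(1)[OF f1 xy1 w1(1) w2(1)])
    show "{w, w'} \<noteq> {x', y'}" if p: "(x', y') \<in> set (qs1 @ qs2)" "(x', y') \<noteq> (x, y)" for x' y'
    proof (cases "(x', y') \<in> set qs1")
      case True
      then show ?thesis using foldableD(2)[OF f1 xy1 w1(1) w2(1) subsetD[OF q1(1) True] p(2)] by simp
    next
      case False
      then have "x' \<in> verts G2" using V2[of x' y'] p by auto
      moreover have "w \<in> verts G1" "w' \<in> verts G1" using simple_graph_edge[OF S1 e] by auto
      ultimately show ?thesis using disj by (auto simp: doubleton_eq_iff)
    qed
    show "{w, w'} \<in> edges G" by (rule edge_G1[OF e w1(2) w2(2)])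
  qed
  have pair2: "{w, w'} \<in> edges G"
      "\<And>x' y'. (x', y') \<in> set (qs1 @ qs2) \<Longrightarrow> (x', y') \<noteq> (x, y) \<Longrightarrow> {w, w'} \<noteq> {x', y'}"
    if xy: "(x, y) \<in> set qs2" and w: "{x, w} \<in> edges G" "{y, w'} \<in> edges G" for x y w w'
  proof -
    have xy2: "(x, y) \<in> set ps2" using xy q2(1) by blast
    obtain a where a: "w = \<phi> a" "{x, a} \<in> edges G2" "a \<noteq> u2" using nbr_G_right[OF w(1)] V2[OF xy] by auto
    obtain b where b: "w' = \<phi> b" "{y, b} \<in> edges G2" "b \<noteq> u2" using nbr_G_right[OF w(2)] V2[OF xy] by auto
    have e: "{a, b} \<in> edges G2" by (rule foldableD(1)[OF f2 xy2 a(2) b(2)])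
    have Vab: "a \<in> verts G2" "b \<in> verts G2" using simple_graph_edge[OF S2 e] by auto
    show "{w, w'} \<noteq> {x', y'}" if p: "(x', y') \<in> set (qs1 @ qs2)" "(x', y') \<noteq> (x, y)" for x' y'
    proof
      assume ww: "{w, w'} = {x', y'}"
      show False
      proof (cases "(x', y') \<in> set qs2")
        case True
        then have n: "{a, b} \<noteq> {x', y'}" using foldableD(2)[OF f2 xy2 a(2) b(2) subsetD[OF q2(1) True] p(2)] by simp
        have "x' \<noteq> v1" "y' \<noteq> v1" using V2[OF True] v_mem by auto
        then have "w \<noteq> v1" "w' \<noteq> v1" using ww by (auto simp: doubleton_eq_iff)
        then have "w = a" "w' = b" using a(1) b(1) Vab by (auto simp: phi_V2 split: if_splits)
        then show False using n ww by simp
      next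
        case False
        then have x': "x' \<in> verts G1" "x' \<noteq> v1" using V1[of x' y'] p by auto
        have "x' = w \<or> x' = w'" using ww by (auto simp: doubleton_eq_iff)
        then have "x' \<in> insert v1 (verts G2)" using a(1) b(1) Vab by (auto simp: phi_V2)
        then show False using x' disj by blast
      qed
    qed
    show "{w, w'} \<in> edges G" using edge_G2[OF e a(3) b(3)] a(1) b(1) by simp
  qed
  show ?thesis
  proof (rule foldableI[OF d sub])
    fix x y w w' assume xy: "(x, y) \<in> set (qs1 @ qs2)" and w: "{x, w} \<in> edges G" "{y, w'} \<in> edges G"
    from xy consider "(x, y) \<in> set qs1" | "(x, y) \<in> set qs2" by auto
    note cases = this
    show "{w, w'} \<in> edges G"
      using cases by cases (rule pair1(1)[OF _ w], assumption, rule pair2(1)[OF _ w], assumption)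
    fix x' y' assume p: "(x', y') \<in> set (qs1 @ qs2)" "(x', y') \<noteq> (x, y)"
    show "{w, w'} \<noteq> {x', y'}"
      using cases by cases (rule pair1(2)[OF _ w p], assumption, rule pair2(2)[OF _ w p], assumption)
  qed
qed

lemma glued_matching:
  assumes m1: "matching G1 ps1" and m2: "matching G2 ps2"
    and q1: "set qs1 \<subseteq> set ps1" "u1 \<notin> covered qs1"
    and q2: "set qs2 \<subseteq> set ps2" "u2 \<notin> covered qs2" "v2 \<notin> covered qs2"
    and d: "distinct (map fst (qs1 @ qs2) @ map snd (qs1 @ qs2))"
  shows "matching G (qs1 @ qs2)"
  unfolding matching_def
proof (intro conjI d ballI, clarify)
  fix x y assume "(x, y) \<in> set (qs1 @ qs2)"
  then consider "(x, y) \<in> set qs1" | "(x, y) \<in> set qs2" by auto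
  then show "{x, y} \<in> edges G"
  proof cases
    case 1
    then have "{x, y} \<in> edges G1" using matching_edge[OF m1] q1(1) by blast
    moreover have "x \<noteq> u1" "y \<noteq> u1" using 1 q1(2) unfolding covered_def by force+
    ultimately show ?thesis by (rule edge_G1)
  next
    case 2
    then have e: "{x, y} \<in> edges G2" using matching_edge[OF m2] q2(1) by blast
    have n: "x \<noteq> u2" "y \<noteq> u2" "x \<noteq> v2" "y \<noteq> v2" using 2 q2(2,3) unfolding covered_def by force+
    then show ?thesis using edge_G2[OF e n(1,2)] by (simp add: \<phi>_def)
  qed
qed

lemma isolated_v1_iff:
  "isolated G v1 \<longleftrightarrow> vdegree G1 v1 = 1 \<and> vdegree G2 v2 = 1"
proof -
  have deg1: "vdegree G1 v1 = 1 \<longleftrightarrow> neighborhood G1 v1 = {u1}"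
  proof -
    have "u1 \<in> neighborhood G1 v1"
      using nbr(1)[of v1] edges_sym[of u1 v1 G1] by (simp add: neighborhood_def)
    then show ?thesis by (auto simp: vdegree_def card_1_singleton_iff)
  qed
  have deg2: "vdegree G2 v2 = 1 \<longleftrightarrow> neighborhood G2 v2 = {u2}"
  proof -
    have "u2 \<in> neighborhood G2 v2"
      using nbr(2)[of v2] edges_sym[of u2 v2 G2] by (simp add: neighborhood_def)
    then show ?thesis by (auto simp: vdegree_def card_1_singleton_iff)
  qed
  have v1G: "v1 \<in> verts G" using v_mem by (auto simp: verts_G)
  show ?thesis
  proof
    assume iso: "isolated G v1"
    have "w = u1" if w: "{w, v1} \<in> edges G1" for w
      using iso edge_G1[OF w] v_mem(3) by (auto simp: isolated_def neighborhood_def)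
    moreover have "w = u2" if w: "{w, v2} \<in> edges G2" for w
      using iso edge_G2[OF w] v_mem(4) by (auto simp: isolated_def neighborhood_def \<phi>_def)
    ultimately show "vdegree G1 v1 = 1 \<and> vdegree G2 v2 = 1"
      using nbr(1)[of v1] nbr(2)[of v2] unfolding deg1 deg2 by (auto simp: neighborhood_def insert_commute)
  next
    assume "vdegree G1 v1 = 1 \<and> vdegree G2 v2 = 1"
    then have n: "neighborhood G1 v1 = {u1}" "neighborhood G2 v2 = {u2}" unfolding deg1 deg2 by auto
    have "{w, v1} \<notin> edges G" for w
    proof
      assume "{w, v1} \<in> edges G"
      then show False
      proof (cases rule: edge_G_cases)
        case 1
        then show ?thesis using n(1) by (auto simp: neighborhood_def)
      next
        case (2 a b)
        have "b \<in> verts G2" using simple_graph_edge[OF S2 2(3)] by simp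
        then have "b = v2" using 2(2) v_mem by (auto simp: phi_V2 split: if_splits)
        then show ?thesis using n(2) 2 by (auto simp: neighborhood_def)
      qed
    qed
    then show "isolated G v1" using v1G by (auto simp: isolated_def neighborhood_def)
  qed
qed

end

section \<open>The depth of the glued graph\<close>

theorem theorem4p2:
  fixes G1 G2 G :: "'v graph" and u1 u2 v1 v2 :: 'v
  assumes "simple_graph G1" and "simple_graph G2"
    and "no_isolated_vertices G1" and "no_isolated_vertices G2"
    and "verts G1 \<inter> verts G2 = {}"
    and "bipartite G1" and "bipartite G2"
    and "cohen_macaulay_graph TYPE('k::field) G1" and "cohen_macaulay_graph TYPE('k) G2"
    and "leaf G1 u1" and "leaf G2 u2"
    and "neighborhood G1 u1 = {v1}" and "neighborhood G2 u2 = {v2}"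
    and "G = circ G1 u1 G2 u2"
  shows "\<exists>d d1 d2 :: nat.
    edge_ring_depth TYPE('k) G = enat d \<and>
    edge_ring_depth TYPE('k) G1 = enat d1 \<and>
    edge_ring_depth TYPE('k) G2 = enat d2 \<and>
    int d = int d1 + int d2 - (if vdegree G1 v1 = 1 \<and> vdegree G2 v2 = 1 then 1 else 2)"
proof -
  interpret glueing G1 G2 G u1 u2 v1 v2
    using assms by unfold_locales (simp_all add: leaf_def)
  obtain ps1 where ps1: "matching G1 ps1" "foldable G1 ps1" "covered ps1 = verts G1"
    "edge_ring_depth TYPE('k) G1 = enat (length ps1)"
    using cohen_macaulay_bipartite_foldable[OF S1 assms(3,6,8)] by blast
  obtain ps2 where ps2: "matching G2 ps2" "foldable G2 ps2" "covered ps2 = verts G2"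
    "edge_ring_depth TYPE('k) G2 = enat (length ps2)"
    using cohen_macaulay_bipartite_foldable[OF S2 assms(4,7,9)] by blast
  obtain qs1 where q1: "length ps1 = Suc (length qs1)" "set qs1 \<subseteq> set ps1"
    "distinct (map fst qs1 @ map snd qs1)" "verts G1 = insert u1 (insert v1 (covered qs1))"
    "u1 \<notin> covered qs1" "v1 \<notin> covered qs1"
    using matching_remove_leaf[OF S1 ps1(1,3) u1 N1] by blast
  obtain qs2 where q2: "length ps2 = Suc (length qs2)" "set qs2 \<subseteq> set ps2"
    "distinct (map fst qs2 @ map snd qs2)" "verts G2 = insert u2 (insert v2 (covered qs2))"
    "u2 \<notin> covered qs2" "v2 \<notin> covered qs2"
    using matching_remove_leaf[OF S2 ps2(1,3) u2 N2] by blast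
  let ?qs = "qs1 @ qs2"
  have fold: "foldable G ?qs"
    by (rule glued_foldable[OF ps1(2) ps2(2) q1(2,3,5,6) q2(2,3,5,6)])
  then have d: "distinct (map fst ?qs @ map snd ?qs)" by (simp only: foldable_def)
  have m: "matching G ?qs" by (rule glued_matching[OF ps1(1) ps2(1) q1(2,5) q2(2,5,6) d])
  have cov: "covered ?qs = covered qs1 \<union> covered qs2" by (auto simp: covered_def)
  have "covered qs1 \<inter> verts G2 = {}" "covered qs2 \<inter> verts G1 = {}" using q1(4) q2(4) disj by auto
  then have v1q: "v1 \<notin> covered ?qs" and VG: "verts G = insert v1 (covered ?qs)"
    unfolding cov verts_G using q1(4-6) q2(4-6) v_mem by auto
  \<comment> \<open>All vertices but \<open>v1\<close> are covered by the matching, which bounds the independent sets avoiding \<open>v1\<close>.\<close>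
  have le: "card F \<le> length ?qs" if F: "independent_set G F" "v1 \<notin> F" for F
  proof -
    have "F \<subseteq> covered ?qs" using F VG by (auto simp: independent_set_def)
    then have "card F \<le> card (set ?qs)" by (intro independent_card_le_pairs[OF simple_G m F(1)]) auto
    then show ?thesis using card_set_matching[OF m] by simp
  qed
  have "edge_ring_depth TYPE('k) G = enat (length ?qs + (if isolated G v1 then 1 else 0))"
  proof (cases "isolated G v1")
    case True
    have "enat (length ?qs + length [v1]) \<le> edge_ring_depth TYPE('k) G"
      by (rule depth_ge_foldable[OF simple_G fold]) (use True v1q in auto)
    moreover have "edge_ring_depth TYPE('k) G \<le> enat (length ?qs + 1)"
    proof -
      have "independent_set G {}" by (simp add: independent_set_def)
      then obtain F where F: "maximal_independent G F" using maximal_independent_extend[OF simple_G] by blast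
      then have ind: "independent_set G F" by (simp add: maximal_independent_def)
      have "independent_set G (F - {v1})" by (rule independent_subset[OF ind]) blast
      then have "card (F - {v1}) \<le> length ?qs" by (rule le) blast
      then have "card F \<le> length ?qs + 1"
        using independent_finite[OF simple_G ind] by (auto simp: card_Diff_singleton_if split: if_splits)
      then show ?thesis using depth_le_maximal_independent[OF simple_G F, where 'k = 'k] order_trans by fastforce
    qed
    ultimately show ?thesis using True by simp
  next
    case False
    have "enat (length ?qs + length ([] :: 'v list)) \<le> edge_ring_depth TYPE('k) G"
      by (rule depth_ge_foldable[OF simple_G fold]) auto
    moreover have "edge_ring_depth TYPE('k) G \<le> enat (length ?qs)"
    proof -
      \<comment> \<open>A maximal independent set containing a neighbour of \<open>v1\<close> avoids \<open>v1\<close>.\<close>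
      obtain w where w: "{w, v1} \<in> edges G" using False VG by (auto simp: isolated_def neighborhood_def)
      have "independent_set G {w}" using simple_graph_edge[OF simple_G w] simple_graph_edge(3)[OF simple_G, of w w]
        by (auto simp: independent_set_def)
      then obtain F where F: "{w} \<subseteq> F" "maximal_independent G F" using maximal_independent_extend[OF simple_G] by blast
      then have ind: "independent_set G F" by (simp add: maximal_independent_def)
      have "v1 \<notin> F" using ind F(1) w by (auto simp: independent_set_def)
      then have "card F \<le> length ?qs" by (rule le[OF ind])
      then show ?thesis using depth_le_maximal_independent[OF simple_G F(2), where 'k = 'k] order_trans by fastforce
    qed
    ultimately show ?thesis using False by simp
  qed
  then show ?thesis
    using ps1(4) ps2(4) q1(1) q2(1) unfolding isolated_v1_iff
    by (intro exI[of _ "length ?qs + (if vdegree G1 v1 = 1 \<and> vdegree G2 v2 = 1 then 1 else 0)"]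
        exI[of _ "length ps1"] exI[of _ "length ps2"]) auto
qed

end
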